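(* Let $(T(t))_{t\ge0}$ be a bounded $C_0$-semigroup on a complex Hilbert space $X$, with generator $A$. Furthermore, let $1\le p<\infty$ and $\beta>0$, and suppose that $$\int_0^{\infty} |\langle T(t)x, y \rangle|^p \, \mathrm{d} t < \infty,\qquad x \in D((-A)^\beta),\ y \in X.$$ Then $i\mathbb{R}\subseteq\rho(A)$ and $$\| T(t) A^{-1} \| = O\big(t^{-1/(p\beta)}\big), \qquad t \to \infty.$$ Furthermore, $\| T(t) x\| = o\big(t^{-1/(p\beta)}\big)$ as $t \to \infty$ for all $x\in D(A)$.
   Context: A $C_0$-semigroup $(T(t))_{t\ge0}$ is bounded if $\sup_{t\ge0}\|T(t)\|<\infty$. $D(A)$ and $\rho(A)$ denote the domain and the resolvent set of $A$, and $\langle\cdot,\cdot\rangle$ is the inner product of $X$. $(-A)^\beta$ is the usual fractional power of the sectorial operator $-A$; its domain $D((-A)^\beta)$ coincides with the range of the bounded injective operator $(I-A)^{-\beta}=\frac{1}{\Gamma(\beta)}\int_0^\infty t^{\beta-1}e^{-t}T(t)\,\mathrm{d}t$ (strong integral). *)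

theory Defs
  imports "HOL-Analysis.Analysis" "HOL-Library.Landau_Symbols"
begin

section \<open>Complex Hilbert spaces\<close>

text \<open>The inner product is linear in its first argument. The real Banach space structure inherited
  from \<open>banach\<close> is the underlying real structure (\<open>scaleR_scaleC\<close>), its norm is the one induced by
  the inner product, and completeness comes from \<open>banach\<close>.\<close>

class complex_hilbert_space = banach +
  fixes scaleC :: "complex \<Rightarrow> 'a \<Rightarrow> 'a" (infixr \<open>*\<^sub>C\<close> 75)
    and cinner :: "'a \<Rightarrow> 'a \<Rightarrow> complex"
  assumes scaleC_add_right: "c *\<^sub>C (x + y) = c *\<^sub>C x + c *\<^sub>C y"
    and scaleC_add_left: "(c + d) *\<^sub>C x = c *\<^sub>C x + d *\<^sub>C x"
    and scaleC_scaleC: "c *\<^sub>C (d *\<^sub>C x) = (c * d) *\<^sub>C x"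
    and scaleR_scaleC: "r *\<^sub>R x = complex_of_real r *\<^sub>C x"
    and cinner_commute: "cinner x y = cnj (cinner y x)"
    and cinner_add_left: "cinner (x + y) z = cinner x z + cinner y z"
    and cinner_scaleC_left: "cinner (c *\<^sub>C x) y = c * cinner x y"
    and cinner_ge_zero: "0 \<le> Re (cinner x x)"
    and cinner_eq_zero_iff: "cinner x x = 0 \<longleftrightarrow> x = 0"
    and norm_eq_sqrt_cinner: "norm x = sqrt (Re (cinner x x))"

instantiation complex :: complex_hilbert_space
begin

definition scaleC_complex :: "complex \<Rightarrow> complex \<Rightarrow> complex"
  where "scaleC_complex c x = c * x"

definition cinner_complex :: "complex \<Rightarrow> complex \<Rightarrow> complex"
  where "cinner_complex x y = x * cnj y"

instance
  by standard
    (auto simp: scaleC_complex_def cinner_complex_def algebra_simps scaleR_conv_of_real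
      cmod_def power2_eq_square)

end

definition bounded_clinear ::
    "('a::complex_hilbert_space \<Rightarrow> 'b::complex_hilbert_space) \<Rightarrow> bool" where
  "bounded_clinear f \<longleftrightarrow> bounded_linear f \<and> (\<forall>c x. f (c *\<^sub>C x) = c *\<^sub>C f x)"


section \<open>Unbounded operators\<close>

text \<open>A (partially defined) operator is represented by its graph, so \<open>Domain A\<close> is its domain.\<close>

type_synonym 'a operator = "('a \<times> 'a) set"

definition resolvent_set :: "'a::complex_hilbert_space operator \<Rightarrow> complex set" where
  "resolvent_set A =
     {z. \<exists>R. bounded_clinear R \<and> {(z *\<^sub>C x - y, x) |x y. (x, y) \<in> A} = {(w, R w) |w. True}}"

text \<open>Only meaningful if \<open>A\<close> is a bijection from its domain onto the whole space.\<close>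

definition op_inverse :: "'a operator \<Rightarrow> 'a \<Rightarrow> 'a" where
  "op_inverse A w = (THE x. (x, w) \<in> A)"


section \<open>Semigroups, generators and fractional powers\<close>

definition C0_semigroup :: "(real \<Rightarrow> 'a::complex_hilbert_space \<Rightarrow> 'a) \<Rightarrow> bool" where
  "C0_semigroup T \<longleftrightarrow>
     (\<forall>t\<ge>0. bounded_clinear (T t)) \<and>
     (\<forall>x. T 0 x = x) \<and>
     (\<forall>s\<ge>0. \<forall>t\<ge>0. \<forall>x. T (s + t) x = T s (T t x)) \<and>
     (\<forall>x. ((\<lambda>t. T t x) \<longlongrightarrow> x) (at_right 0))"

definition bounded_semigroup :: "(real \<Rightarrow> 'a::complex_hilbert_space \<Rightarrow> 'a) \<Rightarrow> bool" where
  "bounded_semigroup T \<longleftrightarrow> bdd_above ((\<lambda>t. onorm (T t)) ` {0..})"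

definition generator :: "(real \<Rightarrow> 'a::complex_hilbert_space \<Rightarrow> 'a) \<Rightarrow> 'a operator" where
  "generator T = {(x, y). ((\<lambda>t. (1 / t) *\<^sub>R (T t x - x)) \<longlongrightarrow> y) (at_right 0)}"

text \<open>For the generator \<open>A\<close> of a bounded semigroup \<open>T\<close> and \<open>\<epsilon>, \<beta> > 0\<close>, this is the bounded injective
  operator \<open>(\<epsilon> - A) powr -\<beta>\<close>. The integral is the Henstock--Kurzweil integral because the Bochner
  integral of the library is restricted to separable spaces; the integrand is continuous on
  \<open>{0<..}\<close> with integrable norm, so both agree.\<close>

definition shifted_neg_power ::
    "(real \<Rightarrow> 'a::complex_hilbert_space \<Rightarrow> 'a) \<Rightarrow> real \<Rightarrow> real \<Rightarrow> 'a \<Rightarrow> 'a" where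
  "shifted_neg_power T \<epsilon> \<beta> x =
     (1 / Gamma \<beta>) *\<^sub>R integral {0..} (\<lambda>t. (t powr (\<beta> - 1) * exp (- \<epsilon> * t)) *\<^sub>R T t x)"

text \<open>The fractional power \<open>(-A) powr \<beta>\<close> of the sectorial operator \<open>-A\<close>, where \<open>A\<close> is the generator
  of \<open>T\<close>, is the strong limit of \<open>(\<epsilon> - A) powr \<beta>\<close> as \<open>\<epsilon>\<close> decreases to \<open>0\<close>, with its
  natural domain; \<open>(\<epsilon> - A) powr \<beta>\<close> is the inverse of \<open>(\<epsilon> - A) powr -\<beta>\<close>, so that \<open>u \<epsilon>\<close> below is
  \<open>(\<epsilon> - A) powr \<beta>\<close> applied to \<open>x\<close> (cf. Martinez and Sanz, The Theory of Fractional Powers of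
  Operators). The domain coincides with the range of \<open>shifted_neg_power T 1 \<beta>\<close>.\<close>

definition neg_generator_power ::
    "(real \<Rightarrow> 'a::complex_hilbert_space \<Rightarrow> 'a) \<Rightarrow> real \<Rightarrow> 'a operator" where
  "neg_generator_power T \<beta> =
     {(x, y). \<exists>u. (\<forall>\<epsilon>>0. shifted_neg_power T \<epsilon> \<beta> (u \<epsilon>) = x) \<and> (u \<longlongrightarrow> y) (at_right 0)}"

end

theory Submission
  imports Defs "HOL-Probability.Probability" "HOL-Real_Asymp.Real_Asymp" "HOL-Computational_Algebra.Formal_Power_Series"
begin

text \<open>
  Testing the hypothesis on the range of \<open>S = (I - A) powr -\<beta>\<close> and using the uniform boundedness
  principle twice gives \<open>\<parallel>R(z) S\<parallel> \<le> C (Re z) powr (1/p - 1)\<close> for \<open>Re z > 0\<close>. Since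
  \<open>(S - (1 - z) powr -\<beta>) R(z)\<close> is uniformly bounded, this is a bound for \<open>R(z)\<close> itself up to the
  factor \<open>|1 - z| powr \<beta>\<close>, and the resolvent identity turns it into
  \<open>\<parallel>R(a + i s)\<parallel> \<le> K (1 + |s|) powr (p \<beta>)\<close> for \<open>0 < a \<le> 1/2\<close>; in particular \<open>i \<real> \<subseteq> \<rho>(A)\<close>.

  The passage to decay of \<open>T(t) R(1)\<close> (the theorem of Borichev and Tomilov) avoids fractional powers:
  with \<open>\<alpha> = p \<beta>\<close> and \<open>\<rho> = t powr (1/\<alpha>)\<close>, one writes \<open>R(1) = (R(1) - B) + B\<close> with
  \<open>B = (\<rho> R(\<rho>))^n R(1)\<close>. The first summand is of size \<open>1/\<rho>\<close>; for the second, \<open>R(z)^m B\<close> is of size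
  \<open>t^m / \<rho>\<close> on the line \<open>Re z = 1/t\<close>, and Plancherel's theorem for \<open>\<tau>^m T(\<tau>) B x\<close> gives
  \<open>\<parallel>T(t) B\<parallel> \<le> C / \<rho>\<close>. As \<open>X\<close> need not be separable, Plancherel's theorem is replaced by scalar double
  integrals of \<open>\<langle>g(t), g(u)\<rangle>\<close> against Gaussian weights.
\<close>

section \<open>Complex Hilbert spaces\<close>

text \<open>The domain in the hypothesis is defined by a strong limit, so \<open>S x\<close> can be
  tested only after its preimages under every (\<epsilon> - A) powr -\<beta> have been found and
  shown to converge as \<epsilon> decreases to 0. The binomial series of (1 - \<delta> R(1)) powr
  \<beta> supplies them: its coefficients are of order k powr (-1 - \<beta>), so it converges
  absolutely up to \<delta> = 1. The exponent p \<beta> balances two losses. On Re z = a the bound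
  is (1 + |s|) powr \<beta> times a powr (1/p - 1), and the resolvent identity continues it to the
  left once a times this is small, that is for a of order (1 + |s|) powr (-p \<beta>). In the second
  half the powers of the resolvent on B x are compared with R(z) x at each frequency; the factor
  R(z) left on the right makes the square integrals finite. Plancherel is needed as one inequality
  in each direction. A wide Gaussian in frequency is a narrow one in time differences, so the error
  vanishes as the width grows. The small-o rate uses that R(1) has dense range: on R(1) R(1) k the
  time can be split into halves, which squares the rate.\<close>

lemma scaleC_zero_left [simp]: "0 *\<^sub>C (x::'a::complex_hilbert_space) = 0"
  using scaleR_scaleC[of 0 x] by simp

lemma scaleC_one [simp]: "1 *\<^sub>C (x::'a::complex_hilbert_space) = x"
  using scaleR_scaleC[of 1 x] by simp

lemma scaleC_zero_right [simp]: "c *\<^sub>C (0::'a::complex_hilbert_space) = 0"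
  using scaleC_scaleC[of c 0 "0::'a"] by simp

lemma scaleC_minus_right: "c *\<^sub>C (- x) = - (c *\<^sub>C (x::'a::complex_hilbert_space))"
  using scaleC_add_right[of c x "-x"] by (metis add.right_inverse add_eq_0_iff scaleC_zero_right)

lemma scaleC_diff_right: "c *\<^sub>C (x - y) = c *\<^sub>C x - c *\<^sub>C (y::'a::complex_hilbert_space)"
  by (metis diff_conv_add_uminus scaleC_add_right scaleC_minus_right)

lemma scaleC_minus_left: "(- c) *\<^sub>C x = - (c *\<^sub>C (x::'a::complex_hilbert_space))"
  using scaleC_add_left[of c "-c" x] by (metis add.right_inverse add_eq_0_iff scaleC_zero_left)

lemma scaleC_diff_left: "(c - d) *\<^sub>C x = c *\<^sub>C x - d *\<^sub>C (x::'a::complex_hilbert_space)"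
  by (metis diff_conv_add_uminus scaleC_add_left scaleC_minus_left)

lemma scaleC_of_real: "complex_of_real r *\<^sub>C x = r *\<^sub>R (x::'a::complex_hilbert_space)"
  by (simp add: scaleR_scaleC)

lemma cinner_add_right: "cinner x (y + z) = cinner x y + cinner x (z::'a::complex_hilbert_space)"
  by (metis cinner_commute cinner_add_left complex_cnj_add)

lemma cinner_scaleC_right: "cinner x (c *\<^sub>C y) = cnj c * cinner x (y::'a::complex_hilbert_space)"
  by (metis cinner_commute cinner_scaleC_left complex_cnj_mult)

lemma cinner_scaleR_left: "cinner (r *\<^sub>R x) y = of_real r * cinner x (y::'a::complex_hilbert_space)"
  by (simp add: scaleR_scaleC cinner_scaleC_left)

lemma cinner_scaleR_right: "cinner x (r *\<^sub>R y) = of_real r * cinner x (y::'a::complex_hilbert_space)"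
  by (simp add: scaleR_scaleC cinner_scaleC_right)

lemma cinner_zero_left [simp]: "cinner 0 (y::'a::complex_hilbert_space) = 0"
  using cinner_scaleC_left[of 0 0 y] by simp

lemma cinner_zero_right [simp]: "cinner (y::'a::complex_hilbert_space) 0 = 0"
  using cinner_scaleC_right[of y 0 0] by simp

lemma cinner_minus_left: "cinner (- x) y = - cinner x (y::'a::complex_hilbert_space)"
  using cinner_add_left[of x "-x" y] by (metis add.right_inverse add_eq_0_iff cinner_zero_left)

lemma cinner_minus_right: "cinner x (- y) = - cinner x (y::'a::complex_hilbert_space)"
  using cinner_add_right[of x y "-y"] by (metis add.right_inverse add_eq_0_iff cinner_zero_right)

lemma cinner_diff_left: "cinner (x - y) z = cinner x z - cinner y (z::'a::complex_hilbert_space)"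
  by (metis diff_conv_add_uminus cinner_add_left cinner_minus_left)

lemma cinner_diff_right: "cinner x (y - z) = cinner x y - cinner x (z::'a::complex_hilbert_space)"
  by (metis diff_conv_add_uminus cinner_add_right cinner_minus_right)

lemma cinner_self: "cinner x x = of_real ((norm (x::'a::complex_hilbert_space))\<^sup>2)"
proof -
  have "Im (cinner x x) = 0"
    using cinner_commute[of x x] by (metis add_cancel_right_right complex_cnj_cancel_iff
        cnj.sel(2) minus_equation_iff neg_equal_zero)
  moreover have "Re (cinner x x) = (norm x)\<^sup>2"
    by (simp add: norm_eq_sqrt_cinner cinner_ge_zero)
  ultimately show ?thesis by (simp add: complex_eq_iff)
qed

lemma norm_scaleC: "norm (c *\<^sub>C x) = cmod c * norm (x::'a::complex_hilbert_space)"
proof -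
  have "cinner (c *\<^sub>C x) (c *\<^sub>C x) = (c * cnj c) * cinner x x"
    by (simp add: cinner_scaleC_left cinner_scaleC_right)
  also have "\<dots> = of_real ((cmod c * norm x)\<^sup>2)"
    by (simp add: cinner_self power_mult_distrib flip: complex_norm_square)
  finally have "cinner (c *\<^sub>C x) (c *\<^sub>C x) = of_real ((cmod c * norm x)\<^sup>2)" .
  hence "(norm (c *\<^sub>C x))\<^sup>2 = (cmod c * norm x)\<^sup>2"
    by (metis cinner_self of_real_eq_iff)
  thus ?thesis by (simp add: power2_eq_iff_nonneg)
qed

lemma norm_diff_square:
  "(norm (x - y))\<^sup>2 = (norm x)\<^sup>2 + (norm (y::'a::complex_hilbert_space))\<^sup>2 - 2 * Re (cinner x y)"
proof -
  have "cinner (x - y) (x - y) = cinner x x + cinner y y - (cinner x y + cnj (cinner x y))"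
    by (simp add: cinner_diff_left cinner_diff_right algebra_simps cinner_commute[of y x])
  hence "Re (cinner (x - y) (x - y)) = (norm x)\<^sup>2 + (norm y)\<^sup>2 - 2 * Re (cinner x y)"
    by (simp add: cinner_self)
  thus ?thesis by (simp add: cinner_self)
qed

lemma Re_cinner_le: "2 * Re (cinner x y) \<le> (norm x)\<^sup>2 + (norm (y::'a::complex_hilbert_space))\<^sup>2"
  using norm_diff_square[of x y] zero_le_power2[of "norm (x - y)"] by linarith

text \<open>Cauchy-Schwarz. For unit vectors \<open>Re_cinner_le\<close> bounds the real part by 1,
  and a unimodular factor \<open>c\<close> on \<open>x\<close> makes the inner product real and
  nonnegative, so that its real part is its modulus.\<close>

lemma cmod_cinner_le: "cmod (cinner x y) \<le> norm x * norm (y::'a::complex_hilbert_space)"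
proof (cases "x = 0 \<or> y = 0")
  case False
  define c where "c = (if cinner x y = 0 then 1 else cnj (sgn (cinner x y)))"
  have c: "cmod c = 1" by (simp add: c_def norm_sgn)
  have ccx: "c * cinner x y = of_real (cmod (cinner x y))"
    by (auto simp: c_def sgn_eq complex_norm_square [symmetric] field_simps power2_eq_square
        simp flip: of_real_mult)
  define u where "u = (1 / norm x) *\<^sub>R (c *\<^sub>C x)"
  define v where "v = (1 / norm y) *\<^sub>R y"
  have "norm u = 1" "norm v = 1" using False c by (auto simp: u_def v_def norm_scaleC)
  moreover have "cinner u v = of_real (cmod (cinner x y) / (norm x * norm y))"
    by (simp add: u_def v_def cinner_scaleR_left cinner_scaleR_right cinner_scaleC_left ccx)
  ultimately have "cmod (cinner x y) / (norm x * norm y) \<le> 1"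
    using Re_cinner_le[of u v] by simp
  thus ?thesis using False by (simp add: divide_le_eq)
qed auto

lemma bounded_bilinear_scaleC:
  "bounded_bilinear (scaleC :: complex \<Rightarrow> 'a::complex_hilbert_space \<Rightarrow> 'a)"
  by (standard; (intro exI[of _ 1])?)
     (auto simp: scaleC_add_left scaleC_add_right norm_scaleC scaleR_scaleC scaleC_scaleC
       scaleR_conv_of_real scaleC_complex_def mult_ac)

lemma bounded_bilinear_cinner:
  "bounded_bilinear (cinner :: 'a::complex_hilbert_space \<Rightarrow> 'a \<Rightarrow> complex)"
  by (standard; (intro exI[of _ 1])?)
     (auto simp: cinner_add_left cinner_add_right cinner_scaleR_left cinner_scaleR_right
       scaleR_conv_of_real cmod_cinner_le)

lemmas tendsto_scaleC [tendsto_intros] = bounded_bilinear.tendsto[OF bounded_bilinear_scaleC]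
lemmas continuous_on_scaleC [continuous_intros] =
  bounded_bilinear.continuous_on[OF bounded_bilinear_scaleC]
lemmas continuous_on_cinner [continuous_intros] =
  bounded_bilinear.continuous_on[OF bounded_bilinear_cinner]
lemmas bounded_linear_scaleC_right = bounded_bilinear.bounded_linear_right[OF bounded_bilinear_scaleC]
lemmas bounded_linear_scaleC_left = bounded_bilinear.bounded_linear_left[OF bounded_bilinear_scaleC]
lemmas bounded_linear_cinner_left = bounded_bilinear.bounded_linear_left[OF bounded_bilinear_cinner]
lemmas bounded_linear_cinner_right = bounded_bilinear.bounded_linear_right[OF bounded_bilinear_cinner]

lemma norm_le_of_cinner_le:
  assumes "\<And>y. cmod (cinner x y) \<le> C * norm y" and "0 \<le> C"
  shows "norm (x::'a::complex_hilbert_space) \<le> C"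
proof (cases "x = 0")
  case False
  have "norm x * norm x \<le> C * norm x"
    using assms(1)[of x] by (simp add: cinner_self power2_eq_square norm_mult)
  thus ?thesis using False by simp
qed (use assms in auto)

section \<open>Integration and uniform boundedness in Banach spaces\<close>

lemma norm_diff_less_half:
  fixes a b c :: "'a::real_normed_vector"
  assumes "norm (a - c) < e / 2" "norm (b - c) < e / 2"
  shows "norm (a - b) < e"
  using norm_diff_triangle_less[OF assms(1), of b "e / 2"] assms(2) by (simp add: norm_minus_commute)

text \<open>Over one tagged division the Riemann sums of \<open>f\<close> and \<open>fn n\<close>
  differ by at most the Riemann sum of \<open>hn n\<close>. A gauge that suits both
  \<open>fn n\<close> and \<open>hn n\<close>, for a single \<open>n\<close> with small integral of
  \<open>hn n\<close>, thus verifies the Cauchy criterion for \<open>f\<close>. Smallness is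
  measured by scalar functions only, so a non-separable space causes no difficulty.\<close>

lemma has_integral_approx_cbox:
  fixes f :: "real \<Rightarrow> 'a::banach"
  assumes fn: "\<And>n. (fn n) integrable_on cbox a b"
    and hn: "\<And>n. (hn n) integrable_on cbox a b"
    and le: "\<And>n x. x \<in> cbox a b \<Longrightarrow> norm (f x - fn n x) \<le> hn n x"
    and lim: "(\<lambda>n. integral (cbox a b) (hn n)) \<longlonglongrightarrow> 0"
  shows "f integrable_on cbox a b"
    and "norm (integral (cbox a b) f - integral (cbox a b) (fn n)) \<le> integral (cbox a b) (hn n)"
proof -
  show *: "f integrable_on cbox a b"
    unfolding integrable_Cauchy
  proof (intro allI impI)
    fix e :: real assume e: "e > 0"
    obtain n where n: "norm (integral (cbox a b) (hn n)) < e / 8"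
      using LIMSEQ_D[OF lim, of "e / 8"] e by auto
    from fn[of n] have "(fn n has_integral integral (cbox a b) (fn n)) (cbox a b)"
      by (simp add: integrable_integral)
    then obtain g1 where g1: "gauge g1" "\<And>D. D tagged_division_of (cbox a b) \<Longrightarrow> g1 fine D \<Longrightarrow>
        norm ((\<Sum>(x, k)\<in>D. measure lborel k *\<^sub>R fn n x) - integral (cbox a b) (fn n)) < e / 8"
      unfolding has_integral using e by (meson divide_pos_pos zero_less_numeral)
    from hn[of n] have "(hn n has_integral integral (cbox a b) (hn n)) (cbox a b)"
      by (simp add: integrable_integral)
    then obtain g2 where g2: "gauge g2" "\<And>D. D tagged_division_of (cbox a b) \<Longrightarrow> g2 fine D \<Longrightarrow>
        norm ((\<Sum>(x, k)\<in>D. measure lborel k *\<^sub>R hn n x) - integral (cbox a b) (hn n)) < e / 8"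
      unfolding has_integral using e by (meson divide_pos_pos zero_less_numeral)
    have key: "norm ((\<Sum>(x, k)\<in>D. measure lborel k *\<^sub>R f x) - integral (cbox a b) (fn n)) < e / 2"
      if D: "D tagged_division_of (cbox a b)" "(\<lambda>x. g1 x \<inter> g2 x) fine D" for D
    proof -
      have fine: "g1 fine D" "g2 fine D" using D(2) by (auto simp: fine_def)
      have "norm ((\<Sum>(x, k)\<in>D. measure lborel k *\<^sub>R f x) - (\<Sum>(x, k)\<in>D. measure lborel k *\<^sub>R fn n x))
          = norm (\<Sum>(x, k)\<in>D. measure lborel k *\<^sub>R (f x - fn n x))"
        by (simp add: sum_subtractf case_prod_unfold scaleR_diff_right)
      also have "\<dots> \<le> (\<Sum>(x, k)\<in>D. measure lborel k *\<^sub>R hn n x)"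
      proof (rule sum_norm_le, safe)
        fix x k assume xk: "(x, k) \<in> D"
        hence "x \<in> cbox a b" using D(1) by (meson subsetD tagged_division_ofD(2,3))
        thus "norm (measure lborel k *\<^sub>R (f x - fn n x)) \<le> measure lborel k *\<^sub>R hn n x"
          using le by (simp add: mult_left_mono)
      qed
      finally have 1: "norm ((\<Sum>(x, k)\<in>D. measure lborel k *\<^sub>R f x) - (\<Sum>(x, k)\<in>D. measure lborel k *\<^sub>R fn n x))
          \<le> (\<Sum>(x, k)\<in>D. measure lborel k *\<^sub>R hn n x)" .
      have "(\<Sum>(x, k)\<in>D. measure lborel k *\<^sub>R hn n x) < e / 8 + e / 8"
        using g2(2)[OF D(1) fine(2)] n unfolding real_norm_def by linarith
      with 1 have "norm ((\<Sum>(x, k)\<in>D. measure lborel k *\<^sub>R f x) - (\<Sum>(x, k)\<in>D. measure lborel k *\<^sub>R fn n x)) < e / 8 + e / 8"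
        by linarith
      from norm_diff_triangle_less[OF this g1(2)[OF D(1) fine(1)]] show ?thesis using e by linarith
    qed
    show "\<exists>\<gamma>. gauge \<gamma> \<and> (\<forall>\<D>1 \<D>2. \<D>1 tagged_division_of (cbox a b) \<and> \<gamma> fine \<D>1 \<and>
            \<D>2 tagged_division_of (cbox a b) \<and> \<gamma> fine \<D>2 \<longrightarrow>
            norm ((\<Sum>(x,K)\<in>\<D>1. measure lborel K *\<^sub>R f x) - (\<Sum>(x,K)\<in>\<D>2. measure lborel K *\<^sub>R f x)) < e)"
    proof (intro exI conjI allI impI; (elim conjE)?)
      show "gauge (\<lambda>x. g1 x \<inter> g2 x)" using g1 g2 by (simp add: gauge_Int)
      fix D1 D2 assume "D1 tagged_division_of cbox a b" "(\<lambda>x. g1 x \<inter> g2 x) fine D1"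
        "D2 tagged_division_of cbox a b" "(\<lambda>x. g1 x \<inter> g2 x) fine D2"
      from key[OF this(1,2)] key[OF this(3,4)]
      show "norm ((\<Sum>(x,K)\<in>D1. measure lborel K *\<^sub>R f x) - (\<Sum>(x,K)\<in>D2. measure lborel K *\<^sub>R f x)) < e"
        by (rule norm_diff_less_half)
    qed
  qed
  have "integral (cbox a b) f - integral (cbox a b) (fn n) = integral (cbox a b) (\<lambda>x. f x - fn n x)"
    by (rule integral_diff[OF * fn, symmetric])
  also have "norm \<dots> \<le> integral (cbox a b) (hn n)"
    by (rule integral_norm_bound_integral[OF integrable_diff[OF * fn] hn le])
  finally show "norm (integral (cbox a b) f - integral (cbox a b) (fn n)) \<le> integral (cbox a b) (hn n)" .
qed

lemma has_integral_box_limit: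
  fixes f :: "real \<Rightarrow> 'a::banach"
  assumes "(f has_integral I) S" and "0 < e"
  obtains B where "B > 0" and "\<And>a b. ball 0 B \<subseteq> cbox a b \<Longrightarrow>
    norm (integral (cbox a b) (\<lambda>x. if x \<in> S then f x else 0) - I) < e"
proof -
  have "\<forall>e>0. \<exists>B>0. \<forall>a b. ball 0 B \<subseteq> cbox a b \<longrightarrow>
      norm (integral (cbox a b) (\<lambda>x. if x \<in> S then f x else 0) - I) < e"
    using assms(1) unfolding has_integral_alt' by (rule conjunct2)
  with assms(2) show thesis using that by blast
qed

text \<open>For fixed \<open>n\<close> the integral of \<open>f\<close> over a box stays within
  \<open>integral UNIV (hn n)\<close> of that of \<open>fn n\<close>, uniformly in the box; boxes
  that are large enough for \<open>fn n\<close> are therefore large enough for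
  \<open>f\<close>.\<close>

lemma integrable_approx_UNIV:
  fixes f :: "real \<Rightarrow> 'a::banach"
  assumes fn: "\<And>n. (fn n) integrable_on UNIV"
    and hn: "\<And>n. (hn n) integrable_on UNIV"
    and le: "\<And>n x. norm (f x - fn n x) \<le> hn n x"
    and lim: "(\<lambda>n. integral UNIV (hn n)) \<longlonglongrightarrow> 0"
  shows "f integrable_on UNIV"
proof -
  have fnc: "(fn n) integrable_on cbox a b" and hnc: "(hn n) integrable_on cbox a b" for n a b
    using fn hn integrable_on_subcbox by blast+
  have hpos: "0 \<le> hn n x" for n x using le[of x n] norm_ge_zero order_trans by blast
  have hle: "0 \<le> integral (cbox a b) (hn n)" "integral (cbox a b) (hn n) \<le> integral UNIV (hn n)" for n a b
    by (rule integral_nonneg[OF hnc hpos]) (rule integral_subset_le[OF subset_UNIV hnc hn], simp add: hpos)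
  have limc: "(\<lambda>n. integral (cbox a b) (hn n)) \<longlonglongrightarrow> 0" for a b
    by (rule tendsto_sandwich[OF _ _ tendsto_const lim]) (use hle in auto)
  have fc: "f integrable_on cbox a b"
      "norm (integral (cbox a b) f - integral (cbox a b) (fn n)) \<le> integral (cbox a b) (hn n)" for a b n
    using has_integral_approx_cbox[where f=f and fn=fn and hn=hn and a=a and b=b, OF fnc hnc _ limc]
    by (simp_all only: le)
  show ?thesis
  proof (subst integrable_alt, intro conjI allI impI)
    show "(\<lambda>x. if x \<in> UNIV then f x else 0) integrable_on cbox a b" for a b using fc(1) by simp
    fix e :: real assume e: "e > 0"
    obtain n where n: "norm (integral UNIV (hn n)) < e / 6"
      using LIMSEQ_D[OF lim, of "e / 6"] e by auto
    have "(fn n has_integral integral UNIV (fn n)) UNIV" by (rule integrable_integral[OF fn])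
    then obtain B where B: "B > 0" "\<And>a b. ball 0 B \<subseteq> cbox a b \<Longrightarrow>
       norm (integral (cbox a b) (fn n) - integral UNIV (fn n)) < e / 6"
      by (rule has_integral_box_limit[where e="e / 6"]) (use e in auto)
    have key: "norm (integral (cbox a b) f - integral UNIV (fn n)) < e / 2"
      if "ball 0 B \<subseteq> cbox a b" for a b
    proof -
      have "norm (integral (cbox a b) f - integral (cbox a b) (fn n)) < e / 6"
        using fc(2)[of a b n] hle(2)[of a b n] n unfolding real_norm_def by linarith
      from norm_diff_triangle_less[OF this B(2)[OF that]] show ?thesis using e by linarith
    qed
    show "\<exists>B>0. \<forall>a b c d. ball 0 B \<subseteq> cbox a b \<and> ball 0 B \<subseteq> cbox c d \<longrightarrow>
      norm (integral (cbox a b) (\<lambda>x. if x \<in> UNIV then f x else 0) -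
            integral (cbox c d) (\<lambda>x. if x \<in> UNIV then f x else 0)) < e"
    proof (intro exI[of _ B] conjI B(1) allI impI; elim conjE)
      fix a b c d :: real assume "ball 0 B \<subseteq> cbox a b" "ball 0 B \<subseteq> cbox c d"
      from key[OF this(1)] key[OF this(2)]
      show "norm (integral (cbox a b) (\<lambda>x. if x \<in> UNIV then f x else 0) -
            integral (cbox c d) (\<lambda>x. if x \<in> UNIV then f x else 0)) < e"
        using norm_diff_less_half by simp
    qed
  qed
qed

text \<open>Continuity is asked only away from 0 because \<open>t powr (g - 1)\<close> is singular
  there for \<open>g < 1\<close>. The cut-offs \<open>F n\<close> to \<open>S n\<close> are
  continuous on a compact interval, and the part of \<open>h\<close> outside \<open>S n\<close> has
  vanishing integral by scalar dominated convergence.\<close>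

lemma integrable_dominated_halfline:
  fixes f :: "real \<Rightarrow> 'a::banach"
  assumes f: "continuous_on {0<..} f"
    and h: "h integrable_on {0..}"
    and le: "\<And>t. 0 < t \<Longrightarrow> norm (f t) \<le> h t"
  shows "f integrable_on {0..}"
proof -
  define S where "S n = {inverse (real (Suc n)) .. real (Suc n)}" for n
  define H where "H n = (\<lambda>t. if t \<in> {0<..} - S n then h t else 0)" for n
  define F where "F n = (\<lambda>t. if t \<in> S n then f t else 0)" for n
  have Ssub: "S n \<subseteq> {0<..}" for n 
    unfolding S_def by (smt (verit) atLeastAtMost_iff greaterThan_iff inverse_positive_iff_positive of_nat_0_less_iff subsetI zero_less_Suc)
  have Fint: "F n integrable_on UNIV" for n
    unfolding F_def integrable_restrict_UNIV
    unfolding S_def by (rule integrable_continuous_real) (rule continuous_on_subset[OF f], fold S_def, rule Ssub)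
  have h0: "h integrable_on {0<..}"
    by (rule integrable_spike_set[OF h]) (auto intro: negligible_subset[of "{0}"])
  have hpos: "0 \<le> h t" if "0 < t" for t using le[OF that] norm_ge_zero order_trans by blast
  have hS: "h integrable_on S n" for n
    using h0 Ssub[of n] unfolding S_def by (rule integrable_on_subinterval)
  have Hint: "H n integrable_on UNIV" for n
    unfolding H_def integrable_restrict_UNIV
    by (rule integrable_setdiff[OF integrable_integral[OF h0] integrable_integral[OF hS]])
       (use Ssub in \<open>simp add: Diff_eq_empty_iff[THEN iffD2]\<close>)
  have lim: "(\<lambda>n. integral UNIV (H n)) \<longlonglongrightarrow> integral UNIV (\<lambda>t::real. 0)"
  proof (rule dominated_convergence(2)[where h="\<lambda>t. if t \<in> {0<..} then h t else 0"])
    show "(\<lambda>t. if t \<in> {0<..} then h t else 0) integrable_on UNIV"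
      unfolding integrable_restrict_UNIV by (rule h0)
    show "norm (H n x) \<le> (if x \<in> {0<..} then h x else 0)" for n x
      by (auto simp: H_def hpos)
    fix x :: real
    show "(\<lambda>n. H n x) \<longlonglongrightarrow> 0"
    proof (cases "0 < x")
      case True
      have "\<forall>\<^sub>F n in sequentially. inverse (real (Suc n)) < x"
        using LIMSEQ_inverse_real_of_nat True by (rule order_tendstoD)
      moreover have "\<forall>\<^sub>F n in sequentially. x < real (Suc n)"
        using eventually_ge_at_top[of "nat \<lceil>x\<rceil>"] by eventually_elim linarith
      ultimately have "\<forall>\<^sub>F n in sequentially. H n x = 0"
        by eventually_elim (auto simp: H_def S_def)
      thus ?thesis by (rule tendsto_eventually)
    qed (simp add: H_def)
  qed (rule Hint)
  have "(\<lambda>t. if t \<in> {0<..} then f t else 0) integrable_on UNIV"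
  proof (rule integrable_approx_UNIV[OF Fint Hint])
    show "norm ((if x \<in> {0<..} then f x else 0) - F n x) \<le> H n x" for n x
      using le[of x] Ssub[of n] by (auto simp: F_def H_def)
    show "(\<lambda>n. integral UNIV (H n)) \<longlonglongrightarrow> 0" using lim by simp
  qed
  hence "f integrable_on {0<..}" unfolding integrable_restrict_UNIV .
  thus ?thesis by (rule integrable_spike_set) (auto intro: negligible_subset[of "{0}"])
qed

text \<open>By Baire category one of the closed sets \<open>V n\<close> contains a ball. Linearity
  is over the reals, so that conjugate-linear maps such as \<open>cinner x\<close> are covered as
  well.\<close>

lemma uniform_boundedness:
  fixes F :: "'i \<Rightarrow> 'a::banach \<Rightarrow> 'b::real_normed_vector"
  assumes lin: "\<And>i. i \<in> I \<Longrightarrow> bounded_linear (F i)"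
    and bd: "\<And>x. \<exists>C. \<forall>i\<in>I. norm (F i x) \<le> C"
  obtains C where "C \<ge> 0" and "\<And>i x. i \<in> I \<Longrightarrow> norm (F i x) \<le> C * norm x"
proof -
  define V where "V n = {x. \<forall>i\<in>I. norm (F i x) \<le> real n}" for n
  have "closed {x. norm (F i x) \<le> real n}" if "i \<in> I" for i n
    using lin[OF that] by (intro closed_Collect_le continuous_intros linear_continuous_on)
  hence closed: "closed (V n)" for n
    unfolding V_def by (auto simp: Collect_ball_eq intro!: closed_INT)
  have "\<exists>n. interior (V n) \<noteq> {}"
  proof (rule ccontr)
    assume neg: "\<not> ?thesis"
    have "Met_TC.mtopology interior_of \<Union> (range V) = {}"
      by (rule Met_TC.metric_Baire_category_alt) (use closed neg in \<open>auto simp: mcomplete_iff_complete complete_UNIV\<close>)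
    moreover have "\<Union> (range V) = UNIV"
    proof (intro set_eqI iffI UNIV_I)
      fix x
      obtain C where "\<forall>i\<in>I. norm (F i x) \<le> C" using bd by blast
      moreover obtain n where "C \<le> real n" using real_arch_simple by blast
      ultimately have "x \<in> V n" by (auto simp: V_def intro: order_trans)
      thus "x \<in> \<Union> (range V)" by blast
    qed
    ultimately show False by simp
  qed
  then obtain n x0 where "x0 \<in> interior (V n)" by blast
  then obtain r where r: "r > 0" "cball x0 r \<subseteq> V n" using mem_interior_cball by blast
  show thesis
  proof (rule that[of "2 * real n / r"])
    show "2 * real n / r \<ge> 0" using r by simp
    fix i x assume i: "i \<in> I"
    interpret bounded_linear "F i" by (rule lin[OF i])
    show "norm (F i x) \<le> 2 * real n / r * norm x"
    proof (cases "x = 0")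
      case False
      define u where "u = (r / norm x) *\<^sub>R x"
      have "norm u = r" using False r by (simp add: u_def)
      hence "x0 + u \<in> V n" "x0 \<in> V n" using r by (auto simp: subset_iff dist_norm)
      hence "norm (F i (x0 + u)) \<le> n" "norm (F i x0) \<le> n" using i by (auto simp: V_def)
      \<comment> \<open>The ball need not be centred at 0; writing \<open>F i u\<close> as a
        difference of two values on it costs the factor 2.\<close>
      moreover have "F i u = F i (x0 + u) - F i x0" by (simp add: add)
      ultimately have "norm (F i u) \<le> 2 * real n"
        using norm_triangle_ineq4[of "F i (x0 + u)" "F i x0"] by simp
      thus ?thesis using False r by (simp add: u_def scaleR field_simps)
    qed (simp add: zero)
  qed
qed


section \<open>Laplace transforms of bounded semigroups\<close>

text \<open>The Gamma density of shape \<open>g\<close> and rate \<open>a\<close> without its factor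
  \<open>a powr g\<close>: the integral over the half line is then \<open>a powr - g\<close>, the
  power that the kernel is to represent.\<close>

abbreviation gdens :: "real \<Rightarrow> real \<Rightarrow> real \<Rightarrow> real" where
  "gdens g a t \<equiv> t powr (g - 1) / Gamma g * exp (- (a * t))"

lemma gamma_density_nn_integral:
  fixes g a :: real
  assumes "0 < g" "0 < a"
  shows "(\<integral>\<^sup>+t. ennreal (indicator {0..} t * gdens g a t) \<partial>lborel)
      = ennreal (a powr - g)"
proof -
  have G: "Gamma g > 0" using assms by (simp add: Gamma_real_pos) 
  have "ennreal (Gamma g) = (\<integral>\<^sup>+t. ennreal (indicator {0..} t * t powr (g - 1) / exp t) \<partial>lborel)"
    by (rule Gamma_conv_nn_integral_real[OF assms(1)])
  also have "\<dots> = ennreal a * (\<integral>\<^sup>+t. ennreal (indicator {0..} (0 + a * t) * (0 + a * t) powr (g - 1) / exp (0 + a * t)) \<partial>lborel)"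
    by (subst nn_integral_real_affine[where c=a and t=0]) (use assms in auto)
  also have "(\<lambda>t. ennreal (indicator {0..} (0 + a * t) * (0 + a * t) powr (g - 1) / exp (0 + a * t)))
     = (\<lambda>t. ennreal (a powr (g - 1) * Gamma g) * ennreal (indicator {0..} t * gdens g a t))"
    using assms G by (auto simp: fun_eq_iff indicator_def zero_le_mult_iff powr_mult Gamma_eq_zero_iff exp_minus field_simps
        simp flip: ennreal_mult')
  also have "(\<integral>\<^sup>+t. \<dots> t \<partial>lborel) = ennreal (a powr (g - 1) * Gamma g) *
      (\<integral>\<^sup>+t. ennreal (indicator {0..} t * gdens g a t) \<partial>lborel)"
    by (rule nn_integral_cmult) measurable
  finally have *: "ennreal (Gamma g) = ennreal (a * (a powr (g - 1) * Gamma g)) *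
      (\<integral>\<^sup>+t. ennreal (indicator {0..} t * gdens g a t) \<partial>lborel)"
    (is "_ = _ * ?I") using assms by (simp add: ennreal_mult' mult.assoc)
  have "a * (a powr (g - 1) * Gamma g) = a powr g * Gamma g"
    using assms by (simp add: powr_diff)
  with * have "ennreal (Gamma g) = ennreal (a powr g * Gamma g) * ?I" by simp
  hence "ennreal (a powr - g / Gamma g) * ennreal (Gamma g) =
      ennreal (a powr - g / Gamma g) * ennreal (a powr g * Gamma g) * ?I"
    by (simp add: mult.assoc)
  moreover have "ennreal (a powr - g / Gamma g) * ennreal (Gamma g) = ennreal (a powr - g)"
    using G by (subst ennreal_mult' [symmetric]) auto
  moreover have "ennreal (a powr - g / Gamma g) * ennreal (a powr g * Gamma g) = 1"
    using G assms by (subst ennreal_mult' [symmetric]) (auto simp: powr_minus Gamma_eq_zero_iff)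
  ultimately show ?thesis by simp
qed

lemma gamma_density_has_integral:
  fixes g a :: real
  assumes "0 < g" "0 < a"
  shows "((\<lambda>t. gdens g a t) has_integral a powr - g) {0..}"
proof -
  have G: "Gamma g > 0" using assms by (simp add: Gamma_real_pos)
  have "((\<lambda>t. indicator {0..} t * gdens g a t) has_integral a powr - g) UNIV"
    by (rule nn_integral_has_integral) (use G gamma_density_nn_integral[OF assms] in \<open>auto simp: indicator_def\<close>)
  moreover have "(\<lambda>t. indicator {0..} t * gdens g a t)
     = (\<lambda>t. if t \<in> {0..} then gdens g a t else 0)"
    by (auto simp: indicator_def)
  ultimately show ?thesis by (subst has_integral_restrict_UNIV[symmetric]) simp
qed

lemma gamma_density_integrable:
  fixes g a :: real
  assumes "0 < g" "0 < a"
  shows "integrable lborel (\<lambda>t. indicator {0..} t * gdens g a t)"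
proof (rule integrableI_nonneg)
  have G: "Gamma g > 0" using assms by (simp add: Gamma_real_pos)
  show "AE t in lborel. 0 \<le> indicator {0..} t * gdens g a t"
    using G by auto
qed (use gamma_density_nn_integral[OF assms] in auto)

text \<open>As \<open>0 powr x = 0\<close>, the kernel vanishes at \<open>t = 0\<close> even for
  \<open>g = 1\<close>; it agrees with \<open>exp (- (z * t))\<close> only for positive
  \<open>t\<close>.\<close>

definition lker :: "real \<Rightarrow> complex \<Rightarrow> real \<Rightarrow> complex" where
  "lker g z t = complex_of_real (t powr (g - 1) / Gamma g) * exp (- (z * of_real t))"

lemma norm_lker: "0 < g \<Longrightarrow> cmod (lker g z t) = gdens g (Re z) t"
  using Gamma_real_pos[of g] by (simp add: lker_def norm_mult norm_divide)

lemma continuous_on_lker: "continuous_on {0<..} (lker g z)"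
  unfolding lker_def divide_inverse by (intro continuous_intros) auto

text \<open>The generator is a limit of difference quotients from the right. In this form it is a
  one-sided derivative, to which the product rule and the fundamental theorem apply.\<close>

lemma has_vector_derivative_iff_quotient:
  "(f has_vector_derivative D) (at t within S) \<longleftrightarrow>
     ((\<lambda>s. (1 / (s - t)) *\<^sub>R (f s - f t)) \<longlongrightarrow> D) (at t within S)"
proof -
  have eq: "norm ((1 / (s - t)) *\<^sub>R (f s - f t) - D) = norm (f s - f t - (s - t) *\<^sub>R D) / norm (s - t)"
    if "s \<noteq> t" for s
  proof -
    from that have "(1 / (s - t)) *\<^sub>R (f s - f t) - D = (1 / (s - t)) *\<^sub>R (f s - f t - (s - t) *\<^sub>R D)"
      by (simp add: scaleR_diff_right)
    thus ?thesis by simp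
  qed
  have "((\<lambda>s. (1 / (s - t)) *\<^sub>R (f s - f t)) \<longlongrightarrow> D) (at t within S) \<longleftrightarrow>
      ((\<lambda>s. norm ((1 / (s - t)) *\<^sub>R (f s - f t) - D)) \<longlongrightarrow> 0) (at t within S)"
    by (simp add: tendsto_norm_zero_iff LIM_zero_iff)
  also have "\<dots> \<longleftrightarrow> ((\<lambda>s. norm (f s - f t - (s - t) *\<^sub>R D) / norm (s - t)) \<longlongrightarrow> 0) (at t within S)"
    by (rule tendsto_cong) (auto simp: eventually_at_filter eq)
  also have "\<dots> \<longleftrightarrow> (f has_vector_derivative D) (at t within S)"
    by (simp add: has_vector_derivative_def has_derivative_iff_norm bounded_linear_scaleR_left)
  finally show ?thesis ..
qed

section \<open>Orbits of a bounded semigroup\<close>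

locale bounded_C0_semigroup =
  fixes T :: "real \<Rightarrow> 'a::complex_hilbert_space \<Rightarrow> 'a" and M :: real
  assumes C0: "C0_semigroup T"
    and bound: "\<And>t x. 0 \<le> t \<Longrightarrow> norm (T t x) \<le> M * norm x"
    and M_ge_1: "1 \<le> M"
begin

lemma T_bounded_linear: "0 \<le> t \<Longrightarrow> bounded_linear (T t)"
  and T_scaleC: "0 \<le> t \<Longrightarrow> T t (c *\<^sub>C x) = c *\<^sub>C T t x"
  and T_0 [simp]: "T 0 x = x"
  and T_plus: "0 \<le> s \<Longrightarrow> 0 \<le> t \<Longrightarrow> T (s + t) x = T s (T t x)"
  and T_tendsto_0: "((\<lambda>t. T t x) \<longlongrightarrow> x) (at_right 0)"
  using C0 unfolding C0_semigroup_def bounded_clinear_def by blast+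

lemma T_commute: "0 \<le> s \<Longrightarrow> 0 \<le> t \<Longrightarrow> T s (T t x) = T t (T s x)"
  by (metis T_plus add.commute)

lemma T_add: "0 \<le> t \<Longrightarrow> T t (x + y) = T t x + T t y"
  and T_diff: "0 \<le> t \<Longrightarrow> T t (x - y) = T t x - T t y"
  and T_scaleR: "0 \<le> t \<Longrightarrow> T t (r *\<^sub>R x) = r *\<^sub>R T t x"
  and T_zero [simp]: "0 \<le> t \<Longrightarrow> T t 0 = 0"
  using T_bounded_linear[of t] by (simp_all add: bounded_linear_def linear_add linear_diff linear_scale linear_0)

text \<open>Factoring out \<open>T (min s t)\<close> treats times to the left and to the right of
  \<open>t\<close> alike: what remains depends on \<open>\<bar>s - t\<bar>\<close>, which tends to 0
  from the right.\<close>

lemma T_min: "0 \<le> s \<Longrightarrow> 0 \<le> t \<Longrightarrow> T (max s t) x = T (min s t) (T \<bar>s - t\<bar> x)"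
  using T_plus[of s "t - s" x] T_plus[of t "s - t" x] by (cases s t rule: linorder_cases) auto

lemma tendsto_abs_diff_at_right: "((\<lambda>s. f \<bar>s - t\<bar>) \<longlongrightarrow> l) (at t within S)"
  if "(f \<longlongrightarrow> l) (at_right (0::real))" for f :: "real \<Rightarrow> 'b::topological_space" and t :: real
proof (rule filterlim_compose[OF that])
  show "LIM s at t within S. \<bar>s - t\<bar> :> at_right 0"
    unfolding filterlim_at
  proof
    show "\<forall>\<^sub>F x in at t within S. \<bar>x - t\<bar> \<in> {0<..} \<and> \<bar>x - t\<bar> \<noteq> 0"
      by (auto simp: eventually_at_filter)
    have "((\<lambda>s. \<bar>s - t\<bar>) \<longlongrightarrow> \<bar>t - t\<bar>) (at t within S)" by (intro tendsto_intros)
    thus "((\<lambda>s. \<bar>s - t\<bar>) \<longlongrightarrow> 0) (at t within S)" by simp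
  qed
qed

text \<open>By \<open>T_min\<close> the increment is at most \<open>M\<close> times an increment at
  0, so right continuity at 0 gives two-sided continuity everywhere.\<close>

lemma continuous_on_T: "continuous_on {0..} (\<lambda>t. T t x)"
  unfolding continuous_on_def
proof (intro ballI)
  fix t :: real assume t: "t \<in> {0..}"
  have "((\<lambda>s. M * norm (T \<bar>s - t\<bar> x - x)) \<longlongrightarrow> M * norm (x - x)) (at t within {0..})"
    by (intro tendsto_intros tendsto_abs_diff_at_right T_tendsto_0)
  hence lim: "((\<lambda>s. M * norm (T \<bar>s - t\<bar> x - x)) \<longlongrightarrow> 0) (at t within {0..})" by simp
  have ev: "\<forall>\<^sub>F s in at t within {0..}. norm (T s x - T t x) \<le> M * norm (T \<bar>s - t\<bar> x - x)"
    unfolding eventually_at_filter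
  proof (intro always_eventually allI impI)
    fix s :: real assume s: "s \<in> {0..}"
    have "norm (T s x - T t x) = norm (T (min s t) (T \<bar>s - t\<bar> x - x))"
      using s t T_min[of s t x] by (cases "s \<le> t") (simp_all add: T_diff norm_minus_commute)
    thus "norm (T s x - T t x) \<le> M * norm (T \<bar>s - t\<bar> x - x)" using bound s t by simp
  qed
  have "((\<lambda>s. T s x - T t x) \<longlongrightarrow> 0) (at t within {0..})" by (rule Lim_null_comparison[OF ev lim])
  thus "((\<lambda>s. T s x) \<longlongrightarrow> T t x) (at t within {0..})" by (simp add: LIM_zero_iff)
qed

lemma continuous_on_T_comp [continuous_intros]:
  "continuous_on S f \<Longrightarrow> (\<And>s. s \<in> S \<Longrightarrow> 0 \<le> f s) \<Longrightarrow> continuous_on S (\<lambda>s. T (f s) x)"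
  by (rule continuous_on_compose2[OF continuous_on_T]) auto

text \<open>The quotient at \<open>t\<close> is \<open>T m\<close> of the quotient
  \<open>q \<bar>s - t\<bar>\<close> at 0, where \<open>m = min s t\<close>. Its error splits into
  \<open>M * norm (q \<bar>s - t\<bar> - y)\<close> and \<open>norm (T m y - T t y)\<close>; the
  latter is 0 or \<open>norm (T s y - T t y)\<close>.\<close>

lemma T_has_vector_derivative:
  assumes gen: "(x, y) \<in> generator T" and t: "0 \<le> t"
  shows "((\<lambda>t. T t x) has_vector_derivative T t y) (at t within {0..})"
proof -
  define q where "q h = (1 / h) *\<^sub>R (T h x - x)" for h
  have q: "(q \<longlongrightarrow> y) (at_right 0)" using gen by (simp add: generator_def q_def[abs_def])
  have "((\<lambda>s. T s y) \<longlongrightarrow> T t y) (at t within {0..})"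
    using continuous_on_T t by (simp add: continuous_on_def)
  hence "((\<lambda>s. M * norm (q \<bar>s - t\<bar> - y) + norm (T s y - T t y)) \<longlongrightarrow>
      M * norm (y - y) + norm (T t y - T t y)) (at t within {0..})"
    by (intro tendsto_intros tendsto_abs_diff_at_right q)
  hence lim: "((\<lambda>s. M * norm (q \<bar>s - t\<bar> - y) + norm (T s y - T t y)) \<longlongrightarrow> 0) (at t within {0..})"
    by simp
  have ev: "\<forall>\<^sub>F s in at t within {0..}. norm ((1 / (s - t)) *\<^sub>R (T s x - T t x) - T t y)
      \<le> M * norm (q \<bar>s - t\<bar> - y) + norm (T s y - T t y)"
    unfolding eventually_at_filter
  proof (intro always_eventually allI impI)
    fix s :: real assume st: "s \<noteq> t" and s: "s \<in> {0..}"
    define m where "m = min s t"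
    have m: "m \<ge> 0" using s t by (simp add: m_def)
    have "(1 / (s - t)) *\<^sub>R (T s x - T t x) = T m (q \<bar>s - t\<bar>)"
    proof (cases "s < t")
      case True
      hence "(1 / (s - t)) *\<^sub>R (T s x - T t x) = (1 / (t - s)) *\<^sub>R (T t x - T s x)"
        by (metis (no_types) minus_diff_eq minus_divide_right scaleR_minus_left scaleR_minus_right
            minus_divide_left)
      also have "\<dots> = T m (q \<bar>s - t\<bar>)"
        using T_min[of s t x] True m s t by (simp add: q_def T_scaleR T_diff m_def)
      finally show ?thesis .
    next
      case False
      thus ?thesis using T_min[of s t x] m s t st by (simp add: q_def T_scaleR T_diff m_def)
    qed
    hence "norm ((1 / (s - t)) *\<^sub>R (T s x - T t x) - T t y) = norm (T m (q \<bar>s - t\<bar> - y) + (T m y - T t y))"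
      using m by (simp add: T_diff)
    also have "\<dots> \<le> M * norm (q \<bar>s - t\<bar> - y) + norm (T m y - T t y)"
      by (rule order_trans[OF norm_triangle_ineq add_right_mono[OF bound[OF m]]])
    also have "norm (T m y - T t y) \<le> norm (T s y - T t y)" by (simp add: m_def min_def)
    finally show "norm ((1 / (s - t)) *\<^sub>R (T s x - T t x) - T t y)
      \<le> M * norm (q \<bar>s - t\<bar> - y) + norm (T s y - T t y)" by simp
  qed
  have "((\<lambda>s. (1 / (s - t)) *\<^sub>R (T s x - T t x) - T t y) \<longlongrightarrow> 0) (at t within {0..})"
    by (rule Lim_null_comparison[OF ev lim])
  hence "((\<lambda>s. (1 / (s - t)) *\<^sub>R (T s x - T t x)) \<longlongrightarrow> T t y) (at t within {0..})"
    by (simp add: LIM_zero_iff)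
  thus ?thesis by (simp only: has_vector_derivative_iff_quotient)
qed

end


section \<open>Improper integrals against Laplace kernels\<close>

lemma integral_halfline_limit:
  fixes f :: "real \<Rightarrow> 'a::banach"
  assumes f: "f integrable_on {0..}"
  shows "((\<lambda>b. integral {0..b} f) \<longlongrightarrow> integral {0..} f) at_top"
proof (rule tendstoI)
  fix e :: real assume e: "e > 0"
  have "(f has_integral integral {0..} f) {0..}" using f by blast
  then obtain B where B: "B > 0" "\<And>a b. ball 0 B \<subseteq> cbox a b \<Longrightarrow>
      norm (integral (cbox a b) (\<lambda>x. if x \<in> {0..} then f x else 0) - integral {0..} f) < e"
    using e by (rule has_integral_box_limit) blast
  show "\<forall>\<^sub>F b in at_top. dist (integral {0..b} f) (integral {0..} f) < e"
    using eventually_ge_at_top[of B]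
  proof eventually_elim
    case (elim b)
    have "ball 0 B \<subseteq> cbox (-b) b" using elim by (auto simp: dist_real_def)
    moreover have "integral (cbox (-b) b) (\<lambda>x. if x \<in> {0..} then f x else 0) = integral {0..b} f"
    proof -
      have "integral (cbox (-b) b) (\<lambda>x. if x \<in> {0..} then f x else 0) = integral ({0..} \<inter> cbox (-b) b) f"
        by (rule integral_restrict_Int)
      also have "{0..} \<inter> cbox (-b) b = {0..b}" using B(1) elim by auto
      finally show ?thesis .
    qed
    ultimately show ?case using B(2)[of "-b" b] by (simp add: dist_norm)
  qed
qed

lemma has_integral_ftc_halfline:
  fixes F :: "real \<Rightarrow> 'a::banach"
  assumes cont: "continuous_on {0..} F"
    and der: "\<And>t. 0 < t \<Longrightarrow> (F has_vector_derivative f t) (at t)"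
    and lim: "(F \<longlongrightarrow> 0) at_top"
    and int: "f integrable_on {0..}"
  shows "(f has_integral - F 0) {0..}"
proof -
  have "\<forall>\<^sub>F b in at_top. integral {0..b} f = F b - F 0"
    using eventually_ge_at_top[of 0]
  proof eventually_elim
    case (elim b)
    have "(f has_integral (F b - F 0)) {0..b}"
      by (rule fundamental_theorem_of_calculus_interior)
         (use elim der in \<open>auto intro: continuous_on_subset[OF cont]\<close>)
    thus ?case by (rule integral_unique)
  qed
  moreover have "((\<lambda>b. F b - F 0) \<longlongrightarrow> 0 - F 0) at_top" by (intro tendsto_intros lim)
  ultimately have "((\<lambda>b. integral {0..b} f) \<longlongrightarrow> 0 - F 0) at_top"
    by (subst tendsto_cong)
  hence "integral {0..} f = 0 - F 0"
    by (rule tendsto_unique[OF trivial_limit_at_top_linorder integral_halfline_limit[OF int]])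
  thus ?thesis using integrable_integral[OF int] by simp
qed

lemma lker_integrable:
  fixes f :: "real \<Rightarrow> 'a::complex_hilbert_space"
  assumes g: "0 < g" and z: "0 < Re z"
    and f: "continuous_on {0..} f" and B: "\<And>t. 0 \<le> t \<Longrightarrow> norm (f t) \<le> B"
  shows "(\<lambda>t. lker g z t *\<^sub>C f t) integrable_on {0..}"
    and "norm (integral {0..} (\<lambda>t. lker g z t *\<^sub>C f t)) \<le> B * Re z powr - g"
proof -
  have h: "((\<lambda>t. B * gdens g (Re z) t) has_integral B * Re z powr - g) {0..}"
    by (intro has_integral_mult_right gamma_density_has_integral g z)
  have le: "norm (lker g z t *\<^sub>C f t) \<le> B * gdens g (Re z) t"
    if "0 \<le> t" for t
    using mult_right_mono[OF B[OF that], of "cmod (lker g z t)"] g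
    by (simp add: norm_scaleC norm_lker mult_ac)
  show *: "(\<lambda>t. lker g z t *\<^sub>C f t) integrable_on {0..}"
  proof (rule integrable_dominated_halfline)
    show "continuous_on {0<..} (\<lambda>t. lker g z t *\<^sub>C f t)"
      by (intro continuous_intros continuous_on_lker continuous_on_subset[OF f]) auto
  qed (use h le in \<open>auto simp: integrable_on_def\<close>)
  show "norm (integral {0..} (\<lambda>t. lker g z t *\<^sub>C f t)) \<le> B * Re z powr - g"
    using integral_norm_bound_integral[OF * has_integral_integrable[OF h]] le integral_unique[OF h] by simp
qed

section \<open>Resolvents and negative powers as Laplace transforms\<close>

context bounded_C0_semigroup
begin

text \<open>\<open>lp g z\<close> is the operator \<open>(z - A) powr -g\<close>.\<close>

definition lp :: "real \<Rightarrow> complex \<Rightarrow> 'a \<Rightarrow> 'a" where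
  "lp g z x = integral {0..} (\<lambda>t. lker g z t *\<^sub>C T t x)"

abbreviation res :: "complex \<Rightarrow> 'a \<Rightarrow> 'a" where
  "res \<equiv> lp 1"

lemma lp_has_integral:
  assumes "0 < g" "0 < Re z"
  shows "((\<lambda>t. lker g z t *\<^sub>C T t x) has_integral lp g z x) {0..}"
  unfolding lp_def using lker_integrable(1)[OF assms continuous_on_T bound] by blast

lemma norm_lp:
  assumes "0 < g" "0 < Re z"
  shows "norm (lp g z x) \<le> M * Re z powr - g * norm x"
  using lker_integrable(2)[OF assms continuous_on_T bound, of x] by (simp add: lp_def mult_ac)

lemma lp_add: "0 < g \<Longrightarrow> 0 < Re z \<Longrightarrow> lp g z (x + y) = lp g z x + lp g z y"
proof -
  assume g: "0 < g" "0 < Re z"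
  have "((\<lambda>t. lker g z t *\<^sub>C T t x + lker g z t *\<^sub>C T t y) has_integral lp g z x + lp g z y) {0..}"
    by (intro has_integral_add lp_has_integral g)
  hence "((\<lambda>t. lker g z t *\<^sub>C T t (x + y)) has_integral lp g z x + lp g z y) {0..}"
    by (rule has_integral_eq[rotated]) (simp add: T_add scaleC_add_right)
  from has_integral_unique[OF this lp_has_integral[OF g]] show ?thesis by simp
qed

text \<open>A bounded operator that commutes with the semigroup can be moved through the integral.
  Scalars, \<open>T s\<close>, other operators \<open>lp d w\<close> and later \<open>rr r\<close>
  are all instances.\<close>

lemma lp_commute:
  assumes g: "0 < g" "0 < Re z"
    and L: "bounded_linear L" "\<And>c x. L (c *\<^sub>C x) = c *\<^sub>C L x"
    and LT: "\<And>t. 0 \<le> t \<Longrightarrow> L (T t x) = T t (L x)"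
  shows "L (lp g z x) = lp g z (L x)"
proof -
  have "((L \<circ> (\<lambda>t. lker g z t *\<^sub>C T t x)) has_integral L (lp g z x)) {0..}"
    by (rule has_integral_linear[OF lp_has_integral[OF g] L(1)])
  hence "((\<lambda>t. lker g z t *\<^sub>C T t (L x)) has_integral L (lp g z x)) {0..}"
    by (rule has_integral_eq[rotated]) (simp add: L LT)
  from has_integral_unique[OF this lp_has_integral[OF g]] show ?thesis by simp
qed

lemma lp_scaleC: "0 < g \<Longrightarrow> 0 < Re z \<Longrightarrow> lp g z (c *\<^sub>C x) = c *\<^sub>C lp g z x"
  by (rule lp_commute[symmetric, of _ _ "\<lambda>x. c *\<^sub>C x"])
     (auto simp: bounded_linear_scaleC_right scaleC_scaleC mult.commute T_scaleC)

lemma bounded_linear_lp: "0 < g \<Longrightarrow> 0 < Re z \<Longrightarrow> bounded_linear (lp g z)"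
  by (rule bounded_linear_intro[where K="M * Re z powr - g"])
     (auto simp: lp_add lp_scaleC scaleR_scaleC norm_lp mult.commute[of "norm _"])

lemma lp_T: "0 < g \<Longrightarrow> 0 < Re z \<Longrightarrow> 0 \<le> s \<Longrightarrow> T s (lp g z x) = lp g z (T s x)"
  by (rule lp_commute) (auto simp: T_bounded_linear T_scaleC T_commute)

lemma lp_lp: "0 < g \<Longrightarrow> 0 < Re z \<Longrightarrow> 0 < d \<Longrightarrow> 0 < Re w \<Longrightarrow>
    lp d w (lp g z x) = lp g z (lp d w x)"
  by (rule lp_commute) (auto simp: bounded_linear_lp lp_scaleC lp_T)

lemma lp_diff: "0 < g \<Longrightarrow> 0 < Re z \<Longrightarrow> lp g z (x - y) = lp g z x - lp g z y"
  by (simp add: bounded_linear_lp bounded_linear.linear linear_diff)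

lemma exp_T_has_vector_derivative:
  assumes "(x, y) \<in> generator T" and "0 < t"
  shows "((\<lambda>t. exp (- (z * of_real t)) *\<^sub>C T t x) has_vector_derivative
      - (exp (- (z * of_real t)) *\<^sub>C T t (z *\<^sub>C x - y))) (at t)"
proof -
  have "((\<lambda>t. T t x) has_vector_derivative T t y) (at t within {0<..})"
    by (rule has_vector_derivative_within_subset[OF T_has_vector_derivative[OF assms(1)]])
       (use assms(2) in auto)
  hence T': "((\<lambda>t. T t x) has_vector_derivative T t y) (at t)"
    using assms(2) by (subst (asm) at_within_open) auto
  have e': "((\<lambda>t. exp (- (z * of_real t))) has_vector_derivative - z * exp (- (z * of_real t))) (at t)"
    by (auto intro!: derivative_eq_intros has_vector_derivative_real_field simp: has_field_derivative_def)
  show ?thesis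
    using bounded_bilinear.has_vector_derivative[OF bounded_bilinear_scaleC e' T'] assms(2)
    by (simp add: T_diff T_scaleC scaleC_diff_right scaleC_scaleC scaleC_minus_left mult.commute)
qed

lemma lker_1: "0 < t \<Longrightarrow> lker 1 z t = exp (- (z * of_real t))"
  by (simp add: lker_def)

lemma res_has_integral:
  assumes "0 < Re z"
  shows "((\<lambda>t. exp (- (z * of_real t)) *\<^sub>C T t x) has_integral res z x) {0..}"
  by (rule has_integral_spike[OF _ _ lp_has_integral[OF zero_less_one assms], of "{0}"])
     (auto simp: lker_1)

text \<open>\<open>F\<close> is a primitive of minus the integrand, starts at \<open>x\<close> and
  vanishes at infinity because \<open>0 < Re z\<close>.\<close>

lemma res_generator:
  assumes xy: "(x, y) \<in> generator T" and z: "0 < Re z"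
  shows "res z (z *\<^sub>C x - y) = x"
proof -
  define F where "F t = exp (- (z * of_real t)) *\<^sub>C T t x" for t :: real
  have "((\<lambda>t. - (exp (- (z * of_real t)) *\<^sub>C T t (z *\<^sub>C x - y))) has_integral - F 0) {0..}"
  proof (rule has_integral_ftc_halfline)
    show "continuous_on {0..} F" unfolding F_def by (intro continuous_intros) auto
    show "(F has_vector_derivative - (exp (- (z * of_real t)) *\<^sub>C T t (z *\<^sub>C x - y))) (at t)"
      if "0 < t" for t
      unfolding F_def by (rule exp_T_has_vector_derivative[OF xy that])
    show "(\<lambda>t. - (exp (- (z * of_real t)) *\<^sub>C T t (z *\<^sub>C x - y))) integrable_on {0..}"
      using res_has_integral[OF z] by (intro integrable_neg) blast
    have "((\<lambda>t. exp (- (Re z * t)) * (M * norm x)) \<longlongrightarrow> 0) at_top"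
      using z by real_asymp
    moreover have "\<forall>\<^sub>F t in at_top. norm (F t) \<le> exp (- (Re z * t)) * (M * norm x)"
      using eventually_ge_at_top[of 0]
      by eventually_elim (auto simp: F_def norm_scaleC intro!: bound)
    ultimately show "(F \<longlongrightarrow> 0) at_top" by (rule Lim_null_comparison[rotated])
  qed
  from has_integral_neg[OF this]
  have "((\<lambda>t. exp (- (z * of_real t)) *\<^sub>C T t (z *\<^sub>C x - y)) has_integral x) {0..}"
    by (simp add: F_def)
  thus ?thesis by (rule has_integral_unique[OF res_has_integral[OF z]])
qed

text \<open>A shift of the variable gives \<open>T h (res z x) = exp (z * h)\<close> applied to
  \<open>res z x - P h\<close>. The right side is differentiable at \<open>h = 0\<close>, with
  derivative \<open>z\<close> times \<open>res z x\<close> minus \<open>x\<close>, since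
  \<open>P\<close> has derivative \<open>x\<close> there. The shift is carried out on the truncated
  integrals \<open>P b\<close>, and \<open>b\<close> then tends to infinity.\<close>

lemma res_in_generator:
  assumes z: "0 < Re z"
  shows "(res z x, z *\<^sub>C res z x - x) \<in> generator T"
proof -
  define e where "e t = exp (- (z * of_real t)) *\<^sub>C T t x" for t :: real
  define P where "P t = integral {0..t} e" for t
  have cont: "continuous_on {0..} e" unfolding e_def by (intro continuous_intros) auto
  have int: "e integrable_on {a..b}" if "0 \<le> a" for a b
    by (rule integrable_continuous_real) (use that in \<open>auto intro: continuous_on_subset[OF cont]\<close>)
  have "e integrable_on {0..}" using res_has_integral[OF z, of x] unfolding e_def by blast
  moreover have "integral {0..} e = res z x"
    using res_has_integral[OF z, of x] unfolding e_def by (rule integral_unique)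
  ultimately have lim: "(P \<longlongrightarrow> res z x) at_top" using integral_halfline_limit[of e] by (simp add: P_def[abs_def])
  have shift: "T h (P b) = exp (z * of_real h) *\<^sub>C (P (b + h) - P h)" if h: "0 \<le> h" and b: "0 \<le> b" for h b
  proof -
    have "T h (P b) = integral {0..b} (T h \<circ> e)"
      unfolding P_def by (rule integral_linear[OF int T_bounded_linear[OF h], symmetric]) simp
    also have "\<dots> = integral {0..b} ((\<lambda>v. exp (z * of_real h) *\<^sub>C v) \<circ> (e \<circ> (\<lambda>t. t + h)))"
      by (rule integral_cong) (use h in \<open>auto simp: e_def T_scaleC scaleC_scaleC T_plus[symmetric]
            add.commute algebra_simps simp flip: exp_add\<close>)
    also have "\<dots> = exp (z * of_real h) *\<^sub>C integral {0..b} (e \<circ> (\<lambda>t. t + h))"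
    proof (rule integral_linear[OF _ bounded_linear_scaleC_right])
      show "(e \<circ> (\<lambda>t. t + h)) integrable_on {0..b}"
        by (rule integrable_continuous_real, rule continuous_on_compose)
           (use h in \<open>auto intro!: continuous_intros continuous_on_subset[OF cont]\<close>)
    qed
    also have "integral {0..b} (e \<circ> (\<lambda>t. t + h)) = integral {0+h..b+h} e"
      using integral_shift_cbox[where f=e and a=h and c=h and b="b + h"] by (simp add: o_def)
    also have "integral {0+h..b+h} e = P (b + h) - P h"
      using Henstock_Kurzweil_Integration.integral_combine[where f=e and a=0 and c=h and b="b + h"] h b int by (simp add: P_def algebra_simps)
    finally show ?thesis .
  qed
  have T_res: "T h (res z x) = exp (z * of_real h) *\<^sub>C (res z x - P h)" if h: "0 \<le> h" for h
  proof -
    have "((\<lambda>b. T h (P b)) \<longlongrightarrow> T h (res z x)) at_top"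
      by (rule bounded_linear.tendsto[OF T_bounded_linear[OF h] lim])
    moreover have "\<forall>\<^sub>F b in at_top. T h (P b) = exp (z * of_real h) *\<^sub>C (P (b + h) - P h)"
      using eventually_ge_at_top[of 0] by eventually_elim (rule shift[OF h])
    moreover have "((\<lambda>b. exp (z * of_real h) *\<^sub>C (P (b + h) - P h)) \<longlongrightarrow> exp (z * of_real h) *\<^sub>C (res z x - P h)) at_top"
    proof (intro tendsto_intros filterlim_compose[OF lim])
      show "filterlim (\<lambda>b::real. b + h) at_top at_top"
        using filterlim_tendsto_add_at_top[OF tendsto_const[of h] filterlim_ident] by (simp add: add.commute)
    qed
    ultimately have "((\<lambda>b. T h (P b)) \<longlongrightarrow> exp (z * of_real h) *\<^sub>C (res z x - P h)) at_top"
      and *: "((\<lambda>b. T h (P b)) \<longlongrightarrow> T h (res z x)) at_top"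
      by (simp_all add: tendsto_cong)
    thus ?thesis using tendsto_unique[OF trivial_limit_at_top_linorder *] by simp
  qed
  have dP: "(P has_vector_derivative x) (at 0 within {0..1})"
    using integral_has_vector_derivative[OF continuous_on_subset[OF cont], of 0 1 0]
    by (simp add: P_def[abs_def] e_def)
  have de: "((\<lambda>h. exp (z * of_real h)) has_vector_derivative z) (at 0 within {0..1})"
    by (auto intro!: derivative_eq_intros has_vector_derivative_real_field)
  have "((\<lambda>h. exp (z * of_real h) *\<^sub>C (res z x - P h)) has_vector_derivative
       (exp (z * of_real 0) *\<^sub>C (0 - x) + z *\<^sub>C (res z x - P 0))) (at 0 within {0..1})"
    by (intro bounded_bilinear.has_vector_derivative[OF bounded_bilinear_scaleC de]
        has_vector_derivative_diff has_vector_derivative_const dP)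
  hence "((\<lambda>h. exp (z * of_real h) *\<^sub>C (res z x - P h)) has_vector_derivative (z *\<^sub>C res z x - x))
      (at 0 within {0..1})"
    by (simp add: P_def)
  hence "((\<lambda>h. T h (res z x)) has_vector_derivative (z *\<^sub>C res z x - x)) (at 0 within {0..1})"
    by (rule has_vector_derivative_transform[rotated 2]) (auto simp: T_res)
  hence "((\<lambda>h. (1 / h) *\<^sub>R (T h (res z x) - res z x)) \<longlongrightarrow> z *\<^sub>C res z x - x) (at 0 within {0..1})"
    by (simp add: has_vector_derivative_iff_quotient)
  thus ?thesis unfolding generator_def
    by (simp add: at_within_Icc_at_right)
qed

text \<open>Integration by parts: \<open>F\<close> has the difference of the two integrands as
  derivative, vanishes at 0 because \<open>g > 0\<close>, and decays at infinity. This takes the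
  place of a convolution of kernels.\<close>

lemma lp_res:
  assumes g: "0 < g" and z: "0 < Re z"
  shows "lp (g + 1) z x = lp g z (res z x)"
proof -
  define r where "r = res z x"
  have r: "(r, z *\<^sub>C r - x) \<in> generator T" unfolding r_def by (rule res_in_generator[OF z])
  define F where "F t = (t powr g / Gamma (g + 1)) *\<^sub>R (exp (- (z * of_real t)) *\<^sub>C T t r)" for t :: real
  have G: "Gamma (g + 1) = g * Gamma g" "Gamma g > 0"
    using g nonpos_Ints_nonpos[of g] by (auto intro!: Gamma_plus1)
  have Gn: "Gamma g \<noteq> 0" "Gamma (g + 1) \<noteq> 0"
    using g Gamma_real_pos[of "g + 1"] G(2) by linarith+
  have "((\<lambda>t. lker g z t *\<^sub>C T t r - lker (g + 1) z t *\<^sub>C T t x) has_integral - F 0) {0..}"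
  proof (rule has_integral_ftc_halfline)
    have "continuous_on {0..} (\<lambda>t::real. t powr g)"
      using g by (intro continuous_on_powr' continuous_intros) auto
    with Gn have "continuous_on {0..} (\<lambda>t::real. t powr g / Gamma (g + 1))"
      by (intro continuous_on_divide continuous_on_const) auto
    thus "continuous_on {0..} F" unfolding F_def
      by (rule continuous_on_scaleR) (intro continuous_intros, auto)
    show "(\<lambda>t. lker g z t *\<^sub>C T t r - lker (g + 1) z t *\<^sub>C T t x) integrable_on {0..}"
      by (intro integrable_diff has_integral_integrable[OF lp_has_integral]) (use g z in auto)
    show "(F has_vector_derivative lker g z t *\<^sub>C T t r - lker (g + 1) z t *\<^sub>C T t x) (at t)"
      if t: "0 < t" for t
    proof -
      have p': "((\<lambda>t. t powr g / Gamma (g + 1)) has_field_derivative t powr (g - 1) / Gamma g) (at t)"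
        using t g Gn unfolding G(1) by (auto intro!: derivative_eq_intros simp: powr_diff)
      show ?thesis
        using has_vector_derivative_scaleR[OF p' exp_T_has_vector_derivative[OF r t, of z]] t
        unfolding F_def
        by (simp add: lker_def scaleR_scaleC scaleC_scaleC T_diff scaleC_minus_right)
    qed
    have "((\<lambda>t. t powr g * exp (- (Re z * t))) \<longlongrightarrow> 0) at_top"
      using z g by real_asymp
    from tendsto_mult_left_zero[OF this, of "M * norm r / Gamma (g + 1)"]
    have "((\<lambda>t. t powr g / Gamma (g + 1) * (exp (- (Re z * t)) * (M * norm r))) \<longlongrightarrow> 0) at_top"
      by (simp add: mult_ac)
    moreover have "\<forall>\<^sub>F t in at_top. norm (F t) \<le> t powr g / Gamma (g + 1) * (exp (- (Re z * t)) * (M * norm r))"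
      using eventually_ge_at_top[of 0]
    proof eventually_elim
      case (elim t)
      thus ?case using bound[OF elim, of r] G g by (auto simp: F_def norm_scaleC intro!: mult_left_mono divide_right_mono)
    qed
    ultimately show "(F \<longlongrightarrow> 0) at_top" by (rule Lim_null_comparison[rotated])
  qed
  moreover have "((\<lambda>t. lker g z t *\<^sub>C T t r - lker (g + 1) z t *\<^sub>C T t x) has_integral
      lp g z r - lp (g + 1) z x) {0..}"
    using g z by (intro has_integral_diff lp_has_integral) auto
  ultimately have "- F 0 = lp g z r - lp (g + 1) z x" by (rule has_integral_unique)
  thus ?thesis using g by (simp add: F_def r_def)
qed

end


section \<open>Binomial expansions of fractional powers\<close>

text \<open>The tail of the series is bounded term by term, and the majorant is again a tail of the
  exponential series. No constant is lost, which \<open>lp_expansion\<close> exploits.\<close>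

lemma norm_exp_minus_partial_sum_le:
  fixes z :: complex
  shows "cmod (exp z - (\<Sum>j<J. z ^ j / fact j)) \<le> exp (cmod z) - (\<Sum>j<J. cmod z ^ j / fact j)"
proof -
  have s: "(\<lambda>n. z ^ n / fact n) sums exp z"
    using exp_converges[of z] by (simp add: scaleR_conv_of_real divide_inverse mult.commute)
  have r: "(\<lambda>n. cmod z ^ n / fact n) sums exp (cmod z)"
    using exp_converges[of "cmod z"] by (simp add: divide_inverse mult.commute)
  have s': "(\<lambda>n. z ^ (n + J) / fact (n + J)) sums (exp z - (\<Sum>j<J. z ^ j / fact j))"
    using s by (rule sums_split_initial_segment)
  have r': "(\<lambda>n. cmod z ^ (n + J) / fact (n + J)) sums (exp (cmod z) - (\<Sum>j<J. cmod z ^ j / fact j))"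
    using r by (rule sums_split_initial_segment)
  have "cmod (\<Sum>n. z ^ (n + J) / fact (n + J)) \<le> (\<Sum>n. cmod z ^ (n + J) / fact (n + J))"
    by (rule norm_suminf_le) (use r' in \<open>auto simp: sums_iff norm_divide norm_power\<close>) 
  thus ?thesis using s' r' by (simp add: sums_iff)
qed

text \<open>The Taylor coefficients of (1 - x) powr -b, in a form that shows them to be nonnegative
  for \<open>b > 0\<close>.\<close>

definition bcoef :: "real \<Rightarrow> nat \<Rightarrow> real" where
  "bcoef b j = pochhammer b j / fact j"

lemma bcoef_gbinomial: "of_real (bcoef b j) = (-1) ^ j * ((of_real (- b) :: 'a::{real_normed_field}) gchoose j)"
  by (simp add: bcoef_def gbinomial_pochhammer pochhammer_of_real flip: power_mult_distrib mult.assoc)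

lemma bcoef_sums_real: 
  assumes "0 < w" "0 \<le> q" "q < w"
  shows "(\<lambda>j. bcoef b j * q ^ j * w powr - (b + j)) sums ((w - q) powr - b)"
proof -
  have "(\<lambda>n. (- b gchoose n) * w powr (- b - real n) * (- q) ^ n) sums (w + - q) powr - b"
    by (rule gen_binomial_real'') (use assms in auto)
  moreover have "(- b gchoose n) * w powr (- b - real n) * (- q) ^ n = bcoef b n * q ^ n * w powr - (b + n)" for n
    using bcoef_gbinomial[of b n, where 'a=real] by (simp add: power_minus[of q])
  ultimately show ?thesis by simp
qed

text \<open>\<open>pochhammer b j\<close> is the quotient of the normalising factors
  \<open>Gamma (b + j)\<close> and \<open>Gamma b\<close>; at \<open>t = 0\<close> both sides vanish
  because \<open>0 powr x = 0\<close>.\<close>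

lemma gamma_density_shift:
  fixes b t :: real
  assumes "0 < b" "0 \<le> t"
  shows "pochhammer b j * (t powr (b + j - 1) / Gamma (b + j)) = t powr (b - 1) / Gamma b * t ^ j"
proof (cases "t = 0")
  case False
  have "b \<notin> \<int>\<^sub>\<le>\<^sub>0" using assms nonpos_Ints_nonpos[of b] by auto
  hence "pochhammer b j = Gamma (b + j) / Gamma b" by (rule pochhammer_Gamma)
  moreover have "Gamma (b + j) > 0" using assms by (intro Gamma_real_pos) auto
  moreover have "t powr (b + j - 1) = t powr (b - 1) * t ^ j"
    using assms False by (simp add: powr_add powr_diff powr_realpow)
  ultimately show ?thesis by simp
qed simp

lemma gamma_density_expansion:
  fixes b t :: real
  assumes "0 < b" "0 \<le> t"
  shows "lker b (of_real w - d) t - (\<Sum>j<J. of_real (bcoef b j) * d ^ j * lker (b + j) (of_real w) t)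
    = lker b (of_real w) t * (exp (d * t) - (\<Sum>j<J. (d * t) ^ j / fact j))"
proof -
  have "of_real (bcoef b j) * d ^ j * lker (b + j) (of_real w) t = lker b (of_real w) t * ((d * t) ^ j / fact j)" for j
  proof -
    have "of_real (bcoef b j) * d ^ j * lker (b + j) (of_real w) t
       = complex_of_real (pochhammer b j * (t powr (b + j - 1) / Gamma (b + j))) * d ^ j / fact j * exp (- (of_real w * of_real t))"
      by (simp add: bcoef_def lker_def mult_ac)
    also have "\<dots> = lker b (of_real w) t * ((d * t) ^ j / fact j)"
      unfolding gamma_density_shift[OF assms] by (simp add: lker_def power_mult_distrib)
    finally show ?thesis .
  qed
  moreover have "lker b (of_real w - d) t = lker b (of_real w) t * exp (d * t)"
    by (simp add: lker_def algebra_simps exp_add exp_diff exp_minus divide_inverse)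
  ultimately show ?thesis by (simp add: sum_distrib_left right_diff_distrib)
qed

text \<open>The binomial series of (w - d - A) powr -b. Its remainder has the kernel
  \<open>lker b w\<close> times the remainder of the exponential series at \<open>d * t\<close>.
  Passing from \<open>d\<close> to \<open>q = cmod d\<close> bounds the norm by the remainder of the
  scalar series for \<open>(w - q) powr - b\<close>, which tends to 0.\<close>

lemma (in bounded_C0_semigroup) lp_expansion:
  assumes b: "0 < b" and w: "cmod d < w"
  shows "(\<lambda>j. (of_real (bcoef b j) * d ^ j) *\<^sub>C lp (b + j) (of_real w) v) sums lp b (of_real w - d) v"
proof -
  define q where "q = cmod d"
  have q: "0 \<le> q" "q < w" "0 < w" using w norm_ge_zero[of d] unfolding q_def by linarith+
  have Re: "Re (of_real w - d) > 0" using complex_Re_le_cmod[of d] w by simp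
  define S where "S J = (\<Sum>j<J. (of_real (bcoef b j) * d ^ j) *\<^sub>C lp (b + j) (of_real w) v)" for J
  define s where "s J = (\<Sum>j<J. bcoef b j * q ^ j * w powr - (b + j))" for J
  have bound_S: "norm (lp b (of_real w - d) v - S J) \<le> M * norm v * ((w - q) powr - b - s J)" for J
  proof -
    define D where "D t = lker b (of_real w - d) t *\<^sub>C T t v -
        (\<Sum>j<J. (of_real (bcoef b j) * d ^ j) *\<^sub>C (lker (b + j) (of_real w) t *\<^sub>C T t v))" for t
    define h where "h t = M * norm v * (gdens b (w - q) t -
        (\<Sum>j<J. (bcoef b j * q ^ j) * gdens (b + j) w t))" for t
    have D: "(D has_integral (lp b (of_real w - d) v - S J)) {0..}"
      unfolding D_def S_def
    proof (intro has_integral_diff has_integral_sum finite_lessThan lp_has_integral b Re)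
      fix j :: nat
      have "((\<lambda>t. lker (b + j) (of_real w) t *\<^sub>C T t v) has_integral lp (b + j) (of_real w) v) {0..}"
        by (rule lp_has_integral) (use b q in auto)
      from has_integral_linear[OF this bounded_linear_scaleC_right[of "of_real (bcoef b j) * d ^ j"]]
      show "((\<lambda>t. (of_real (bcoef b j) * d ^ j) *\<^sub>C (lker (b + j) (of_real w) t *\<^sub>C T t v)) has_integral
         (of_real (bcoef b j) * d ^ j) *\<^sub>C lp (b + j) (of_real w) v) {0..}"
        by (simp add: o_def)
    qed
    have h: "(h has_integral (M * norm v * ((w - q) powr - b - s J))) {0..}"
      unfolding h_def s_def
      by (intro has_integral_mult_right has_integral_diff has_integral_sum finite_lessThan
          gamma_density_has_integral) (use b q in auto)
    have "norm (D t) \<le> h t" if t: "t \<in> {0..}" for t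
    proof -
      have "D t = (lker b (of_real w - d) t - (\<Sum>j<J. of_real (bcoef b j) * d ^ j * lker (b + j) (of_real w) t)) *\<^sub>C T t v"
        by (simp add: D_def scaleC_diff_left scaleC_scaleC
            linear_sum[OF bounded_linear.linear[OF bounded_linear_scaleC_left]])
      also have "norm \<dots> = cmod (lker b (of_real w) t) * cmod (exp (d * t) - (\<Sum>j<J. (d * t) ^ j / fact j)) * norm (T t v)"
        using t b by (subst gamma_density_expansion) (auto simp: norm_scaleC norm_mult)
      also have "\<dots> \<le> cmod (lker b (of_real w) t) * (exp (cmod (d * t)) - (\<Sum>j<J. cmod (d * t) ^ j / fact j)) * (M * norm v)"
        by (rule mult_mono[OF mult_left_mono[OF norm_exp_minus_partial_sum_le] bound])
           (use t order_trans[OF norm_ge_zero norm_exp_minus_partial_sum_le[of "d * t" J]] in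
             \<open>auto intro!: mult_nonneg_nonneg simp del: norm_mult\<close>)
      also have "cmod (d * t) = q * t" using t by (simp add: q_def norm_mult)
      also have "cmod (lker b (of_real w) t) * (exp (q * t) - (\<Sum>j<J. (q * t) ^ j / fact j)) * (M * norm v) = h t"
      proof -
        have "(bcoef b j * q ^ j) * gdens (b + j) w t
           = cmod (lker b (of_real w) t) * ((q * t) ^ j / fact j)" for j
        proof -
          have "(bcoef b j * q ^ j) * gdens (b + j) w t
            = (pochhammer b j * (t powr (b + j - 1) / Gamma (b + j))) * q ^ j / fact j * exp (- (w * t))"
            by (simp add: bcoef_def mult_ac)
          also have "\<dots> = cmod (lker b (of_real w) t) * ((q * t) ^ j / fact j)"
            using t b by (subst gamma_density_shift) (auto simp: norm_lker power_mult_distrib)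
          finally show ?thesis .
        qed
        moreover have "gdens b (w - q) t = cmod (lker b (of_real w) t) * exp (q * t)"
          using b by (simp add: norm_lker algebra_simps exp_diff exp_minus divide_inverse)
        ultimately show ?thesis by (simp add: h_def sum_distrib_left algebra_simps)
      qed
      finally show ?thesis .
    qed
    from integral_norm_bound_integral[OF has_integral_integrable[OF D] has_integral_integrable[OF h] this]
    show ?thesis by (simp only: integral_unique[OF D] integral_unique[OF h])
  qed
  have "s \<longlonglongrightarrow> (w - q) powr - b"
    using bcoef_sums_real[OF q(3,1,2), of b] unfolding sums_def s_def .
  hence "(\<lambda>J. M * norm v * ((w - q) powr - b - s J)) \<longlonglongrightarrow> M * norm v * ((w - q) powr - b - (w - q) powr - b)"
    by (intro tendsto_intros)
  hence lim: "(\<lambda>J. M * norm v * ((w - q) powr - b - s J)) \<longlonglongrightarrow> 0" by simp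
  have "(\<lambda>J. lp b (of_real w - d) v - S J) \<longlonglongrightarrow> 0"
    by (rule Lim_null_comparison[OF _ lim]) (auto intro!: always_eventually bound_S)
  from tendsto_diff[OF tendsto_const[of "lp b (of_real w - d) v"] this]
  have "S \<longlonglongrightarrow> lp b (of_real w - d) v" by simp
  thus ?thesis unfolding sums_def S_def .
qed

text \<open>The constant semigroup on the complex numbers has generator 0, so
  \<open>lp b z 1\<close> is the scalar z powr -b and \<open>lp_expansion\<close> also serves scalar
  Laplace transforms.\<close>

lemma bounded_C0_semigroup_id: "bounded_C0_semigroup (\<lambda>t x. x :: complex) 1"
  by standard (auto simp: C0_semigroup_def bounded_clinear_def bounded_linear_ident)

lemma lker_integrable_scalar:
  assumes "0 < b" "0 < Re z"
  shows "lker b z integrable_on {0..}"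
proof -
  interpret bounded_C0_semigroup "\<lambda>t x. x :: complex" 1 by (rule bounded_C0_semigroup_id)
  from lp_has_integral[OF assms, of 1] show ?thesis by (auto simp: scaleC_complex_def integrable_on_def)
qed

text \<open>The integral is z powr -b; later only its modulus matters. Expansion around a positive
  real \<open>w\<close>, where the integral is real, reduces it to the binomial series of a complex
  power, without rotating a contour.\<close>

lemma norm_integral_lker:
  assumes b: "0 < b" and z: "0 < Re z"
  shows "cmod (integral {0..} (lker b z)) = cmod z powr - b"
proof -
  interpret bounded_C0_semigroup "\<lambda>t x. x :: complex" 1 by (rule bounded_C0_semigroup_id)
  have lp: "lp g s 1 = integral {0..} (lker g s)" for g s
    by (simp add: lp_def scaleC_complex_def)
  \<comment> \<open>The expansion reaches \<open>z\<close> if \<open>cmod (w - z) < w\<close>, that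
    is if \<open>(cmod z)\<^sup>2 < 2 * w * Re z\<close>; this \<open>w\<close> is twice the
    threshold.\<close>
  define w where "w = (cmod z)\<^sup>2 / Re z"
  define d where "d = of_real w - z"
  have z0: "cmod z > 0" "z \<noteq> 0" using z by auto
  have w0: "w > 0" using z z0 by (simp add: w_def)
  have "(cmod d)\<^sup>2 = w\<^sup>2 - 2 * w * Re z + (cmod z)\<^sup>2"
    unfolding d_def cmod_power2 by (simp add: power2_eq_square algebra_simps)
  also have "\<dots> < w\<^sup>2" using z z0 by (simp add: w_def)
  finally have d: "cmod d < w" using w0 by (simp add: power2_less_imp_less)
  have lpw: "lp g (of_real w) 1 = of_real (w powr - g)" if "0 < g" for g
  proof -
    have "lker g (of_real w) = (\<lambda>t. of_real (gdens g w t))"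
      by (auto simp: lker_def fun_eq_iff simp flip: exp_of_real)
    hence "(lker g (of_real w) has_integral of_real (w powr - g)) {0..}"
      using has_integral_linear[OF gamma_density_has_integral[OF that w0] bounded_linear_of_real]
      by (simp only: o_def)
    thus ?thesis unfolding lp by (rule integral_unique)
  qed
  have "(\<lambda>j. (of_real (bcoef b j) * d ^ j) *\<^sub>C lp (b + j) (of_real w) 1) sums lp b z 1"
    using lp_expansion[OF b d, of 1] by (simp add: d_def)
  moreover have "(of_real (bcoef b j) * d ^ j) *\<^sub>C lp (b + j) (of_real w) 1 =
      of_real (w powr - b) * ((of_real (- b) gchoose j) * (- d / of_real w) ^ j)" for j
  proof -
    have "w powr - (b + j) = w powr - b / w ^ j"
      using w0 by (simp add: powr_diff powr_realpow)
    thus ?thesis using b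
      by (simp add: lpw scaleC_complex_def bcoef_gbinomial power_minus[of "d / of_real w"] power_divide)
  qed
  ultimately have "(\<lambda>j. of_real (w powr - b) * ((of_real (- b) gchoose j) * (- d / of_real w) ^ j)) sums lp b z 1"
    by simp
  moreover have "(\<lambda>j. of_real (w powr - b) * ((of_real (- b) gchoose j) * (- d / of_real w) ^ j)) sums
      (of_real (w powr - b) * (1 + (- d / of_real w)) powr of_real (- b))"
    by (intro sums_mult gen_binomial_complex) (use d w0 in \<open>simp add: norm_divide\<close>)
  ultimately have "lp b z 1 = of_real (w powr - b) * (1 + (- d / of_real w)) powr of_real (- b)"
    by (rule sums_unique2)
  also have "1 + (- d / of_real w) = z / of_real w" using w0 by (simp add: d_def field_simps)
  finally have "cmod (lp b z 1) = w powr - b * cmod ((z / of_real w) powr of_real (- b))"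
    by (simp add: norm_mult)
  also have "cmod ((z / of_real w) powr of_real (- b)) = cmod (z / of_real w) powr - b"
    using norm_powr_real_powr'[of "of_real (- b)" "z / of_real w"] by simp
  also have "w powr - b * cmod (z / of_real w) powr - b = cmod z powr - b"
    using w0 z0 by (simp add: norm_divide flip: powr_mult)
  finally show ?thesis unfolding lp .
qed


text \<open>Row sums of the double family \<open>F\<close> give \<open>t\<close>, its antidiagonal
  sums the claimed series. As \<open>v\<close> is bounded, the family is absolutely summable and the
  two orders of summation agree.\<close>

lemma cauchy_product_shifted:
  fixes v :: "nat \<Rightarrow> 'a::banach" and a b :: "nat \<Rightarrow> real"
  assumes a: "summable (\<lambda>k. \<bar>a k\<bar>)" and b: "summable (\<lambda>k. \<bar>b k\<bar>)" and v: "\<And>n. norm (v n) \<le> C"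
    and s: "\<And>k. (\<lambda>j. b j *\<^sub>R v (k + j)) sums s k"
    and t: "(\<lambda>k. a k *\<^sub>R s k) sums t"
  shows "(\<lambda>n. (\<Sum>k\<le>n. a k * b (n - k)) *\<^sub>R v n) sums t"
proof -
  define F where "F = (\<lambda>(k, j). (a k * b j) *\<^sub>R v (k + j))"
  have C: "0 \<le> C" using v[of 0] norm_ge_zero order_trans by blast
  have "(\<lambda>x. norm (case x of (k, j) \<Rightarrow> C * (\<bar>a k\<bar> * \<bar>b j\<bar>))) summable_on (UNIV \<times> UNIV)"
  proof (rule iffD2[OF Infinite_Sum.abs_summable_on_Sigma_iff], intro conjI ballI)
    have b': "(\<lambda>j. \<bar>b j\<bar>) summable_on UNIV" and a': "(\<lambda>j. \<bar>a j\<bar>) summable_on UNIV"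
      using a b by (simp_all add: summable_on_UNIV_nonneg_real_iff)
    show "(\<lambda>j. norm (case (k, j) of (k, j) \<Rightarrow> C * (\<bar>a k\<bar> * \<bar>b j\<bar>))) summable_on UNIV" for k
      using summable_on_cmult_right[OF b', of "C * \<bar>a k\<bar>"] C by (simp add: abs_mult mult_ac)
    have "(\<Sum>\<^sub>\<infinity>y. norm (case (k, y) of (k, j) \<Rightarrow> C * (\<bar>a k\<bar> * \<bar>b j\<bar>))) = C * (\<Sum>\<^sub>\<infinity>y. \<bar>b y\<bar>) * \<bar>a k\<bar>" for k
      using infsum_cmult_right[of "C * \<bar>a k\<bar>" "\<lambda>j. \<bar>b j\<bar>" UNIV] b' C by (simp add: abs_mult mult_ac)
    thus "(\<lambda>k. norm (\<Sum>\<^sub>\<infinity>y. norm (case (k, y) of (k, j) \<Rightarrow> C * (\<bar>a k\<bar> * \<bar>b j\<bar>)))) summable_on UNIV"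
      using summable_on_cmult_right[OF a', of "\<bar>C * (\<Sum>\<^sub>\<infinity>y. \<bar>b y\<bar>)\<bar>"] by (simp add: abs_mult)
  qed
  hence "(\<lambda>x. norm (F x)) summable_on (UNIV \<times> UNIV)"
  proof (rule Infinite_Sum.abs_summable_on_comparison_test)
    fix x :: "nat \<times> nat"
    obtain k j where "x = (k, j)" by force
    thus "norm (F x) \<le> norm (case x of (k, j) \<Rightarrow> C * (\<bar>a k\<bar> * \<bar>b j\<bar>))"
      using mult_left_mono[OF v[of "k + j"], of "\<bar>a k\<bar> * \<bar>b j\<bar>"] C by (simp add: F_def abs_mult mult_ac)
  qed
  hence "F summable_on (UNIV \<times> UNIV)" by (rule abs_summable_summable)
  then obtain S where S: "(F has_sum S) (UNIV \<times> UNIV)" by (auto simp: summable_on_def)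
  have "((\<lambda>k. a k *\<^sub>R s k) has_sum S) UNIV"
  proof (rule has_sum_SigmaD[OF S])
    fix k
    have "summable (\<lambda>j. norm (b j *\<^sub>R v (k + j)))"
    proof (rule summable_comparison_test'[of _ 0])
      show "summable (\<lambda>j. \<bar>b j\<bar> * C)" using b by (rule summable_mult2)
      show "norm (norm (b j *\<^sub>R v (k + j))) \<le> \<bar>b j\<bar> * C" for j
        using v[of "k + j"] by (simp add: mult_left_mono)
    qed
    hence "((\<lambda>j. b j *\<^sub>R v (k + j)) has_sum s k) UNIV" using s by (rule norm_summable_imp_has_sum)
    from has_sum_bounded_linear[OF bounded_linear_scaleR_right[of "a k"] this]
    show "((\<lambda>j. F (k, j)) has_sum a k *\<^sub>R s k) UNIV" by (simp add: F_def o_def)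
  qed
  from sums_unique2[OF t has_sum_imp_sums[OF this]] have "t = S" .
  have "((\<lambda>(n, k). F (k, n - k)) has_sum S) (Sigma UNIV (\<lambda>n. {..n}))"
    using S by (subst has_sum_reindex_bij_witness[where i = "\<lambda>(k, j). (k + j, k)" and j = "\<lambda>(n, k). (k, n - k)"
          and h = F and T = "UNIV \<times> UNIV"]) auto
  hence "((\<lambda>n. \<Sum>k\<le>n. F (k, n - k)) has_sum S) UNIV"
    by (rule has_sum_SigmaD) (use has_sum_finite in auto)
  hence "(\<lambda>n. \<Sum>k\<le>n. F (k, n - k)) sums t"
    using \<open>t = S\<close> by (simp add: has_sum_imp_sums)
  thus ?thesis by (simp add: F_def scaleR_sum_left)
qed

text \<open>The Taylor coefficients of (1 - x) powr b.\<close>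

definition ncoef :: "real \<Rightarrow> nat \<Rightarrow> real" where
  "ncoef b k = (-1) ^ k * (b gchoose k)"

text \<open>For \<open>b > 0\<close> the coefficients are of order k powr (-1 - b), so the series
  converges absolutely at the boundary of its disc; this lets \<open>frac_quot\<close> include
  \<open>\<bar>d\<bar> = w\<close>. For natural \<open>b\<close> the limit of \<open>f\<close> is 0,
  which is harmless since only boundedness of \<open>f\<close> enters.\<close>

lemma summable_ncoef:
  assumes "0 < b"
  shows "summable (\<lambda>k. \<bar>ncoef b k\<bar>)"
proof -
  define f where "f n = (b gchoose n) / ((-1) ^ n / exp ((b + 1) * ln (real n)))" for n
  have "f \<longlonglongrightarrow> inverse (Gamma (- b))"
    using gbinomial_asymptotic[of b] by (simp add: f_def[abs_def])
  hence "Bseq f" by (intro convergent_imp_Bseq convergentI)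
  then obtain K where "\<forall>n. norm (f n) \<le> K" by (rule BseqE)
  hence K: "\<bar>f n\<bar> \<le> K" for n by simp
  have le: "norm \<bar>ncoef b n\<bar> \<le> K * real n powr - (b + 1)" if "1 \<le> n" for n
  proof -
    have "\<bar>f n\<bar> = \<bar>ncoef b n\<bar> * real n powr (b + 1)"
      using that by (simp add: f_def ncoef_def abs_mult powr_def)
    with K[of n] have "\<bar>ncoef b n\<bar> * real n powr (b + 1) \<le> K" by simp
    hence "\<bar>ncoef b n\<bar> * real n powr (b + 1) * real n powr - (b + 1) \<le> K * real n powr - (b + 1)"
      by (rule mult_right_mono) simp
    moreover have "real n powr (b + 1) * real n powr - (b + 1) = 1"
      using that by (simp flip: powr_add)
    ultimately show ?thesis by (simp add: mult.assoc)
  qed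
  have "summable (\<lambda>n. K * real n powr - (b + 1))"
    using assms by (intro summable_mult) (simp add: summable_real_powr_iff)
  thus ?thesis using le by (rule summable_comparison_test')
qed

text \<open>The product of (1 - x) powr b and (1 - x) powr -b is 1; on coefficients this is
  Vandermonde's identity.\<close>

lemma ncoef_bcoef_convolution:
  "(\<Sum>k\<le>n. ncoef b k * bcoef b (n - k)) = (if n = 0 then 1 else 0)"
proof -
  have "ncoef b k * bcoef b (n - k) = (-1) ^ n * ((b gchoose k) * (- b gchoose (n - k)))" if "k \<le> n" for k
  proof -
    have "(-1 :: real) ^ k * (-1) ^ (n - k) = (-1) ^ n" using that by (simp flip: power_add)
    thus ?thesis using bcoef_gbinomial[of b "n - k", where 'a = real]
      by (simp add: ncoef_def mult_ac)
  qed
  hence "(\<Sum>k\<le>n. ncoef b k * bcoef b (n - k)) = (-1) ^ n * (\<Sum>k = 0..n. (b gchoose k) * (- b gchoose (n - k)))"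
    by (simp add: sum_distrib_left atLeast0AtMost)
  also have "\<dots> = (-1) ^ n * ((b + - b) gchoose n)" by (simp only: gbinomial_Vandermonde)
  finally show ?thesis by (cases n) auto
qed

context bounded_C0_semigroup
begin

lemma res_funpow:
  assumes "0 < g" "0 < Re z"
  shows "lp g z ((res z ^^ k) x) = lp (g + k) z x"
  using assms(1)
proof (induction k arbitrary: g)
  case (Suc k)
  have "lp g z ((res z ^^ Suc k) x) = lp (g + 1) z ((res z ^^ k) x)"
    using Suc.prems assms(2) by (simp add: lp_res)
  also have "\<dots> = lp (g + 1 + k) z x" by (rule Suc.IH) (use Suc.prems in auto)
  finally show ?case by (simp add: add_ac)
qed simp

text \<open>The constant is \<open>M\<close> and not \<open>M ^ k\<close>, because the power is a
  single Laplace transform \<open>lp k z\<close>. This makes the terms of \<open>frac_quot\<close>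
  summable up to \<open>\<bar>d\<bar> = w\<close>.\<close>

lemma norm_res_funpow:
  assumes "0 < Re z"
  shows "norm ((res z ^^ k) x) \<le> M * Re z powr - real k * norm x"
proof (cases k)
  case 0
  have "1 * norm x \<le> M * norm x" using M_ge_1 by (intro mult_right_mono) auto
  thus ?thesis using 0 assms by simp
next
  case (Suc j)
  have "(res z ^^ k) x = lp (1 + j) z x"
    using res_funpow[of 1 z j x] assms Suc by simp
  thus ?thesis using norm_lp[of "1 + j" z x] assms Suc by simp
qed

text \<open>The binomial series of \<open>(w - \<delta> - A) powr b (w - A) powr -b = (1 - \<delta> R(w)) powr b\<close>.\<close>

definition frac_quot :: "real \<Rightarrow> real \<Rightarrow> real \<Rightarrow> 'a \<Rightarrow> 'a" where
  "frac_quot b w d z = (\<Sum>k. (ncoef b k * d ^ k) *\<^sub>R (res (of_real w) ^^ k) z)"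

lemma norm_frac_quot_term:
  assumes "0 < w" "\<bar>d\<bar> \<le> w"
  shows "norm ((ncoef b k * d ^ k) *\<^sub>R (res (of_real w) ^^ k) z) \<le> \<bar>ncoef b k\<bar> * (M * norm z)"
proof -
  have "norm ((ncoef b k * d ^ k) *\<^sub>R (res (of_real w) ^^ k) z)
      \<le> \<bar>ncoef b k\<bar> * w ^ k * (M * w powr - real k * norm z)"
    using norm_res_funpow[of "of_real w" k z] assms
    by (auto simp: abs_mult power_abs intro!: mult_mono power_mono mult_nonneg_nonneg)
  also have "\<dots> = \<bar>ncoef b k\<bar> * (M * norm z)"
    using assms by (simp add: powr_minus powr_realpow field_simps)
  finally show ?thesis .
qed

lemma frac_quot_sums:
  assumes "0 < b" "0 < w" "\<bar>d\<bar> \<le> w"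
  shows "(\<lambda>k. (ncoef b k * d ^ k) *\<^sub>R (res (of_real w) ^^ k) z) sums frac_quot b w d z"
  unfolding frac_quot_def
proof (rule summable_sums, rule summable_comparison_test'[where N = 0])
  show "summable (\<lambda>k. \<bar>ncoef b k\<bar> * (M * norm z))"
    by (rule summable_mult2[OF summable_ncoef[OF assms(1)]])
qed (use norm_frac_quot_term assms in auto)

text \<open>Expanding \<open>lp b (w - d)\<close> by \<open>lp_expansion\<close> and
  \<open>frac_quot\<close> by its definition gives a double series whose antidiagonal coefficients
  are those of \<open>ncoef_bcoef_convolution\<close>: only the term of order 0 survives.\<close>

lemma lp_frac_quot:
  assumes b: "0 < b" and w: "\<bar>d\<bar> < w"
  shows "lp b (of_real (w - d)) (frac_quot b w d z) = lp b (of_real w) z"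
proof -
  have w0: "0 < w" using w by linarith
  have d: "w - d > 0" using w by linarith
  \<comment> \<open>Powers of \<open>w\<close> are moved from the coefficients into
    \<open>v\<close>, so that \<open>v\<close> becomes bounded.\<close>
  define a where "a k = ncoef b k * (d / w) ^ k" for k
  define e where "e k = bcoef b k * (d / w) ^ k" for k
  define v where "v n = w ^ n *\<^sub>R lp (b + n) (of_real w) z" for n
  have "(\<lambda>n. (\<Sum>k\<le>n. a k * e (n - k)) *\<^sub>R v n) sums lp b (of_real (w - d)) (frac_quot b w d z)"
  proof (rule cauchy_product_shifted)
    show "norm (v n) \<le> M * w powr - b * norm z" for n
    proof -
      have "norm (v n) \<le> w ^ n * (M * w powr - (b + n) * norm z)"
        unfolding v_def using norm_lp[of "b + n" "of_real w" z] b w0 by (auto intro!: mult_left_mono)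
      also have "\<dots> = M * w powr - b * norm z"
        using w0 by (simp add: powr_diff powr_realpow)
      finally show ?thesis .
    qed
    show "summable (\<lambda>k. \<bar>a k\<bar>)"
    proof (rule summable_comparison_test'[OF summable_ncoef[OF b], of 0])
      fix k
      have "\<bar>d / w\<bar> ^ k \<le> 1" using w w0 by (intro power_le_one) auto
      thus "norm \<bar>a k\<bar> \<le> \<bar>ncoef b k\<bar>"
        unfolding a_def by (simp add: abs_mult power_abs mult_left_le del: abs_divide)
    qed
    have "summable (\<lambda>j. bcoef b j * \<bar>d\<bar> ^ j * w powr - (b + j))"
      using bcoef_sums_real[of w "\<bar>d\<bar>" b] w w0 by (simp add: sums_iff)
    hence "summable (\<lambda>j. w powr b * (bcoef b j * \<bar>d\<bar> ^ j * w powr - (b + j)))" by (rule summable_mult)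
    moreover have "w powr b * (bcoef b j * \<bar>d\<bar> ^ j * w powr - (b + j)) = \<bar>e j\<bar>" for j
    proof -
      have "bcoef b j \<ge> 0" using b by (simp add: bcoef_def pochhammer_nonneg)
      moreover have "w powr b * w powr - (b + j) = 1 / w ^ j"
        using w0 by (simp add: powr_minus powr_realpow divide_inverse flip: powr_add)
      moreover have "w powr b * (bcoef b j * \<bar>d\<bar> ^ j * w powr - (b + j)) =
          bcoef b j * \<bar>d\<bar> ^ j * (w powr b * w powr - (b + j))" by simp
      ultimately show ?thesis using w0 by (simp only: e_def abs_mult power_abs power_divide abs_divide) simp
    qed
    ultimately show "summable (\<lambda>k. \<bar>e k\<bar>)" by (simp only:)
    show "(\<lambda>j. e j *\<^sub>R v (k + j)) sums (w ^ k *\<^sub>R lp b (of_real (w - d)) ((res (of_real w) ^^ k) z))" for k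
    proof -
      have "(\<lambda>j. w ^ k *\<^sub>R ((of_real (bcoef b j) * of_real d ^ j) *\<^sub>C lp (b + j) (of_real w) ((res (of_real w) ^^ k) z)))
          sums (w ^ k *\<^sub>R lp b (of_real w - of_real d) ((res (of_real w) ^^ k) z))"
        by (intro sums_scaleR_right lp_expansion b) (use w in simp)
      moreover have "w ^ k *\<^sub>R ((of_real (bcoef b j) * of_real d ^ j) *\<^sub>C lp (b + j) (of_real w) ((res (of_real w) ^^ k) z))
         = e j *\<^sub>R v (k + j)" for j
      proof -
        have "(of_real (bcoef b j) * of_real d ^ j) *\<^sub>C y = (bcoef b j * d ^ j) *\<^sub>R y" for y :: 'a
          by (simp add: scaleR_scaleC)
        moreover have "lp (b + j) (of_real w) ((res (of_real w) ^^ k) z) = lp (b + (k + j)) (of_real w) z"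
          using res_funpow[of "b + j" "of_real w" k z] b w0 by (simp add: add_ac)
        ultimately show ?thesis using w0 by (simp add: e_def v_def power_add power_divide)
      qed
      ultimately show ?thesis by simp
    qed
    have "(\<lambda>k. lp b (of_real (w - d)) ((ncoef b k * d ^ k) *\<^sub>R (res (of_real w) ^^ k) z))
        sums lp b (of_real (w - d)) (frac_quot b w d z)"
      by (intro bounded_linear.sums[OF bounded_linear_lp] frac_quot_sums) (use b d w0 w in auto)
    moreover have "lp b (of_real (w - d)) ((ncoef b k * d ^ k) *\<^sub>R (res (of_real w) ^^ k) z)
        = a k *\<^sub>R w ^ k *\<^sub>R lp b (of_real (w - d)) ((res (of_real w) ^^ k) z)" for k
      using b d w0 by (simp add: linear_scale[OF bounded_linear.linear[OF bounded_linear_lp]] a_def power_divide)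
    ultimately show "(\<lambda>k. a k *\<^sub>R w ^ k *\<^sub>R lp b (of_real (w - d)) ((res (of_real w) ^^ k) z)) sums
        lp b (of_real (w - d)) (frac_quot b w d z)" by simp
  qed
  moreover have "(\<Sum>k\<le>n. a k * e (n - k)) = (if n = 0 then 1 else 0)" for n
  proof -
    have "a k * e (n - k) = (d / w) ^ n * (ncoef b k * bcoef b (n - k))" if "k \<le> n" for k
    proof -
      have "(d / w) ^ n = (d / w) ^ k * (d / w) ^ (n - k)" using that by (simp flip: power_add)
      thus ?thesis by (simp only: a_def e_def mult_ac)
    qed
    hence "(\<Sum>k\<le>n. a k * e (n - k)) = (d / w) ^ n * (\<Sum>k\<le>n. ncoef b k * bcoef b (n - k))"
      by (simp add: sum_distrib_left)
    thus ?thesis by (simp add: ncoef_bcoef_convolution)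
  qed
  ultimately have "(\<lambda>n. (if n = 0 then 1 else 0) *\<^sub>R v n) sums lp b (of_real (w - d)) (frac_quot b w d z)"
    by simp
  moreover have "(\<lambda>n. (if n = 0 then 1 else 0) *\<^sub>R v n) sums v 0"
    using sums_single[of 0 v] by (simp add: if_distrib[of "\<lambda>c. c *\<^sub>R _"] cong: if_cong)
  ultimately have "lp b (of_real (w - d)) (frac_quot b w d z) = v 0" by (rule sums_unique2)
  thus ?thesis by (simp add: v_def)
qed

text \<open>A single quotient from \<open>w = 1\<close> reaches only \<open>e < 2\<close>, because
  of the condition \<open>\<bar>1 - e\<bar> < 1\<close>. Larger \<open>e\<close> are reached in
  geometric steps of ratio 3/2.\<close>

lemma lp_range_shift:
  assumes b: "0 < b" and e: "0 < e"
  shows "\<exists>u. lp b (of_real e) u = lp b 1 z"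
proof -
  have "\<exists>u. lp b (of_real e) u = lp b 1 z" if "0 < e" "e \<le> (3 / 2) ^ n" for n e
    using that
  proof (induction n arbitrary: e)
    case 0
    thus ?case using lp_frac_quot[OF b, of "1 - e" 1 z] by auto
  next
    case (Suc n)
    have "\<exists>u. lp b (of_real (2 * e / 3)) u = lp b 1 z"
      by (rule Suc.IH) (use Suc.prems in auto)
    then obtain u where u: "lp b (of_real (2 * e / 3)) u = lp b 1 z" by blast
    \<comment> \<open>From centre \<open>2 * e / 3\<close> the shift \<open>- e / 3\<close> leads to
      \<open>e\<close>; it is half the centre in modulus, hence inside the disc of
      convergence.\<close>
    have "lp b (of_real (2 * e / 3 - (- e / 3))) (frac_quot b (2 * e / 3) (- e / 3) u) = lp b 1 z"
      using lp_frac_quot[OF b, of "- e / 3" "2 * e / 3" u] Suc.prems u by simp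
    moreover have "2 * e / 3 - (- e / 3) = e" by simp
    ultimately show ?case by auto
  qed
  moreover obtain n where "e \<le> (3 / 2) ^ n"
    using real_arch_pow[of "3 / 2" e] less_imp_le by auto
  ultimately show ?thesis using e by blast
qed

lemma shifted_neg_power_eq_lp: "shifted_neg_power T e b x = lp b (of_real e) x"
proof -
  have "lker b (of_real e) t *\<^sub>C T t x = (1 / Gamma b) *\<^sub>R ((t powr (b - 1) * exp (- e * t)) *\<^sub>R T t x)" for t
  proof -
    have "lker b (of_real e) t = of_real (1 / Gamma b * (t powr (b - 1) * exp (- e * t)))"
      by (simp add: lker_def flip: exp_of_real)
    thus ?thesis by (simp only: scaleC_of_real scaleR_scaleR)
  qed
  thus ?thesis by (simp only: shifted_neg_power_def lp_def integral_cmul)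
qed

text \<open>The preimages \<open>frac_quot b 1 (1 - e) z\<close> converge as \<open>e\<close> tends
  to 0, because their series converges uniformly in \<open>d\<close> on \<open>{0..1}\<close>, end
  point included.\<close>

lemma lp_in_domain_neg_generator_power:
  assumes b: "0 < b"
  shows "lp b 1 z \<in> Domain (neg_generator_power T b)"
proof -
  \<comment> \<open>Values at \<open>e > 1\<close> do not affect the limit, but a preimage is
    demanded at every positive \<open>e\<close>.\<close>
  define u where "u e = (if e \<le> 1 then frac_quot b 1 (1 - e) z else (SOME u. lp b (of_real e) u = lp b 1 z))" for e :: real
  have "lp b (of_real e) (u e) = lp b 1 z" if "0 < e" for e
  proof (cases "e \<le> 1")
    case True
    thus ?thesis using lp_frac_quot[OF b, of "1 - e" 1 z] that by (simp add: u_def)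
  next
    case False
    thus ?thesis using someI_ex[OF lp_range_shift[OF b that, of z]] by (simp add: u_def)
  qed
  moreover have "(u \<longlongrightarrow> frac_quot b 1 1 z) (at_right 0)"
  proof -
    have "continuous_on {0..1} (\<lambda>d. frac_quot b 1 d z)"
    proof (rule uniform_limit_theorem)
      show "uniform_limit {0..1} (\<lambda>n d. \<Sum>k<n. (ncoef b k * d ^ k) *\<^sub>R (res (of_real 1) ^^ k) z)
          (\<lambda>d. frac_quot b 1 d z) sequentially"
        unfolding frac_quot_def
      proof (rule Weierstrass_m_test)
        show "norm ((ncoef b k * d ^ k) *\<^sub>R (res (of_real 1) ^^ k) z) \<le> \<bar>ncoef b k\<bar> * (M * norm z)"
          if "d \<in> {0..1}" for k d
          by (rule norm_frac_quot_term) (use that in auto)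
        show "summable (\<lambda>k. \<bar>ncoef b k\<bar> * (M * norm z))"
          by (rule summable_mult2[OF summable_ncoef[OF b]])
      qed
    qed (auto intro!: always_eventually continuous_intros)
    hence "((\<lambda>d. frac_quot b 1 d z) \<longlongrightarrow> frac_quot b 1 1 z) (at 1 within {0..1})"
      by (simp add: continuous_on_def)
    moreover have "filterlim (\<lambda>e::real. 1 - e) (at 1 within {0..1}) (at_right 0)"
      unfolding filterlim_at
    proof
      show "\<forall>\<^sub>F e::real in at_right 0. 1 - e \<in> {0..1} \<and> 1 - e \<noteq> 1"
        unfolding eventually_at_right_field by (rule exI[of _ 1]) auto
      have "((\<lambda>e::real. 1 - e) \<longlongrightarrow> 1 - 0) (at_right 0)" by (intro tendsto_intros)
      thus "((\<lambda>e::real. 1 - e) \<longlongrightarrow> 1) (at_right 0)" by simp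
    qed
    ultimately have "((\<lambda>e. frac_quot b 1 (1 - e) z) \<longlongrightarrow> frac_quot b 1 1 z) (at_right 0)"
      by (rule filterlim_compose)
    moreover have "\<forall>\<^sub>F e in at_right 0. frac_quot b 1 (1 - e) z = u e"
      unfolding eventually_at_right_field by (rule exI[of _ 1]) (auto simp: u_def)
    ultimately show ?thesis by (rule Lim_transform_eventually)
  qed
  ultimately show ?thesis
    unfolding neg_generator_power_def shifted_neg_power_eq_lp by blast
qed

end


section \<open>Resolvent estimates\<close>

context bounded_C0_semigroup
begin

text \<open>Pairing with \<open>y\<close> turns the vector-valued Henstock-Kurzweil integral into a
  scalar Lebesgue integral, the setting of the hypothesis on \<open>T\<close> and of Fubini's
  theorem.\<close>

lemma cinner_lp:
  assumes g: "0 < g" "0 < Re z"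
  shows "integrable lborel (\<lambda>t. indicator {0..} t *\<^sub>R (lker g z t * cinner (T t x) y))"
    and "(\<integral>t. indicator {0..} t *\<^sub>R (lker g z t * cinner (T t x) y) \<partial>lborel) = cinner (lp g z x) y"
proof -
  let ?f = "\<lambda>t. indicator {0..} t *\<^sub>R (lker g z t * cinner (T t x) y)"
  have "?f = (\<lambda>t. indicator {0<..} t *\<^sub>R (lker g z t * cinner (T t x) y))"
    by (auto simp: fun_eq_iff indicator_def lker_def)
  moreover have "\<dots> \<in> borel_measurable borel"
    by (intro borel_measurable_continuous_on_indicator continuous_intros continuous_on_lker
        continuous_on_cinner) auto
  ultimately have meas: "?f \<in> borel_measurable lborel" by simp
  show int: "integrable lborel ?f"
  proof (rule Bochner_Integration.integrable_bound[OF _ meas])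
    show "integrable lborel (\<lambda>t. (M * norm x * norm y) * (indicator {0..} t * gdens g (Re z) t))"
      by (intro integrable_mult_right gamma_density_integrable g)
    show "AE t in lborel. norm (?f t) \<le> norm ((M * norm x * norm y) * (indicator {0..} t * gdens g (Re z) t))"
    proof (intro AE_I2)
      fix t :: real
      show "norm (?f t) \<le> norm ((M * norm x * norm y) * (indicator {0..} t * gdens g (Re z) t))"
      proof (cases "0 \<le> t")
        case True
        have "cmod (cinner (T t x) y) \<le> M * norm x * norm y"
          using cmod_cinner_le[of "T t x" y] mult_right_mono[OF bound[OF True, of x], of "norm y"] by simp
        hence "cmod (lker g z t) * cmod (cinner (T t x) y) \<le> cmod (lker g z t) * (M * norm x * norm y)"
          by (rule mult_left_mono) simp
        also have "\<dots> \<le> norm ((M * norm x * norm y) * cmod (lker g z t))"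
          by (simp add: mult.commute)
        finally show ?thesis using True g by (simp add: norm_mult norm_lker)
      qed simp
    qed
  qed
  have "((\<lambda>t. lker g z t * cinner (T t x) y) has_integral cinner (lp g z x) y) {0..}"
    using has_integral_linear[OF lp_has_integral[OF g] bounded_linear_cinner_left, of y x]
    by (simp add: o_def cinner_scaleC_left)
  moreover have "?f = (\<lambda>t. if t \<in> {0..} then lker g z t * cinner (T t x) y else 0)"
    by (auto simp: fun_eq_iff)
  ultimately have "(?f has_integral cinner (lp g z x) y) UNIV"
    by (simp only: has_integral_restrict_UNIV)
  moreover have "(?f has_integral (\<integral>t. ?f t \<partial>lborel)) UNIV" by (rule has_integral_integral_lborel[OF int])
  ultimately show "(\<integral>t. ?f t \<partial>lborel) = cinner (lp g z x) y" using has_integral_unique by blast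
qed

text \<open>A pointwise substitute for Hoelder's inequality that includes \<open>p = 1\<close>:
  above \<open>u\<close>, write \<open>f = f powr (1 - p) * f powr p\<close> and use that the first
  exponent is at most 0.\<close>

lemma le_add_powr:
  fixes f u p :: real
  assumes "0 \<le> f" "0 < u" "1 \<le> p"
  shows "f \<le> u + u powr (1 - p) * f powr p"
proof (cases "f \<le> u")
  case True
  thus ?thesis by (smt (verit) mult_nonneg_nonneg powr_ge_zero)
next
  case False
  have "f = f powr (1 - p) * f powr p" using False assms by (simp flip: powr_add)
  also have "\<dots> \<le> u powr (1 - p) * f powr p"
    using False assms by (intro mult_right_mono powr_mono2') auto
  finally show ?thesis using assms by simp
qed

lemma weak_lp_resolvent_bound:
  assumes p: "1 \<le> p" and z: "0 < Re z"
    and fin: "(\<integral>\<^sup>+t\<in>{0..}. ennreal (cmod (cinner (T t x) y) powr p) \<partial>lborel) < \<infinity>"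
  shows "Re z powr (1 - 1 / p) * cmod (cinner (res z x) y)
     \<le> 1 + enn2real (\<integral>\<^sup>+t\<in>{0..}. ennreal (cmod (cinner (T t x) y) powr p) \<partial>lborel)"
proof -
  define a where "a = Re z"
  \<comment> \<open>The threshold balances the two terms: both \<open>u / a\<close> and
    \<open>u powr (1 - p)\<close> equal \<open>a powr (1 / p - 1)\<close>.\<close>
  define u where "u = a powr (1 / p)"
  define f where "f t = cmod (cinner (T t x) y)" for t
  have a: "0 < a" and u: "0 < u" using z by (auto simp: a_def u_def)
  have meas: "(\<lambda>t. indicator {0..} t *\<^sub>R (f t powr p)) \<in> borel_measurable borel"
    unfolding f_def using p
    by (intro borel_measurable_continuous_on_indicator continuous_on_powr' continuous_intros continuous_on_cinner) auto
  have eq: "(\<integral>\<^sup>+t\<in>{0..}. ennreal (cmod (cinner (T t x) y) powr p) \<partial>lborel) = (\<integral>\<^sup>+t. ennreal (indicator {0..} t *\<^sub>R (f t powr p)) \<partial>lborel)"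
    by (intro nn_integral_cong) (auto simp: f_def indicator_def)
  have int_f: "integrable lborel (\<lambda>t. indicator {0..} t *\<^sub>R (f t powr p))"
  proof (rule integrableI_nonneg)
    show "(\<integral>\<^sup>+t. ennreal (indicator {0..} t *\<^sub>R (f t powr p)) \<partial>lborel) < \<infinity>"
      using fin unfolding eq .
  qed (use meas in auto)
  define J where "J = (\<integral>t. indicator {0..} t *\<^sub>R (f t powr p) \<partial>lborel)"
  have J: "enn2real (\<integral>\<^sup>+t\<in>{0..}. ennreal (cmod (cinner (T t x) y) powr p) \<partial>lborel) = J"
    unfolding eq J_def by (rule integral_eq_nn_integral[symmetric]) (use meas in auto)
  define E0 where "E0 t = indicator {0..} t * gdens 1 a t" for t
  have int_e: "integrable lborel E0"
    unfolding E0_def by (rule gamma_density_integrable) (use a in auto)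
  have int_e_eq: "(\<integral>t. E0 t \<partial>lborel) = 1 / a"
  proof -
    have "(\<integral>t. E0 t \<partial>lborel) = a powr - 1"
      using gamma_density_nn_integral[OF zero_less_one a] int_e unfolding E0_def
      by (subst integral_eq_nn_integral) auto
    thus ?thesis using a by (simp add: powr_minus divide_inverse)
  qed
  have "cmod (cinner (res z x) y) \<le> (\<integral>t. norm (indicator {0..} t *\<^sub>R (lker 1 z t * cinner (T t x) y)) \<partial>lborel)"
    unfolding cinner_lp(2)[OF zero_less_one z, symmetric] by (rule integral_norm_bound)
  also have "\<dots> \<le> (\<integral>t. u * E0 t +
      u powr (1 - p) * (indicator {0..} t *\<^sub>R (f t powr p)) \<partial>lborel)"
  proof (rule integral_mono)
    show "integrable lborel (\<lambda>t. norm (indicator {0..} t *\<^sub>R (lker 1 z t * cinner (T t x) y)))"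
      by (rule integrable_norm[OF cinner_lp(1)]) (use z in auto)
    show "integrable lborel (\<lambda>t. u * E0 t +
      u powr (1 - p) * (indicator {0..} t *\<^sub>R (f t powr p)))"
      by (intro Bochner_Integration.integrable_add integrable_mult_right int_e int_f)
    fix t :: real
    show "norm (indicator {0..} t *\<^sub>R (lker 1 z t * cinner (T t x) y)) \<le>
      u * E0 t +
      u powr (1 - p) * (indicator {0..} t *\<^sub>R (f t powr p))"
    proof (cases "0 \<le> t")
      case True
      define E where "E = gdens 1 a t"
      have E: "0 \<le> E" "E \<le> 1" using True a by (auto simp: E_def mult_le_one)
      have f0: "0 \<le> f t" by (simp add: f_def)
      have "E * f t \<le> E * (u + u powr (1 - p) * f t powr p)"
        by (rule mult_left_mono[OF le_add_powr[OF f0 u p] E(1)])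
      also have "\<dots> \<le> u * E + u powr (1 - p) * f t powr p"
        using mult_right_mono[OF E(2), of "u powr (1 - p) * f t powr p"] by (simp add: algebra_simps)
      finally show ?thesis using True by (simp add: norm_mult norm_lker E_def E0_def f_def a_def)
    qed (simp add: E0_def)
  qed
  also have "\<dots> = u * (1 / a) + u powr (1 - p) * J"
    unfolding J_def int_e_eq[symmetric]
    by (subst Bochner_Integration.integral_add) (use int_e int_f in auto)
  also have "u * (1 / a) = a powr (1 / p - 1)" using a by (simp add: u_def powr_diff)
  also have "u powr (1 - p) = a powr (1 / p - 1)" using p by (simp add: u_def powr_powr diff_divide_distrib)
  finally have "a powr (1 - 1 / p) * cmod (cinner (res z x) y) \<le> a powr (1 - 1 / p) * (a powr (1 / p - 1) * (1 + J))"
    by (intro mult_left_mono) (auto simp: algebra_simps)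
  also have "\<dots> = 1 + J" using a by (simp flip: powr_add mult.assoc)
  finally show ?thesis unfolding J a_def .
qed

lemma res_identity:
  assumes "0 < Re z" "0 < Re w"
  shows "res z x - res w x = (w - z) *\<^sub>C res z (res w x)"
proof -
  have "res z (z *\<^sub>C res w x - (w *\<^sub>C res w x - x)) = res w x"
    by (rule res_generator[OF res_in_generator[OF assms(2)] assms(1)])
  thus ?thesis using assms
    by (simp add: lp_diff lp_add lp_scaleC scaleC_diff_left algebra_simps)
qed

text \<open>Variation of constants: the difference is minus the integral of
  \<open>exp (z * (t - s))\<close> times \<open>T s x\<close> over \<open>{0..t}\<close>. Its size
  depends on \<open>Re z\<close> alone, uniformly in the imaginary part.\<close>

lemma norm_T_res_diff:
  assumes z: "0 < Re z" and t: "0 \<le> t"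
  shows "norm (T t (res z x) - exp (z * of_real t) *\<^sub>C res z x) \<le> t * exp (Re z * t) * (M * norm x)"
proof -
  define r where "r = res z x"
  have "((\<lambda>s. - (exp (- (z * of_real s)) *\<^sub>C T s (z *\<^sub>C r - (z *\<^sub>C r - x)))) has_integral
      (exp (- (z * of_real t)) *\<^sub>C T t r - exp (- (z * of_real 0)) *\<^sub>C T 0 r)) {0..t}"
  proof (rule fundamental_theorem_of_calculus_interior[OF t])
    fix s assume "s \<in> {0<..<t}"
    thus "((\<lambda>s. exp (- (z * of_real s)) *\<^sub>C T s r) has_vector_derivative
        - (exp (- (z * of_real s)) *\<^sub>C T s (z *\<^sub>C r - (z *\<^sub>C r - x)))) (at s)"
      unfolding r_def by (intro exp_T_has_vector_derivative res_in_generator[OF z]) auto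
  qed (auto intro!: continuous_intros)
  hence I: "((\<lambda>s. - (exp (- (z * of_real s)) *\<^sub>C T s x)) has_integral
      (exp (- (z * of_real t)) *\<^sub>C T t r - r)) {0..t}" by simp
  have "norm (exp (- (z * of_real t)) *\<^sub>C T t r - r) \<le> (M * norm x) * measure lborel {0..t}"
  proof (rule has_integral_bound_real[OF _ _ I, of _ "{}"])
    fix s assume s: "s \<in> {0..t} - {}"
    have "exp (- (Re z * s)) * norm (T s x) \<le> 1 * (M * norm x)"
      by (intro mult_mono bound) (use s z in auto)
    thus "norm (- (exp (- (z * of_real s)) *\<^sub>C T s x)) \<le> M * norm x" by (simp add: norm_scaleC)
  qed (use M_ge_1 in auto)
  hence "norm (exp (- (z * of_real t)) *\<^sub>C T t r - r) \<le> t * (M * norm x)" using t by (simp add: mult.commute)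
  hence "exp (Re z * t) * norm (exp (- (z * of_real t)) *\<^sub>C T t r - r) \<le> exp (Re z * t) * (t * (M * norm x))"
    by (rule mult_left_mono) simp
  moreover have "T t r - exp (z * of_real t) *\<^sub>C r = exp (z * of_real t) *\<^sub>C (exp (- (z * of_real t)) *\<^sub>C T t r - r)"
    by (simp add: scaleC_diff_right scaleC_scaleC flip: exp_add)
  ultimately show ?thesis unfolding r_def[symmetric] by (simp add: norm_scaleC mult_ac)
qed

text \<open>The scalar integral stands for (1 - z) powr -b: it appears when
  \<open>T t (res z x)\<close> under the integral is replaced by \<open>exp (z * t)\<close> times
  \<open>res z x\<close>. The factor \<open>t\<close> of \<open>norm_T_res_diff\<close> raises the
  Gamma density from order \<open>b\<close> to \<open>b + 1\<close>, at the price of a factor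
  \<open>b\<close>, and \<open>Re z \<le> 1 / 2\<close> leaves the rate 1/2.\<close>

lemma norm_lp_res_diff:
  assumes b: "0 < b" and z: "0 < Re z" "Re z \<le> 1 / 2"
  shows "norm (lp b 1 (res z x) - integral {0..} (lker b (1 - z)) *\<^sub>C res z x) \<le> M * b * (1 / 2) powr - (b + 1) * norm x"
proof -
  define r where "r = res z x"
  define D where "D t = lker b 1 t *\<^sub>C T t r - lker b (1 - z) t *\<^sub>C r" for t
  have "(lker b (1 - z) has_integral integral {0..} (lker b (1 - z))) {0..}"
    by (rule integrable_integral, rule lker_integrable_scalar) (use b z in auto)
  from has_integral_linear[OF this bounded_linear_scaleC_left[of r]]
  have D: "(D has_integral (lp b 1 r - integral {0..} (lker b (1 - z)) *\<^sub>C r)) {0..}"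
    unfolding D_def by (intro has_integral_diff lp_has_integral) (use b in \<open>auto simp: o_def\<close>)
  have h: "((\<lambda>t. M * b * norm x * gdens (b + 1) (1 / 2) t) has_integral
      (M * b * norm x * (1 / 2) powr - (b + 1))) {0..}"
    by (intro has_integral_mult_right gamma_density_has_integral) (use b in auto)
  have "norm (D t) \<le> M * b * norm x * gdens (b + 1) (1 / 2) t"
    if "t \<in> {0..}" for t
  proof (cases "t = 0")
    case True
    thus ?thesis by (simp add: D_def lker_def)
  next
    case False
    hence t: "0 < t" using that by simp
    have "lker b (1 - z) t = lker b 1 t * exp (z * of_real t)"
      by (simp add: lker_def algebra_simps flip: exp_add)
    hence "D t = lker b 1 t *\<^sub>C (T t r - exp (z * of_real t) *\<^sub>C r)"
      by (simp add: D_def scaleC_diff_right scaleC_scaleC)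
    hence "norm (D t) \<le> cmod (lker b 1 t) * (t * exp (Re z * t) * (M * norm x))"
      using norm_T_res_diff[OF z(1), of t x] t by (simp add: norm_scaleC r_def mult_left_mono)
    also have "\<dots> \<le> cmod (lker b 1 t) * (t * exp (1 / 2 * t) * (M * norm x))"
      using z t M_ge_1 by (intro mult_left_mono mult_right_mono) auto
    also have "\<dots> = M * b * norm x * gdens (b + 1) (1 / 2) t"
    proof -
      have "Gamma (b + 1) = b * Gamma b" by (rule Gamma_plus1) (use b nonpos_Ints_nonpos[of b] in auto)
      moreover have "exp (- t) * exp (1 / 2 * t) = exp (- (1 / 2 * t))" by (simp flip: exp_add)
      moreover have "t powr (b - 1) * t = t powr b" using t by (simp add: powr_diff)
      moreover have "cmod (lker b 1 t) * (t * exp (1 / 2 * t)) =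
          (t powr (b - 1) * t) / Gamma b * (exp (- t) * exp (1 / 2 * t))"
        using b by (simp add: norm_lker)
      ultimately have "cmod (lker b 1 t) * (t * exp (1 / 2 * t)) = t powr b / Gamma b * exp (- (1 / 2 * t))"
        by (simp only:)
      moreover have "t powr b / Gamma b = b * (t powr (b + 1 - 1) / Gamma (b + 1))"
        using \<open>Gamma (b + 1) = b * Gamma b\<close> b by simp
      ultimately have "cmod (lker b 1 t) * (t * exp (1 / 2 * t)) =
          b * (t powr (b + 1 - 1) / Gamma (b + 1)) * exp (- (1 / 2 * t))"
        by (simp only:)
      hence "cmod (lker b 1 t) * (t * exp (1 / 2 * t)) * (M * norm x) =
          b * (t powr (b + 1 - 1) / Gamma (b + 1)) * exp (- (1 / 2 * t)) * (M * norm x)"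
        by (simp only:)
      thus ?thesis by (simp only: mult_ac)
    qed
    finally show ?thesis .
  qed
  from integral_norm_bound_integral[OF has_integral_integrable[OF D] has_integral_integrable[OF h] this]
  have "norm (lp b 1 r - integral {0..} (lker b (1 - z)) *\<^sub>C r) \<le> M * b * norm x * (1 / 2) powr - (b + 1)"
    by (simp only: integral_unique[OF D] integral_unique[OF h])
  thus ?thesis unfolding r_def by (simp only: mult_ac)
qed

section \<open>Resolvent growth from weak integrability\<close>

context
  fixes p b :: real
  assumes p: "1 \<le> p" and b: "0 < b"
    and fin: "\<And>x y. x \<in> Domain (neg_generator_power T b) \<Longrightarrow>
           (\<integral>\<^sup>+t\<in>{0..}. ennreal (cmod (cinner (T t x) y) powr p) \<partial>lborel) < \<infinity>"
begin

text \<open>The pointwise constants depend on \<open>x\<close> and \<open>y\<close>. For fixed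
  \<open>y\<close> the functionals \<open>cinner (G z x) y\<close> of \<open>x\<close> are indexed
  by \<open>z\<close>; this removes the dependence on \<open>x\<close>. Those of \<open>y\<close>,
  now indexed by \<open>z\<close> and the unit ball, are then bounded uniformly too.\<close>

lemma res_lp_uniform_bound:
  obtains C where "C \<ge> 0" and "\<And>z x. 0 < Re z \<Longrightarrow> norm (res z (lp b 1 x)) \<le> C * Re z powr (1 / p - 1) * norm x"
proof -
  define G where "G z x = Re z powr (1 - 1 / p) *\<^sub>R res z (lp b 1 x)" for z x
  have lin: "bounded_linear (G z)" if "0 < Re z" for z
    unfolding G_def
    by (rule bounded_linear_compose[OF bounded_linear_scaleR_right
          bounded_linear_compose[OF bounded_linear_lp bounded_linear_lp]]) (use that b in auto)
  have pt: "\<exists>C. \<forall>z\<in>{z. 0 < Re z}. norm (cinner (G z x) y) \<le> C" for x y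
    using weak_lp_resolvent_bound[OF p _ fin[OF lp_in_domain_neg_generator_power[OF b]]]
    by (auto simp: G_def cinner_scaleR_left norm_mult)
  have 1: "\<exists>C. \<forall>(z, x)\<in>{(z, x). 0 < Re z \<and> norm x \<le> 1}. norm (cinner (G z x) y) \<le> C" for y
  proof -
    obtain C where C: "C \<ge> 0" "\<And>z x. z \<in> {z. 0 < Re z} \<Longrightarrow> norm (cinner (G z x) y) \<le> C * norm x"
      using uniform_boundedness[of "{z. 0 < Re z}" "\<lambda>z x. cinner (G z x) y"] pt
        bounded_linear_compose[OF bounded_linear_cinner_left lin] by auto
    have "norm (cinner (G z x) y) \<le> C" if "0 < Re z" "norm x \<le> 1" for z x
      using C(2)[of z x] mult_left_mono[OF that(2) C(1)] that(1) by simp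
    thus ?thesis by blast
  qed
  obtain C where C: "C \<ge> 0" and
    "\<And>i y. i \<in> {(z, x). 0 < Re z \<and> norm x \<le> 1} \<Longrightarrow> norm (cinner (G (fst i) (snd i)) y) \<le> C * norm y"
  proof (rule uniform_boundedness[where I = "{(z, x). 0 < Re z \<and> norm x \<le> 1}" and F = "\<lambda>i y. cinner (G (fst i) (snd i)) y"])
    show "\<exists>C. \<forall>i\<in>{(z, x). 0 < Re z \<and> norm x \<le> 1}. norm (cinner (G (fst i) (snd i)) y) \<le> C" for y
      using 1[of y] by (simp add: case_prod_unfold)
  qed (auto simp: bounded_linear_cinner_right)
  hence *: "norm (cinner (G z x) y) \<le> C * norm y" if "0 < Re z" "norm x \<le> 1" for z x y
    using that by fastforce
  have "norm (res z (lp b 1 x)) \<le> C * Re z powr (1 / p - 1) * norm x" if z: "0 < Re z" for z x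
  proof (cases "x = 0")
    case True
    interpret bounded_linear "G z" by (rule lin[OF z])
    show ?thesis using zero True z by (simp add: G_def)
  next
    case False
    interpret bounded_linear "G z" by (rule lin[OF z])
    have "norm (G z ((1 / norm x) *\<^sub>R x)) \<le> C"
      by (rule norm_le_of_cinner_le[OF *[OF z]]) (use C False in auto)
    hence "norm (G z x) \<le> C * norm x" using False by (simp add: scaleR divide_le_eq)
    hence "Re z powr (1 / p - 1) * (Re z powr (1 - 1 / p) * norm (res z (lp b 1 x))) \<le> Re z powr (1 / p - 1) * (C * norm x)"
      by (intro mult_left_mono) (auto simp: G_def)
    thus ?thesis using z by (simp add: mult_ac flip: mult.assoc powr_add)
  qed
  with C show thesis by (rule that)
qed

lemma res_strip_bound:
  obtains C where "C > 0" and "\<And>a s x. 0 < a \<Longrightarrow> a \<le> 1 / 2 \<Longrightarrow>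
    norm (res (Complex a s) x) \<le> C * (1 + \<bar>s\<bar>) powr b * a powr (1 / p - 1) * norm x"
proof -
  obtain C where C: "C \<ge> 0" "\<And>z x. 0 < Re z \<Longrightarrow> norm (res z (lp b 1 x)) \<le> C * Re z powr (1 / p - 1) * norm x"
    using res_lp_uniform_bound by blast
  define C1 where "C1 = M * b * (1 / 2) powr - (b + 1)"
  have C1: "C1 > 0" using M_ge_1 b by (simp add: C1_def)
  have "norm (res (Complex a s) x) \<le> (C + C1) * (1 + \<bar>s\<bar>) powr b * a powr (1 / p - 1) * norm x"
    if a: "0 < a" "a \<le> 1 / 2" for a s x
  proof -
    define z where "z = Complex a s"
    define I where "I = integral {0..} (lker b (1 - z))"
    define A where "A = a powr (1 / p - 1)"
    have z: "0 < Re z" "Re z \<le> 1 / 2" "0 < Re (1 - z)" using a by (auto simp: z_def)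
    \<comment> \<open>As \<open>1 / p - 1 \<le> 0\<close> and \<open>a < 1\<close>, the uniformly
      bounded error \<open>C1\<close> can be absorbed into the term with \<open>A\<close>.\<close>
    have A: "1 \<le> A"
      using powr_mono'[of "1 / p - 1" 0 a] a p by (simp add: A_def)
    have I: "cmod I = cmod (1 - z) powr - b" unfolding I_def by (rule norm_integral_lker[OF b z(3)])
    have "norm (I *\<^sub>C res z x) \<le> norm (lp b 1 (res z x)) + norm (lp b 1 (res z x) - I *\<^sub>C res z x)"
      by (metis norm_minus_commute norm_triangle_sub)
    also have "norm (lp b 1 (res z x)) \<le> C * A * norm x"
      using C(2)[OF z(1), of x] b z by (simp add: lp_lp z_def A_def)
    also have "norm (lp b 1 (res z x) - I *\<^sub>C res z x) \<le> C1 * norm x"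
      unfolding I_def C1_def by (rule norm_lp_res_diff[OF b z(1,2)])
    also have "C1 * norm x \<le> C1 * A * norm x"
      using mult_left_mono[OF A, of "C1 * norm x"] C1 by (simp add: mult_ac)
    finally have le: "cmod (1 - z) powr - b * norm (res z x) \<le> (C + C1) * A * norm x"
      by (simp add: norm_scaleC I algebra_simps)
    have z1: "cmod (1 - z) > 0" using z by auto
    have "cmod (1 - z) \<le> \<bar>1 - a\<bar> + \<bar>s\<bar>"
      using cmod_le[of "1 - z"] by (simp add: z_def)
    hence le1: "cmod (1 - z) powr b \<le> (1 + \<bar>s\<bar>) powr b"
      using a b by (intro powr_mono2) auto
    have "norm (res z x) = cmod (1 - z) powr b * (cmod (1 - z) powr - b * norm (res z x))"
      using z1 by (simp flip: mult.assoc powr_add)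
    also have "\<dots> \<le> (1 + \<bar>s\<bar>) powr b * ((C + C1) * A * norm x)"
      by (rule mult_mono[OF le1 le]) auto
    finally show ?thesis by (simp add: z_def A_def mult_ac)
  qed
  with C(1) C1 show thesis by (intro that[of "C + C1"]) auto
qed

text \<open>The point \<open>a\<^sub>0\<close> is chosen so that \<open>a\<^sub>0 \<parallel>R(a\<^sub>0 + i s)\<parallel> \<le> 1/2\<close>: to the left of it the resolvent
  identity keeps the resolvent bounded by twice its value at \<open>a\<^sub>0 + i s\<close>.\<close>

lemma res_polynomial_bound:
  obtains K where "K > 0" and "\<And>a s x. 0 < a \<Longrightarrow> a \<le> 1 / 2 \<Longrightarrow>
    norm (res (Complex a s) x) \<le> K * (1 + \<bar>s\<bar>) powr (p * b) * norm x"
proof -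
  obtain C where C: "C > 0" "\<And>a s x. 0 < a \<Longrightarrow> a \<le> 1 / 2 \<Longrightarrow>
    norm (res (Complex a s) x) \<le> C * (1 + \<bar>s\<bar>) powr b * a powr (1 / p - 1) * norm x"
    using res_strip_bound by blast
  \<comment> \<open>The second entry yields \<open>C * c powr (1 / p) \<le> 1 / 2\<close>, which is
    what \<open>half\<close> needs; the first keeps \<open>a0\<close> in the strip.\<close>
  define c where "c = min (1 / 2) ((1 / (2 * C)) powr p)"
  have c: "0 < c" "c \<le> 1 / 2" "C * c powr (1 / p) \<le> 1 / 2"
  proof -
    show "0 < c" "c \<le> 1 / 2" using C(1) by (auto simp: c_def)
    have "c powr (1 / p) \<le> ((1 / (2 * C)) powr p) powr (1 / p)"
      using p \<open>0 < c\<close> by (intro powr_mono2) (auto simp: c_def)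
    also have "\<dots> = 1 / (2 * C)" using p C(1) by (simp add: powr_powr)
    finally show "C * c powr (1 / p) \<le> 1 / 2" using C(1) by (simp add: field_simps)
  qed
  define K where "K = C * c powr (1 / p - 1)"
  have K: "K > 0" using C(1) c(1) by (simp add: K_def)
  have "norm (res (Complex a s) x) \<le> (2 * K) * (1 + \<bar>s\<bar>) powr (p * b) * norm x"
    if a: "0 < a" "a \<le> 1 / 2" for a s x
  proof -
    define w where "w = 1 + \<bar>s\<bar>"
    have w: "1 \<le> w" by (simp add: w_def)
    \<comment> \<open>For this power \<open>a0 powr (1 / p)\<close> contributes
      \<open>w powr - b\<close>, so \<open>a0\<close> times the strip bound at \<open>a0\<close>
      does not depend on \<open>s\<close>.\<close>
    define a0 where "a0 = c * w powr - (p * b)"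
    have "w powr - (p * b) \<le> w powr 0" using w p b by (intro powr_mono) auto
    hence "c * w powr - (p * b) \<le> c * 1" using c w by (intro mult_left_mono) auto
    hence a0: "0 < a0" "a0 \<le> 1 / 2"
      using c(1,2) w unfolding a0_def by (simp, linarith)
    have wa0: "C * w powr b * a0 powr (1 / p - 1) = K * w powr (p * b)"
    proof -
      have "a0 powr (1 / p - 1) = c powr (1 / p - 1) * w powr (- (p * b) * (1 / p - 1))"
        using c w by (simp add: a0_def powr_mult powr_powr)
      moreover have "- (p * b) * (1 / p - 1) = p * b - b" using p by (simp add: field_simps)
      ultimately show ?thesis using w by (simp add: K_def powr_diff)
    qed
    have big: "norm (res (Complex c' s) v) \<le> K * w powr (p * b) * norm v" if c': "a0 \<le> c'" "c' \<le> 1 / 2" for c' v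
    proof -
      have "c' powr (1 / p - 1) \<le> a0 powr (1 / p - 1)"
        using a0 c' p by (intro powr_mono2') auto
      hence "C * w powr b * c' powr (1 / p - 1) * norm v \<le> C * w powr b * a0 powr (1 / p - 1) * norm v"
        using C(1) by (intro mult_left_mono mult_right_mono) auto
      moreover have "norm (res (Complex c' s) v) \<le> C * w powr b * c' powr (1 / p - 1) * norm v"
        unfolding w_def using a0 c' by (intro C(2)) auto
      ultimately show ?thesis unfolding wa0 by linarith
    qed
    have half: "a0 * (K * w powr (p * b)) \<le> 1 / 2"
    proof -
      have "a0 * (K * w powr (p * b)) = c * K * (w powr - (p * b) * w powr (p * b))" by (simp add: a0_def)
      also have "\<dots> = C * c powr (1 / p)" using w c by (simp add: K_def powr_diff flip: powr_add)
      finally show ?thesis using c(3) by simp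
    qed
    show ?thesis
    proof (cases "a0 \<le> a")
      case True
      have "0 \<le> K * w powr (p * b) * norm x" using K by simp
      with big[OF True a(2), of x] show ?thesis unfolding w_def[symmetric] by simp
    next
      case False
      \<comment> \<open>After commuting the resolvents, the identity expresses \<open>r\<close>
        through the resolvent at \<open>a0\<close> applied to \<open>r\<close> itself. By
        \<open>half\<close> this term is at most half of \<open>norm r\<close> and moves to the left
        side.\<close>
      define r where "r = res (Complex a s) x"
      have "r - res (Complex a0 s) x = (Complex a0 s - Complex a s) *\<^sub>C res (Complex a s) (res (Complex a0 s) x)"
        unfolding r_def by (rule res_identity) (use a a0 in auto)
      also have "res (Complex a s) (res (Complex a0 s) x) = res (Complex a0 s) r"
        unfolding r_def using a a0 by (intro lp_lp) auto
      also have "Complex a0 s - Complex a s = of_real (a0 - a)" by (simp add: complex_eq_iff)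
      finally have "r - res (Complex a0 s) x = (a0 - a) *\<^sub>R res (Complex a0 s) r"
        by (simp only: scaleC_of_real)
      hence "r = res (Complex a0 s) x + (a0 - a) *\<^sub>R res (Complex a0 s) r"
        unfolding diff_eq_eq by (simp only: add.commute)
      hence "norm r \<le> norm (res (Complex a0 s) x) + norm ((a0 - a) *\<^sub>R res (Complex a0 s) r)"
        by (metis norm_triangle_ineq)
      also have "norm ((a0 - a) *\<^sub>R res (Complex a0 s) r) \<le> a0 * (K * w powr (p * b) * norm r)"
        using False a big[of a0 r] a0 by (auto intro!: mult_mono)
      also have "\<dots> \<le> 1 / 2 * norm r"
        using mult_right_mono[OF half, of "norm r"] by (simp add: mult_ac)
      also have "norm (res (Complex a0 s) x) \<le> K * w powr (p * b) * norm x"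
        using big[of a0 x] a0 by simp
      finally show ?thesis unfolding r_def w_def by simp
    qed
  qed
  with K show thesis by (intro that[of "2 * K"]) auto
qed

end

text \<open>Along the points \<open>l n\<close>, which approach the imaginary axis from the right,
  the resolvent identity makes \<open>res (l n) x\<close> a Cauchy sequence. Both inverse relations
  pass to the limit \<open>R\<close>.\<close>

lemma imaginary_in_resolvent_set:
  assumes K: "\<And>a x. 0 < a \<Longrightarrow> a \<le> 1 / 2 \<Longrightarrow> norm (res (Complex a s) x) \<le> K * norm x"
  obtains R where "bounded_clinear R"
    and "\<And>w. (R w, (\<i> * of_real s) *\<^sub>C R w - w) \<in> generator T"
    and "\<And>x y. (x, y) \<in> generator T \<Longrightarrow> R ((\<i> * of_real s) *\<^sub>C x - y) = x"
proof -
  define z where "z = \<i> * of_real s"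
  \<comment> \<open>Starting at 1/2 keeps every \<open>a n\<close> in the range of the assumed
    bound.\<close>
  define a where "a n = inverse (real (Suc (Suc n)))" for n
  have a: "0 < a n" "a n \<le> 1 / 2" for n by (auto simp: a_def field_simps)
  have a0: "a \<longlonglongrightarrow> 0"
    unfolding a_def using LIMSEQ_inverse_real_of_nat by (rule LIMSEQ_Suc)
  define l where "l n = Complex (a n) s" for n
  have l: "l n = of_real (a n) + z" "0 < Re (l n)" for n
    using a by (auto simp: l_def z_def complex_eq_iff)
  have Kl: "norm (res (l n) x) \<le> K * norm x" for n x unfolding l_def by (rule K[OF a])
  have "Cauchy (\<lambda>n. res (l n) x)" for x
  proof (rule metric_CauchyI)
    fix e :: real assume e: "e > 0"
    have "Cauchy a" using a0 by (rule LIMSEQ_imp_Cauchy)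
    define D where "D = K * (K * norm x)"
    have D: "D \<ge> 0" using Kl[of 0 x] order_trans[OF norm_ge_zero Kl[of 0 "res (l 0) x"]]
      by (smt (verit, del_insts) D_def mult_nonneg_nonneg norm_ge_zero mult_eq_0_iff zero_le_mult_iff)
    obtain N where N: "\<And>m n. N \<le> m \<Longrightarrow> N \<le> n \<Longrightarrow> dist (a m) (a n) < e / (D + 1)"
      using metric_CauchyD[OF \<open>Cauchy a\<close>, of "e / (D + 1)"] e D by auto
    have "dist (res (l m) x) (res (l n) x) < e" if "N \<le> m" "N \<le> n" for m n
    proof -
      have "res (l m) x - res (l n) x = (l n - l m) *\<^sub>C res (l m) (res (l n) x)"
        by (rule res_identity) (use l in auto)
      hence "dist (res (l m) x) (res (l n) x) = dist (a m) (a n) * norm (res (l m) (res (l n) x))"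
        by (simp add: dist_norm norm_scaleC l(1) abs_minus_commute flip: of_real_diff)
      also have "\<dots> \<le> dist (a m) (a n) * D"
      proof (rule mult_left_mono)
        \<comment> \<open>\<open>K\<close> carries no sign; a negative \<open>K\<close> forces the
          vector to vanish.\<close>
        have "K \<ge> 0 \<or> norm (res (l n) x) = 0"
          using Kl[of m "res (l n) x"] by (smt (verit) mult_less_0_iff norm_ge_zero)
        have "norm (res (l m) (res (l n) x)) \<le> K * norm (res (l n) x)" by (rule Kl)
        also have "\<dots> \<le> D"
          using \<open>K \<ge> 0 \<or> _\<close> D mult_left_mono[OF Kl[of n x], of K] by (auto simp: D_def)
        finally show "norm (res (l m) (res (l n) x)) \<le> D" .
      qed simp
      also have "\<dots> \<le> dist (a m) (a n) * (D + 1)" by (rule mult_left_mono) auto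
      also have "\<dots> < e" using N[OF that] D by (simp add: pos_less_divide_eq)
      finally show ?thesis .
    qed
    thus "\<exists>N. \<forall>m\<ge>N. \<forall>n\<ge>N. dist (res (l m) x) (res (l n) x) < e" by blast
  qed
  hence "\<exists>r. (\<lambda>n. res (l n) x) \<longlonglongrightarrow> r" for x
    by (auto simp: Cauchy_convergent_iff convergent_def)
  then obtain R where R: "\<And>x. (\<lambda>n. res (l n) x) \<longlonglongrightarrow> R x" by metis
  have l_lim: "l \<longlonglongrightarrow> z"
    using tendsto_add[OF tendsto_of_real[OF a0] tendsto_const[of z]] by (simp add: l(1)[abs_def])
  have R_add: "R (x + y) = R x + R y" for x y
    using R[of "x + y"] tendsto_add[OF R[of x] R[of y]] l(2) LIMSEQ_unique by (auto simp: lp_add)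
  have R_scaleC: "R (c *\<^sub>C x) = c *\<^sub>C R x" for c x
    using R[of "c *\<^sub>C x"] tendsto_scaleC[OF tendsto_const[of c] R[of x]] l(2) LIMSEQ_unique by (auto simp: lp_scaleC)
  have "norm (R x) \<le> K * norm x" for x
    by (rule Lim_bounded[OF tendsto_norm[OF R[of x]]]) (use Kl in auto)
  hence "bounded_linear R"
    by (intro bounded_linear_intro[where K = K]) (auto simp: R_add R_scaleC scaleR_scaleC mult.commute)
  hence bcl: "bounded_clinear R" by (simp add: bounded_clinear_def R_scaleC)
  have gen: "(R x, z *\<^sub>C R x - x) \<in> generator T" for x
  proof -
    \<comment> \<open>This replaces closedness of the generator: \<open>res (l n) x\<close> has a
      convergent sequence of preimages under \<open>res 1\<close>, so \<open>R x\<close> lies in the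
      range of \<open>res 1\<close> as well.\<close>
    have "res 1 (1 *\<^sub>C res (l n) x - (l n *\<^sub>C res (l n) x - x)) = res (l n) x" for n
      by (rule res_generator[OF res_in_generator[OF l(2)]]) simp
    moreover have "(\<lambda>n. res 1 (1 *\<^sub>C res (l n) x - (l n *\<^sub>C res (l n) x - x)))
        \<longlonglongrightarrow> res 1 (1 *\<^sub>C R x - (z *\<^sub>C R x - x))"
      by (intro bounded_linear.tendsto[OF bounded_linear_lp] tendsto_intros R l_lim) auto
    ultimately have eq: "res 1 (1 *\<^sub>C R x - (z *\<^sub>C R x - x)) = R x"
      using R[of x] LIMSEQ_unique by simp
    have "(res 1 (1 *\<^sub>C R x - (z *\<^sub>C R x - x)), 1 *\<^sub>C res 1 (1 *\<^sub>C R x - (z *\<^sub>C R x - x)) - (1 *\<^sub>C R x - (z *\<^sub>C R x - x))) \<in> generator T"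
      by (rule res_in_generator) simp
    thus ?thesis unfolding eq by simp
  qed
  moreover have "R (z *\<^sub>C x - y) = x" if xy: "(x, y) \<in> generator T" for x y
  proof -
    have "res (l n) (z *\<^sub>C x - y) + a n *\<^sub>R res (l n) x = x" for n
    proof -
      have "l n *\<^sub>C x - y = (z *\<^sub>C x - y) + of_real (a n) *\<^sub>C x"
        by (simp add: l(1) scaleC_add_left)
      moreover have "res (l n) (of_real (a n) *\<^sub>C x) = a n *\<^sub>R res (l n) x"
        using l(2)[of n] by (subst lp_scaleC) (auto simp: scaleC_of_real)
      ultimately show ?thesis
        using res_generator[OF xy l(2), of n] l(2)[of n] by (simp only: lp_add zero_less_one)
    qed
    moreover have "(\<lambda>n. res (l n) (z *\<^sub>C x - y) + a n *\<^sub>R res (l n) x) \<longlonglongrightarrow> R (z *\<^sub>C x - y) + 0 *\<^sub>R R x"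
      by (intro tendsto_intros R a0)
    ultimately show ?thesis by (simp add: LIMSEQ_const_iff)
  qed
  ultimately show thesis using bcl that[of R] unfolding z_def by blast
qed

end


section \<open>A Gaussian form of Plancherel's theorem\<close>

abbreviation lborel2 :: "(real \<times> real) measure" where
  "lborel2 \<equiv> lborel \<Otimes>\<^sub>M lborel"

lemma convolution_kernel_integrable:
  fixes k q :: "real \<Rightarrow> real"
  assumes k: "integrable lborel k" and q: "integrable lborel q"
  shows "integrable lborel2 (\<lambda>(t, u). k (t - u) * q t)"
    and "(\<integral>(t, u). k (t - u) * q t \<partial>lborel2) = (\<integral>t. k t \<partial>lborel) * (\<integral>t. q t \<partial>lborel)"
proof -
  have km[measurable]: "k \<in> borel_measurable borel" and qm[measurable]: "q \<in> borel_measurable borel"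
    using k q by auto
  have shift: "integrable lborel f \<Longrightarrow> integrable lborel (\<lambda>u. f (t - u))"
      "(\<integral>u. f (t - u) \<partial>lborel) = (\<integral>u. f u \<partial>lborel)" for f :: "real \<Rightarrow> real" and t
    using lborel_integrable_real_affine[of f "-1" t] lborel_integral_real_affine[of "-1" f t] by auto
  show int: "integrable lborel2 (\<lambda>(t, u). k (t - u) * q t)"
  proof (rule lborel_pair.Fubini_integrable)
    have "(\<integral>u. \<bar>k (t - u)\<bar> \<partial>lborel) = (\<integral>u. \<bar>k u\<bar> \<partial>lborel)" for t
      by (rule shift(2)[of "\<lambda>u. \<bar>k u\<bar>" t])
    thus "integrable lborel (\<lambda>t. \<integral>u. norm (case (t, u) of (t, u) \<Rightarrow> k (t - u) * q t) \<partial>lborel)"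
      using q by (simp add: abs_mult)
    show "AE t in lborel. integrable lborel (\<lambda>u. case (t, u) of (t, u) \<Rightarrow> k (t - u) * q t)"
      using shift(1)[OF k] by simp
  qed simp
  have "(\<integral>(t, u). k (t - u) * q t \<partial>lborel2) = (\<integral>t. (\<integral>u. k (t - u) * q t \<partial>lborel) \<partial>lborel)"
    using lborel_pair.integral_fst'[OF int] by simp
  also have "\<dots> = (\<integral>t. k t \<partial>lborel) * (\<integral>t. q t \<partial>lborel)" by (simp add: shift(2))
  finally show "(\<integral>(t, u). k (t - u) * q t \<partial>lborel2) = (\<integral>t. k t \<partial>lborel) * (\<integral>t. q t \<partial>lborel)" .
qed

lemma convolution_kernel_integrable':
  fixes k q :: "real \<Rightarrow> real"
  assumes k: "integrable lborel k" and q: "integrable lborel q" and even: "\<And>u. k (- u) = k u"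
  shows "integrable lborel2 (\<lambda>(t, u). k (t - u) * q u)"
    and "(\<integral>(t, u). k (t - u) * q u \<partial>lborel2) = (\<integral>t. k t \<partial>lborel) * (\<integral>t. q t \<partial>lborel)"
proof -
  have eq: "(\<lambda>(t, u). (\<lambda>(t, u). k (t - u) * q t) (u, t)) = (\<lambda>(t, u). k (t - u) * q u)"
    using even[of "_ - _"] by (auto simp: fun_eq_iff)
  note int = convolution_kernel_integrable[OF k q]
  show "integrable lborel2 (\<lambda>(t, u). k (t - u) * q u)"
    using lborel_pair.integrable_product_swap[OF int(1)] unfolding eq .
  show "(\<integral>(t, u). k (t - u) * q u \<partial>lborel2) = (\<integral>t. k t \<partial>lborel) * (\<integral>t. q t \<partial>lborel)"
    using lborel_pair.integral_product_swap[OF borel_measurable_integrable[OF int(1)]] int(2) unfolding eq by simp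
qed

text \<open>The characteristic function of the standard normal distribution: averaging over
  frequencies \<open>b * \<xi>\<close> with normal \<open>\<xi>\<close> puts the weight
  \<open>gk (b * (t - u))\<close> on time differences.\<close>

definition gk :: "real \<Rightarrow> real" where
  "gk u = exp (- (u\<^sup>2) / 2)"

lemma gk_eq: "gk u = sqrt (2 * pi) * std_normal_density u"
  by (simp add: gk_def std_normal_density_def)

text \<open>The mass is of order \<open>1 / b\<close>, the first absolute moment of order
  \<open>1 / b\<^sup>2\<close>. The Lipschitz error of the lower estimate is a first moment, hence
  negligible against the main term for large \<open>b\<close>.\<close>

lemma gk_integrals:
  assumes "b > 0"
  shows "integrable lborel (\<lambda>u. gk (b * u))" "(\<integral>u. gk (b * u) \<partial>lborel) = sqrt (2 * pi) / b"
    and "integrable lborel (\<lambda>u. gk (b * u) * \<bar>u\<bar>)" "(\<integral>u. gk (b * u) * \<bar>u\<bar> \<partial>lborel) = 2 / b\<^sup>2"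
proof -
  have m0: "has_bochner_integral lborel std_normal_density 1"
    using std_normal_moment_even[of 0] by simp
  have i0: "integrable lborel gk" "(\<integral>u. gk u \<partial>lborel) = sqrt (2 * pi)"
    using m0 by (auto simp: gk_eq[abs_def] has_bochner_integral_iff)
  have m1: "has_bochner_integral lborel (\<lambda>x. std_normal_density x * \<bar>x\<bar>) (sqrt (2 / pi))"
    using std_normal_moment_abs_odd[of 0] by simp
  have i1: "integrable lborel (\<lambda>u. gk u * \<bar>u\<bar>)" "(\<integral>u. gk u * \<bar>u\<bar> \<partial>lborel) = 2"
  proof -
    have "(\<lambda>u. gk u * \<bar>u\<bar>) = (\<lambda>u. sqrt (2 * pi) * (std_normal_density u * \<bar>u\<bar>))"
      by (simp add: gk_eq fun_eq_iff)
    moreover have "sqrt (2 * pi) * sqrt (2 / pi) = 2"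
      by (simp flip: real_sqrt_mult)
    ultimately show "integrable lborel (\<lambda>u. gk u * \<bar>u\<bar>)" "(\<integral>u. gk u * \<bar>u\<bar> \<partial>lborel) = 2"
      using m1 by (auto simp: has_bochner_integral_iff)
  qed
  show "integrable lborel (\<lambda>u. gk (b * u))"
    using lborel_integrable_real_affine[OF i0(1), of b 0] assms by simp
  show "(\<integral>u. gk (b * u) \<partial>lborel) = sqrt (2 * pi) / b"
    using lborel_integral_real_affine[of b gk 0] assms i0(2) by (simp add: field_simps)
  have eq: "gk (b * u) * \<bar>u\<bar> = (1 / b) * (gk (0 + b * u) * \<bar>0 + b * u\<bar>)" for u
    using assms by (simp add: abs_mult)
  show "integrable lborel (\<lambda>u. gk (b * u) * \<bar>u\<bar>)"
    unfolding eq using lborel_integrable_real_affine[OF i1(1), of b 0] assms by simp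
  show "(\<integral>u. gk (b * u) * \<bar>u\<bar> \<partial>lborel) = 2 / b\<^sup>2"
    unfolding eq using lborel_integral_real_affine[of b "\<lambda>u. gk u * \<bar>u\<bar>" 0] assms i1(2)
    by (simp add: field_simps power2_eq_square)
qed

text \<open>\<open>F\<close> is the Fourier transform of \<open>G\<close> in the weak sense, tested
  against each \<open>y\<close>. Only norms and inner products of \<open>G\<close> are integrated,
  so integration stays scalar whatever the size of the space.\<close>

locale fourier_pair =
  fixes G F :: "real \<Rightarrow> 'a::complex_hilbert_space"
  assumes cont: "continuous_on {0<..} G" and zero: "\<And>t. t \<le> 0 \<Longrightarrow> G t = 0"
    and int: "integrable lborel (\<lambda>t. norm (G t))" and int2: "integrable lborel (\<lambda>t. (norm (G t))\<^sup>2)"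
    and F: "\<And>s y. (\<integral>t. exp (- (\<i> * of_real (s * t))) * cinner (G t) y \<partial>lborel) = cinner (F s) y"
begin

text \<open>The function is jointly continuous on the open quadrant and zero off it; measurability
  of \<open>G\<close> as a vector-valued map does not enter.\<close>

lemma cinner_measurable [measurable]:
  "(\<lambda>p. cinner (G (fst p)) (G (snd p))) \<in> borel_measurable lborel2"
proof -
  have "(\<lambda>p. indicator ({0<..} \<times> {0<..}) p *\<^sub>R cinner (G (fst p)) (G (snd p))) \<in> borel_measurable borel"
    by (intro borel_measurable_continuous_on_indicator borel_open open_Times open_greaterThan
        continuous_on_cinner continuous_on_compose2[OF cont] continuous_intros) auto
  moreover have "(\<lambda>p. indicator ({0<..} \<times> {0<..}) p *\<^sub>R cinner (G (fst p)) (G (snd p))) =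
      (\<lambda>p. cinner (G (fst p)) (G (snd p)))"
    by (auto simp: fun_eq_iff indicator_def not_less zero)
  ultimately show ?thesis by (simp add: lborel_prod)
qed

lemma integrable_norm_product:
  "integrable lborel2 (\<lambda>p. norm (G (fst p)) * norm (G (snd p)))"
proof (rule lborel_pair.Fubini_integrable)
  have [measurable]: "(\<lambda>t. norm (G t)) \<in> borel_measurable borel" using int by auto
  show "(\<lambda>p. norm (G (fst p)) * norm (G (snd p))) \<in> borel_measurable lborel2" by measurable
qed (use int in auto)

definition \<Phi> :: "real \<Rightarrow> real \<times> real \<Rightarrow> complex" where
  "\<Phi> s p = exp (- (\<i> * of_real (s * (fst p - snd p)))) * cinner (G (fst p)) (G (snd p))"

lemma norm_\<Phi>_le: "cmod (\<Phi> s p) \<le> norm (G (fst p)) * norm (G (snd p))"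
  by (simp add: \<Phi>_def norm_mult cmod_cinner_le)

lemma integrable_\<Phi>: "integrable lborel2 (\<Phi> s)"
proof (rule Bochner_Integration.integrable_bound[OF integrable_norm_product])
  show "\<Phi> s \<in> borel_measurable lborel2" unfolding \<Phi>_def[abs_def] by measurable
qed (auto simp: norm_\<Phi>_le)

text \<open>The integral over \<open>u\<close> is, up to conjugation, the defining property of
  \<open>F\<close> with test vector \<open>G t\<close>; the integral over \<open>t\<close> then has
  test vector \<open>F s\<close>.\<close>

lemma integral_\<Phi>: "(\<integral>p. \<Phi> s p \<partial>lborel2) = of_real ((norm (F s))\<^sup>2)"
proof -
  have inner: "(\<integral>u. \<Phi> s (t, u) \<partial>lborel) = exp (- (\<i> * of_real (s * t))) * cinner (G t) (F s)" for t
  proof -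
    have "\<Phi> s (t, u) = exp (- (\<i> * of_real (s * t))) * cnj (exp (- (\<i> * of_real (s * u))) * cinner (G u) (G t))" for u
      by (simp add: \<Phi>_def exp_cnj cinner_commute[of "G t" "G u"] algebra_simps exp_diff exp_minus divide_inverse)
    hence "(\<integral>u. \<Phi> s (t, u) \<partial>lborel) = exp (- (\<i> * of_real (s * t))) *
        cnj (\<integral>u. exp (- (\<i> * of_real (s * u))) * cinner (G u) (G t) \<partial>lborel)"
      by (simp only: integral_mult_right_zero Bochner_Integration.integral_cnj)
    also have "\<dots> = exp (- (\<i> * of_real (s * t))) * cinner (G t) (F s)"
      unfolding F by (simp add: cinner_commute[of "G t" "F s"])
    finally show ?thesis .
  qed
  have "(\<integral>p. \<Phi> s p \<partial>lborel2) = (\<integral>t. (\<integral>u. \<Phi> s (t, u) \<partial>lborel) \<partial>lborel)"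
    by (rule lborel_pair.integral_fst'[OF integrable_\<Phi>, symmetric])
  also have "\<dots> = cinner (F s) (F s)" unfolding inner F ..
  finally show ?thesis by (simp add: cinner_self)
qed

text \<open>Fubini for the normal measure in frequency and Lebesgue measure in the two times. As the
  normal measure is finite, the triple integral converges absolutely; its frequency part is a
  characteristic function. The left side is real, so real parts may be taken on the right.\<close>

lemma gaussian_plancherel:
  shows "integrable std_normal_distribution (\<lambda>\<xi>. (norm (F (b * \<xi>)))\<^sup>2)"
    and "integrable lborel2 (\<lambda>(t, u). gk (b * (t - u)) * Re (cinner (G t) (G u)))"
    and "(\<integral>\<xi>. (norm (F (b * \<xi>)))\<^sup>2 \<partial>std_normal_distribution) =
      (\<integral>(t, u). gk (b * (t - u)) * Re (cinner (G t) (G u)) \<partial>lborel2)"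
proof -
  let ?Q = lborel2
  let ?N = std_normal_distribution
  interpret N: real_distribution ?N by (rule real_dist_normal_dist)
  interpret Q: sigma_finite_measure ?Q
    by (rule sigma_finite_pair_measure) (rule lborel.sigma_finite_measure_axioms)+
  interpret P: pair_sigma_finite ?N ?Q ..
  have int: "integrable (?N \<Otimes>\<^sub>M ?Q) (\<lambda>(\<xi>, p). \<Phi> (b * \<xi>) p)"
  proof (rule Bochner_Integration.integrable_bound)
    show "integrable (?N \<Otimes>\<^sub>M ?Q) (\<lambda>x. norm (G (fst (snd x))) * norm (G (snd (snd x))))"
    proof (rule P.Fubini_integrable)
      have [measurable]: "(\<lambda>p. norm (G (fst p)) * norm (G (snd p))) \<in> borel_measurable ?Q"
        using integrable_norm_product by auto
      show "(\<lambda>x. norm (G (fst (snd x))) * norm (G (snd (snd x)))) \<in> borel_measurable (?N \<Otimes>\<^sub>M ?Q)"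
        by (rule measurable_compose[OF measurable_snd]) measurable
    qed (use integrable_norm_product in auto)
    show "(\<lambda>(\<xi>, p). \<Phi> (b * \<xi>) p) \<in> borel_measurable (?N \<Otimes>\<^sub>M ?Q)"
    proof -
      have [measurable]: "(\<lambda>x. cinner (G (fst (snd x))) (G (snd (snd x)))) \<in> borel_measurable (?N \<Otimes>\<^sub>M ?Q)"
        by (rule measurable_compose[OF measurable_snd cinner_measurable])
      show ?thesis unfolding \<Phi>_def case_prod_beta by measurable
    qed
    show "AE x in ?N \<Otimes>\<^sub>M ?Q. norm (case x of (\<xi>, p) \<Rightarrow> \<Phi> (b * \<xi>) p) \<le> norm (norm (G (fst (snd x))) * norm (G (snd (snd x))))"
      using norm_\<Phi>_le by (auto simp: case_prod_beta)
  qed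
  have char: "(\<integral>\<xi>. \<Phi> (b * \<xi>) p \<partial>?N) = of_real (gk (b * (fst p - snd p))) * cinner (G (fst p)) (G (snd p))" for p
  proof -
    have "(\<integral>\<xi>. exp (- (\<i> * of_real (b * \<xi> * (fst p - snd p)))) \<partial>?N) = char ?N (- (b * (fst p - snd p)))"
      unfolding char_def by (intro Bochner_Integration.integral_cong) (auto simp: mult_ac)
    also have "\<dots> = of_real (gk (b * (fst p - snd p)))"
      by (simp add: char_std_normal_distribution gk_def)
    finally show ?thesis by (simp add: \<Phi>_def)
  qed
  have fub: "(\<integral>p. (\<integral>\<xi>. \<Phi> (b * \<xi>) p \<partial>?N) \<partial>?Q) = (\<integral>\<xi>. (\<integral>p. \<Phi> (b * \<xi>) p \<partial>?Q) \<partial>?N)"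
    by (rule P.Fubini_integral[OF int])
  have int_k: "integrable ?Q (\<lambda>p. of_real (gk (b * (fst p - snd p))) * cinner (G (fst p)) (G (snd p)))"
    using P.integrable_snd[OF int] unfolding char .
  have Re_eq: "Re (of_real (gk (b * (fst p - snd p))) * cinner (G (fst p)) (G (snd p))) =
      (case p of (t, u) \<Rightarrow> gk (b * (t - u)) * Re (cinner (G t) (G u)))" for p
    by (simp add: case_prod_beta)
  show "integrable ?Q (\<lambda>(t, u). gk (b * (t - u)) * Re (cinner (G t) (G u)))"
    using integrable_Re[OF int_k] unfolding Re_eq .
  have int_F: "integrable ?N (\<lambda>\<xi>. complex_of_real ((norm (F (b * \<xi>)))\<^sup>2))"
    using P.integrable_fst[OF int] unfolding integral_\<Phi> .
  thus "integrable ?N (\<lambda>\<xi>. (norm (F (b * \<xi>)))\<^sup>2)"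
    using integrable_Re[OF int_F] by simp
  have "complex_of_real (\<integral>\<xi>. (norm (F (b * \<xi>)))\<^sup>2 \<partial>?N) = (\<integral>\<xi>. (\<integral>p. \<Phi> (b * \<xi>) p \<partial>?Q) \<partial>?N)"
    unfolding integral_\<Phi> by (rule integral_complex_of_real[symmetric])
  also have "\<dots> = (\<integral>p. of_real (gk (b * (fst p - snd p))) * cinner (G (fst p)) (G (snd p)) \<partial>?Q)"
    unfolding fub[symmetric] char ..
  finally have "(\<integral>\<xi>. (norm (F (b * \<xi>)))\<^sup>2 \<partial>?N) =
      Re (\<integral>p. of_real (gk (b * (fst p - snd p))) * cinner (G (fst p)) (G (snd p)) \<partial>?Q)"
    by (metis Re_complex_of_real)
  also have "\<dots> = (\<integral>p. Re (of_real (gk (b * (fst p - snd p))) * cinner (G (fst p)) (G (snd p))) \<partial>?Q)"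
    by (rule integral_Re[OF int_k, symmetric])
  finally show "(\<integral>\<xi>. (norm (F (b * \<xi>)))\<^sup>2 \<partial>?N) =
      (\<integral>(t, u). gk (b * (t - u)) * Re (cinner (G t) (G u)) \<partial>?Q)"
    unfolding Re_eq .
qed

lemma gk_minus: "gk (b * - u) = gk (b * u)" and gk_nonneg: "0 \<le> gk u"
  by (simp_all add: gk_def)

text \<open>The inner product is at most the mean of the two squared norms, and each of these leaves
  the full mass \<open>sqrt (2 * pi) / b\<close> of the kernel.\<close>

lemma gaussian_plancherel_upper:
  assumes b: "0 < b"
  shows "(\<integral>\<xi>. (norm (F (b * \<xi>)))\<^sup>2 \<partial>std_normal_distribution) \<le> sqrt (2 * pi) / b * (\<integral>t. (norm (G t))\<^sup>2 \<partial>lborel)"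
proof -
  note k1 = convolution_kernel_integrable[OF gk_integrals(1)[OF b] int2]
  note k2 = convolution_kernel_integrable'[OF gk_integrals(1)[OF b] int2 gk_minus]
  have "(\<integral>\<xi>. (norm (F (b * \<xi>)))\<^sup>2 \<partial>std_normal_distribution) \<le>
     (\<integral>p. 1 / 2 * ((case p of (t, u) \<Rightarrow> gk (b * (t - u)) * (norm (G t))\<^sup>2) + (case p of (t, u) \<Rightarrow> gk (b * (t - u)) * (norm (G u))\<^sup>2)) \<partial>lborel2)"
    unfolding gaussian_plancherel(3)
  proof (rule integral_mono[OF gaussian_plancherel(2)])
    show "integrable lborel2 (\<lambda>p. 1 / 2 * ((case p of (t, u) \<Rightarrow> gk (b * (t - u)) * (norm (G t))\<^sup>2) + (case p of (t, u) \<Rightarrow> gk (b * (t - u)) * (norm (G u))\<^sup>2)))"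
      by (intro integrable_mult_right Bochner_Integration.integrable_add k1 k2)
    fix p :: "real \<times> real"
    obtain t u where p: "p = (t, u)" by force
    have "gk (b * (t - u)) * Re (cinner (G t) (G u)) \<le> gk (b * (t - u)) * (1 / 2 * ((norm (G t))\<^sup>2 + (norm (G u))\<^sup>2))"
      using Re_cinner_le[of "G t" "G u"] gk_nonneg by (intro mult_left_mono) auto
    thus "(case p of (t, u) \<Rightarrow> gk (b * (t - u)) * Re (cinner (G t) (G u))) \<le>
       1 / 2 * ((case p of (t, u) \<Rightarrow> gk (b * (t - u)) * (norm (G t))\<^sup>2) + (case p of (t, u) \<Rightarrow> gk (b * (t - u)) * (norm (G u))\<^sup>2))"
      by (simp add: p algebra_simps)
  qed
  also have "\<dots> = 1 / 2 * (sqrt (2 * pi) / b * (\<integral>t. (norm (G t))\<^sup>2 \<partial>lborel) + sqrt (2 * pi) / b * (\<integral>t. (norm (G t))\<^sup>2 \<partial>lborel))"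
    by (subst integral_mult_right_zero, subst Bochner_Integration.integral_add[OF k1(1) k2(1)])
       (simp only: k1(2) k2(2) gk_integrals[OF b])
  finally show ?thesis by simp
qed

text \<open>The loss against the mean of the squared norms is half of
  \<open>(norm (G t - G u))\<^sup>2\<close>. One factor of this square is bounded by
  \<open>L * \<bar>t - u\<bar>\<close>, the other by the triangle inequality, so only the integral
  of \<open>norm (G t)\<close> and the first moment of the kernel appear.\<close>

lemma gaussian_plancherel_lower:
  assumes b: "0 < b" and L: "\<And>t u. norm (G t - G u) \<le> L * \<bar>t - u\<bar>"
  shows "sqrt (2 * pi) / b * (\<integral>t. (norm (G t))\<^sup>2 \<partial>lborel) - L * (2 / b\<^sup>2) * (\<integral>t. norm (G t) \<partial>lborel)
     \<le> (\<integral>\<xi>. (norm (F (b * \<xi>)))\<^sup>2 \<partial>std_normal_distribution)"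
proof -
  let ?Q = lborel2
  have even: "gk (b * - u) * \<bar>- u\<bar> = gk (b * u) * \<bar>u\<bar>" for u by (simp add: gk_def)
  note k1 = convolution_kernel_integrable[OF gk_integrals(1)[OF b] int2]
  note k2 = convolution_kernel_integrable'[OF gk_integrals(1)[OF b] int2 gk_minus]
  note k3 = convolution_kernel_integrable[OF gk_integrals(3)[OF b] int]
  note k4 = convolution_kernel_integrable'[OF gk_integrals(3)[OF b] int even]
  define f1 where "f1 = (\<lambda>(t, u). gk (b * (t - u)) * (norm (G t))\<^sup>2)"
  define f2 where "f2 = (\<lambda>(t, u). gk (b * (t - u)) * (norm (G u))\<^sup>2)"
  define f3 where "f3 = (\<lambda>(t, u). gk (b * (t - u)) * \<bar>t - u\<bar> * norm (G t))"
  define f4 where "f4 = (\<lambda>(t, u). gk (b * (t - u)) * \<bar>t - u\<bar> * norm (G u))"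
  note f = k1[folded f1_def] k2[folded f2_def] k3[folded f3_def] k4[folded f4_def]
  have "(\<integral>p. 1 / 2 * ((f1 p + f2 p) - L * (f3 p + f4 p)) \<partial>?Q) \<le> (\<integral>\<xi>. (norm (F (b * \<xi>)))\<^sup>2 \<partial>std_normal_distribution)"
    unfolding gaussian_plancherel(3)
  proof (rule integral_mono[OF _ gaussian_plancherel(2)])
    show "integrable ?Q (\<lambda>p. 1 / 2 * ((f1 p + f2 p) - L * (f3 p + f4 p)))"
      by (intro integrable_mult_right Bochner_Integration.integrable_add Bochner_Integration.integrable_diff f)
    fix p :: "real \<times> real"
    obtain t u where p: "p = (t, u)" by force
    have "(norm (G t - G u))\<^sup>2 \<le> L * \<bar>t - u\<bar> * (norm (G t) + norm (G u))"
      unfolding power2_eq_square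
      by (rule mult_mono[OF L norm_triangle_ineq4]) (use order_trans[OF norm_ge_zero L] in auto)
    hence "(norm (G t))\<^sup>2 + (norm (G u))\<^sup>2 - L * \<bar>t - u\<bar> * (norm (G t) + norm (G u)) \<le> 2 * Re (cinner (G t) (G u))"
      using norm_diff_square[of "G t" "G u"] by linarith
    hence "gk (b * (t - u)) * ((norm (G t))\<^sup>2 + (norm (G u))\<^sup>2 - L * \<bar>t - u\<bar> * (norm (G t) + norm (G u)))
        \<le> gk (b * (t - u)) * (2 * Re (cinner (G t) (G u)))"
      by (rule mult_left_mono[OF _ gk_nonneg])
    thus "1 / 2 * ((f1 p + f2 p) - L * (f3 p + f4 p)) \<le> (case p of (t, u) \<Rightarrow> gk (b * (t - u)) * Re (cinner (G t) (G u)))"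
      by (simp add: p f1_def f2_def f3_def f4_def algebra_simps)
  qed
  moreover have "(\<integral>p. 1 / 2 * ((f1 p + f2 p) - L * (f3 p + f4 p)) \<partial>?Q) =
      sqrt (2 * pi) / b * (\<integral>t. (norm (G t))\<^sup>2 \<partial>lborel) - L * (2 / b\<^sup>2) * (\<integral>t. norm (G t) \<partial>lborel)"
  proof -
    have "(\<integral>p. 1 / 2 * ((f1 p + f2 p) - L * (f3 p + f4 p)) \<partial>?Q) =
       1 / 2 * ((integral\<^sup>L ?Q f1 + integral\<^sup>L ?Q f2) - L * (integral\<^sup>L ?Q f3 + integral\<^sup>L ?Q f4))"
      using f by simp
    moreover have "1 / 2 * ((A + A) - L * (2 / b\<^sup>2 * B + 2 / b\<^sup>2 * B)) = A - L * (2 / b\<^sup>2) * B" for A B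
      by (simp add: algebra_simps)
    ultimately show ?thesis unfolding f gk_integrals[OF b] by (simp only:)
  qed
  ultimately show ?thesis by (simp only:)
qed

end


section \<open>From resolvent bounds to decay\<close>

lemma power_div_fact_le_exp:
  fixes x :: real
  assumes "0 \<le> x"
  shows "x ^ m / fact m \<le> exp x"
proof -
  have s: "(\<lambda>n. x ^ n / fact n) sums exp x"
    using exp_converges[of x] by (simp add: divide_inverse mult.commute)
  have "(\<Sum>n\<in>{m}. x ^ n / fact n) \<le> (\<Sum>n. x ^ n / fact n)"
    by (rule sum_le_suminf) (use s assms in \<open>auto simp: sums_iff\<close>)
  thus ?thesis using s by (simp add: sums_iff)
qed

lemma power_exp_le:
  fixes a t :: real
  assumes "0 < a" "0 \<le> t"
  shows "t ^ m / fact m * exp (- (a * t)) \<le> inverse (a ^ m)"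
proof -
  have "(a * t) ^ m / fact m * exp (- (a * t)) \<le> exp (a * t) * exp (- (a * t))"
    using power_div_fact_le_exp[of "a * t" m] assms by (intro mult_right_mono) auto
  also have "\<dots> = 1" by (simp flip: exp_add)
  finally have "a ^ m * (t ^ m / fact m * exp (- (a * t))) \<le> 1" by (simp add: power_mult_distrib)
  thus ?thesis using assms by (simp add: field_simps)
qed

section \<open>Weighted orbits and pointwise decay from square integrals\<close>

context bounded_C0_semigroup
begin

text \<open>With the factorial, the Fourier transform at \<open>s\<close> is the resolvent power of
  order \<open>m + 1\<close> on the line \<open>Re z = a\<close>. The value at 0 is 0 also for
  \<open>m = 0\<close>, as \<open>fourier_pair\<close> demands.\<close>

definition orb :: "nat \<Rightarrow> real \<Rightarrow> 'a \<Rightarrow> real \<Rightarrow> 'a" where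
  "orb m a v t = (if 0 < t then (t ^ m / fact m * exp (- (a * t))) *\<^sub>R T t v else 0)"

lemma norm_orb_le:
  assumes "0 < a"
  shows "norm (orb m a v t) \<le> (M * norm v) * (indicator {0..} t * gdens (real m + 1) a t)"
    and "norm (orb m a v t) \<le> inverse (a ^ m) * (M * norm v)"
proof -
  have G: "Gamma (real m + 1) = fact m" using Gamma_fact[of m, where 'a = real] by (simp add: add.commute)
  have M: "0 \<le> M * norm v" using M_ge_1 by simp
  show "norm (orb m a v t) \<le> (M * norm v) * (indicator {0..} t * gdens (real m + 1) a t)"
  proof (cases "0 < t")
    case True
    thus ?thesis using mult_left_mono[OF bound[of t v], of "t ^ m / fact m * exp (- (a * t))"]
      unfolding G by (simp add: orb_def powr_realpow mult_ac)
  next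
    case False
    have "0 \<le> (M * norm v) * (indicator {0..} t * gdens (real m + 1) a t)"
      unfolding G by (intro mult_nonneg_nonneg divide_nonneg_nonneg M) auto
    thus ?thesis using False by (simp add: orb_def)
  qed
  show "norm (orb m a v t) \<le> inverse (a ^ m) * (M * norm v)"
    using mult_mono[OF power_exp_le[of a t m] bound[of t v]] assms M by (auto simp: orb_def)
qed

lemma continuous_on_orb: "continuous_on {0<..} (orb m a v)"
proof -
  have "continuous_on {0<..} (\<lambda>t. (t ^ m / fact m * exp (- (a * t))) *\<^sub>R T t v)"
    by (intro continuous_intros) auto
  thus ?thesis by (rule continuous_on_eq) (simp add: orb_def)
qed

lemma fourier_pair_orb:
  assumes a: "0 < a"
  shows "fourier_pair (orb m a v) (\<lambda>s. lp (real m + 1) (Complex a s) v)"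
proof
  show "continuous_on {0<..} (orb m a v)" by (rule continuous_on_orb)
  show "orb m a v t = 0" if "t \<le> 0" for t using that by (simp add: orb_def)
  have "(\<lambda>t. indicator {0<..} t *\<^sub>R norm (orb m a v t)) \<in> borel_measurable borel"
    by (intro borel_measurable_continuous_on_indicator continuous_on_norm continuous_on_orb) auto
  moreover have "(\<lambda>t. indicator {0<..} t *\<^sub>R norm (orb m a v t)) = (\<lambda>t. norm (orb m a v t))"
    by (auto simp: fun_eq_iff orb_def indicator_def)
  ultimately have meas: "(\<lambda>t. norm (orb m a v t)) \<in> borel_measurable lborel" by simp
  show int: "integrable lborel (\<lambda>t. norm (orb m a v t))"
  proof (rule Bochner_Integration.integrable_bound[OF integrable_mult_right[OF gamma_density_integrable[of "real m + 1" a]] meas])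
    show "AE t in lborel. norm (norm (orb m a v t)) \<le> norm ((M * norm v) *
        (indicator {0..} t * gdens (real m + 1) a t))"
    proof (rule AE_I2)
      fix t
      note norm_orb_le(1)[OF a, of m v t]
      also note abs_ge_self
      finally show "norm (norm (orb m a v t)) \<le> norm ((M * norm v) *
        (indicator {0..} t * gdens (real m + 1) a t))"
        by (simp only: real_norm_def abs_norm_cancel)
    qed
  qed (use a in auto)
  show "integrable lborel (\<lambda>t. (norm (orb m a v t))\<^sup>2)"
  proof (rule Bochner_Integration.integrable_bound[OF integrable_mult_right[OF int, of "inverse (a ^ m) * (M * norm v)"]])
    show "(\<lambda>t. (norm (orb m a v t))\<^sup>2) \<in> borel_measurable lborel" using meas by measurable
    show "AE t in lborel. norm ((norm (orb m a v t))\<^sup>2) \<le> norm (inverse (a ^ m) * (M * norm v) * norm (orb m a v t))"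
    proof (rule AE_I2)
      fix t
      have "(norm (orb m a v t))\<^sup>2 \<le> inverse (a ^ m) * (M * norm v) * norm (orb m a v t)"
        unfolding power2_eq_square by (rule mult_right_mono[OF norm_orb_le(2)[OF a]]) simp
      thus "norm ((norm (orb m a v t))\<^sup>2) \<le> norm (inverse (a ^ m) * (M * norm v) * norm (orb m a v t))"
        by simp
    qed
  qed
  fix s y
  have "exp (- (\<i> * of_real (s * t))) * cinner (orb m a v t) y =
      indicator {0..} t *\<^sub>R (lker (real m + 1) (Complex a s) t * cinner (T t v) y)" for t
  proof (cases "0 < t")
    case True
    have "Gamma (real m + 1) = fact m" using Gamma_fact[of m, where 'a = real] by (simp add: add.commute)
    moreover have "exp (- (Complex a s * of_real t)) = of_real (exp (- (a * t))) * exp (- (\<i> * of_real (s * t)))"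
      by (simp add: Complex_eq algebra_simps exp_add exp_of_real[symmetric])
         (simp add: exp_diff exp_minus exp_add algebra_simps divide_inverse)
    ultimately show ?thesis
      using True by (simp add: orb_def lker_def powr_realpow cinner_scaleR_left)
  qed (auto simp: orb_def indicator_def lker_def)
  thus "(\<integral>t. exp (- (\<i> * of_real (s * t))) * cinner (orb m a v t) y \<partial>lborel) =
      cinner (lp (real m + 1) (Complex a s) v) y"
    using cinner_lp(2)[of "real m + 1" "Complex a s" v y] a by simp
qed

text \<open>A positive \<open>m\<close> makes the weight vanish at 0, so the extension by 0 is
  continuous; \<open>v\<close> in the domain makes the derivative bounded. Existence of
  \<open>L\<close> suffices, since \<open>L\<close> disappears in the limit taken in
  \<open>plancherel_orb\<close>.\<close>

lemma orb_lipschitz: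
  assumes a: "0 < a" and v: "(v, v') \<in> generator T" and m: "m = Suc k"
  shows "\<exists>L. \<forall>t u. norm (orb m a v t - orb m a v u) \<le> L * \<bar>t - u\<bar>"
proof -
  define g where "g t = (t ^ m / fact m * exp (- (a * t))) *\<^sub>R T t v" for t
  define g' where "g' t = (t ^ m / fact m * exp (- (a * t))) *\<^sub>R T t v' +
      (t ^ k / fact k * exp (- (a * t)) - a * (t ^ m / fact m * exp (- (a * t)))) *\<^sub>R T t v" for t
  define L where "L = inverse (a ^ m) * (M * norm v') + (inverse (a ^ k) + a * inverse (a ^ m)) * (M * norm v)"
  have der: "(g has_vector_derivative g' t) (at t within {0..})" if t: "t \<in> {0..}" for t
  proof -
    have "((\<lambda>t. t ^ Suc k) has_field_derivative real (Suc k) * t ^ k) (at t within {0..})"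
      by (rule has_field_derivative_at_within) (use DERIV_pow[of "Suc k" t] in simp)
    from DERIV_cdivide[OF this, of "fact (Suc k)"]
    have p: "((\<lambda>t. t ^ m / fact m) has_field_derivative t ^ k / fact k) (at t within {0..})"
      unfolding m by (simp add: field_simps del: of_nat_Suc power_Suc)
    have "((\<lambda>t. exp (- (a * t))) has_field_derivative - a * exp (- (a * t))) (at t within {0..})"
      by (auto intro!: derivative_eq_intros)
    from DERIV_mult[OF p this]
    have "((\<lambda>t. t ^ m / fact m * exp (- (a * t))) has_field_derivative
        (t ^ k / fact k * exp (- (a * t)) - a * (t ^ m / fact m * exp (- (a * t))))) (at t within {0..})"
      by (simp add: mult_ac)
    from has_vector_derivative_scaleR[OF this T_has_vector_derivative[OF v]] t
    show ?thesis by (simp add: g_def[abs_def] g'_def)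
  qed
  have "norm (g' t) \<le> L" if t: "t \<in> {0..}" for t
  proof -
    have t0: "0 \<le> t" using that by simp
    have "norm (g' t) \<le> norm ((t ^ m / fact m * exp (- (a * t))) *\<^sub>R T t v') +
       norm ((t ^ k / fact k * exp (- (a * t)) - a * (t ^ m / fact m * exp (- (a * t)))) *\<^sub>R T t v)"
      unfolding g'_def by (rule norm_triangle_ineq)
    also have "norm ((t ^ m / fact m * exp (- (a * t))) *\<^sub>R T t v') \<le> inverse (a ^ m) * (M * norm v')"
      using mult_mono[OF power_exp_le[OF a t0, of m] bound[OF t0, of v']] a t0 by simp
    also have "norm ((t ^ k / fact k * exp (- (a * t)) - a * (t ^ m / fact m * exp (- (a * t)))) *\<^sub>R T t v)
        \<le> (inverse (a ^ k) + a * inverse (a ^ m)) * (M * norm v)"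
      unfolding norm_scaleR
    proof (rule mult_mono[OF _ bound[OF t0]])
      have "\<bar>t ^ k / fact k * exp (- (a * t)) - a * (t ^ m / fact m * exp (- (a * t)))\<bar>
         \<le> t ^ k / fact k * exp (- (a * t)) + a * (t ^ m / fact m * exp (- (a * t)))"
        using a t0 by (intro abs_triangle_ineq4[THEN order_trans]) (simp add: abs_mult)
      also have "\<dots> \<le> inverse (a ^ k) + a * inverse (a ^ m)"
        using a t0 by (intro add_mono mult_left_mono power_exp_le) auto
      finally show "\<bar>t ^ k / fact k * exp (- (a * t)) - a * (t ^ m / fact m * exp (- (a * t)))\<bar> \<le> inverse (a ^ k) + a * inverse (a ^ m)" .
    qed (use a in auto)
    finally show ?thesis unfolding L_def by simp
  qed
  hence on: "onorm (\<lambda>h. h *\<^sub>R g' t) \<le> L" if "t \<in> {0..}" for t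
    using that by (intro onorm_le) (subst mult.commute, simp add: mult_left_mono)
  have lip0: "norm (g t - g u) \<le> L * \<bar>t - u\<bar>" if "0 \<le> t" "0 \<le> u" for t u
    using differentiable_bound[where S = "{0..}" and f = g and f' = "\<lambda>t h. h *\<^sub>R g' t" and B = L and x = t and y = u] der on that
    by (auto simp: has_vector_derivative_def convex_real_interval)
  have orb: "orb m a v t = g (max 0 t)" for t by (auto simp: orb_def g_def m max_def)
  have L0: "0 \<le> L" using lip0[of 0 1] order_trans[OF norm_ge_zero lip0[of 0 1]] by simp
  have "norm (orb m a v t - orb m a v u) \<le> L * \<bar>t - u\<bar>" for t u
  proof -
    have "norm (orb m a v t - orb m a v u) \<le> L * \<bar>max 0 t - max 0 u\<bar>"
      unfolding orb by (rule lip0) auto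
    also have "\<dots> \<le> L * \<bar>t - u\<bar>" by (rule mult_left_mono[OF _ L0]) (auto simp: max_def)
    finally show ?thesis .
  qed
  thus ?thesis by blast
qed

text \<open>The lower Gaussian estimate for \<open>v\<close> and the upper one for \<open>x\<close>
  enclose the comparison of transforms. After multiplication by \<open>b / c\<close> the error is of
  order \<open>1 / b\<close> and vanishes along \<open>b = Suc n\<close>.\<close>

lemma plancherel_orb:
  assumes a: "0 < a" and K: "0 \<le> K" and m: "m = Suc k" and v: "(v, v') \<in> generator T"
    and le: "\<And>s. norm (lp (real m + 1) (Complex a s) v) \<le> K * norm (res (Complex a s) x)"
  shows "(\<integral>t. (norm (orb m a v t))\<^sup>2 \<partial>lborel) \<le> K\<^sup>2 * (\<integral>t. (norm (orb 0 a x t))\<^sup>2 \<partial>lborel)"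
proof -
  define A where "A = (\<integral>t. (norm (orb m a v t))\<^sup>2 \<partial>lborel)"
  define B where "B = (\<integral>t. norm (orb m a v t) \<partial>lborel)"
  define D where "D = (\<integral>t. (norm (orb 0 a x t))\<^sup>2 \<partial>lborel)"
  obtain L where L: "\<And>t u. norm (orb m a v t - orb m a v u) \<le> L * \<bar>t - u\<bar>"
    using orb_lipschitz[OF a v m] by blast
  interpret V: fourier_pair "orb m a v" "\<lambda>s. lp (real m + 1) (Complex a s) v"
    by (rule fourier_pair_orb[OF a])
  interpret X: fourier_pair "orb 0 a x" "\<lambda>s. res (Complex a s) x"
    using fourier_pair_orb[OF a, of 0 x] by simp
  define c where "c = sqrt (2 * pi)"
  have c: "c > 0" by (simp add: c_def)
  have key: "A - K\<^sup>2 * D \<le> (2 * L * B / c) * inverse b" if b: "0 < b" for b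
  proof -
    have "c / b * A - L * (2 / b\<^sup>2) * B \<le> (\<integral>\<xi>. (norm (lp (real m + 1) (Complex a (b * \<xi>)) v))\<^sup>2 \<partial>std_normal_distribution)"
      using V.gaussian_plancherel_lower[OF b L] by (simp only: A_def B_def c_def)
    also have "\<dots> \<le> (\<integral>\<xi>. K\<^sup>2 * (norm (res (Complex a (b * \<xi>)) x))\<^sup>2 \<partial>std_normal_distribution)"
    proof (rule integral_mono)
      show "(norm (lp (real m + 1) (Complex a (b * \<xi>)) v))\<^sup>2 \<le> K\<^sup>2 * (norm (res (Complex a (b * \<xi>)) x))\<^sup>2" for \<xi>
        using power_mono[OF le[of "b * \<xi>"], of 2] by (simp add: power_mult_distrib)
    qed (use V.gaussian_plancherel(1)[of b] X.gaussian_plancherel(1)[of b] in auto)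
    also have "\<dots> = K\<^sup>2 * (\<integral>\<xi>. (norm (res (Complex a (b * \<xi>)) x))\<^sup>2 \<partial>std_normal_distribution)"
      by (rule integral_mult_right_zero)
    also have "\<dots> \<le> K\<^sup>2 * (c / b * D)"
      using X.gaussian_plancherel_upper[OF b] by (intro mult_left_mono) (auto simp: c_def D_def)
    finally have "c / b * (A - K\<^sup>2 * D) \<le> L * (2 / b\<^sup>2) * B" by (simp add: algebra_simps)
    hence "(b / c) * (c / b * (A - K\<^sup>2 * D)) \<le> (b / c) * (L * (2 / b\<^sup>2) * B)"
      using c b by (intro mult_left_mono) auto
    moreover have "(b / c) * (c / b * (A - K\<^sup>2 * D)) = A - K\<^sup>2 * D" using c b by simp
    moreover have "(b / c) * (L * (2 / b\<^sup>2) * B) = (2 * L * B / c) * inverse b"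
      using c b by (simp add: power2_eq_square field_simps)
    ultimately show ?thesis by (simp only:)
  qed
  have "(\<lambda>n. (2 * L * B / c) * inverse (real (Suc n))) \<longlonglongrightarrow> (2 * L * B / c) * 0"
    by (intro tendsto_intros LIMSEQ_inverse_real_of_nat)
  hence "A - K\<^sup>2 * D \<le> (2 * L * B / c) * 0"
    by (rule LIMSEQ_le_const) (use key in auto)
  thus ?thesis by (simp add: A_def D_def)
qed

text \<open>A square integral controls a single time because
  \<open>norm (T (1 / a) v) \<le> M * norm (T t v)\<close> for \<open>t \<le> 1 / a\<close>. The
  length \<open>1 / (2 * a)\<close> of the interval used cancels against the integral of
  \<open>exp (- (2 * a * t))\<close>, which bounds the orbit of \<open>x\<close>.\<close>

lemma norm_T_le_of_resolvent_bound:
  assumes a: "0 < a" and K: "0 \<le> K" and m: "m = Suc k" and v: "(v, v') \<in> generator T"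
    and le: "\<And>s. norm (lp (real m + 1) (Complex a s) v) \<le> K * norm (res (Complex a s) x)"
  shows "norm (T (1 / a) v) \<le> M\<^sup>2 * fact m * exp 1 * K * (2 * a) ^ m * norm x"
proof -
  interpret V: fourier_pair "orb m a v" "\<lambda>s. lp (real m + 1) (Complex a s) v"
    by (rule fourier_pair_orb[OF a])
  interpret X: fourier_pair "orb 0 a x" "\<lambda>s. res (Complex a s) x"
    using fourier_pair_orb[OF a, of 0 x] by simp
  define E where "E t = indicator {0..} t * gdens 1 (2 * a) t" for t
  have E: "integrable lborel E" "(\<integral>t. E t \<partial>lborel) = 1 / (2 * a)"
  proof -
    show i: "integrable lborel E"
      unfolding E_def by (rule gamma_density_integrable) (use a in auto)
    have "(\<integral>t. E t \<partial>lborel) = (2 * a) powr - 1"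
      using gamma_density_nn_integral[of 1 "2 * a"] i a unfolding E_def by (subst integral_eq_nn_integral) auto
    thus "(\<integral>t. E t \<partial>lborel) = 1 / (2 * a)" using a by (simp add: powr_minus_divide)
  qed
  have upper: "(\<integral>t. (norm (orb 0 a x t))\<^sup>2 \<partial>lborel) \<le> (M * norm x)\<^sup>2 * (1 / (2 * a))"
  proof -
    have "(\<integral>t. (norm (orb 0 a x t))\<^sup>2 \<partial>lborel) \<le> (\<integral>t. (M * norm x)\<^sup>2 * E t \<partial>lborel)"
    proof (rule integral_mono[OF X.int2])
      fix t
      show "(norm (orb 0 a x t))\<^sup>2 \<le> (M * norm x)\<^sup>2 * E t"
      proof (cases "0 < t")
        case True
        have "(exp (- (a * t)) * norm (T t x))\<^sup>2 \<le> (exp (- (a * t)) * (M * norm x))\<^sup>2"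
          using bound[of t x] True by (intro power_mono mult_left_mono) auto
        also have "\<dots> = (M * norm x)\<^sup>2 * E t"
          using True by (simp add: E_def power_mult_distrib mult_ac flip: exp_double)
        finally show ?thesis using True by (simp add: orb_def power_mult_distrib)
      qed (simp add: orb_def E_def)
    qed (use E in auto)
    thus ?thesis using E by simp
  qed
  \<comment> \<open>A lower bound for the weighted orbit on \<open>{1 / (2 * a)..1 / a}\<close>: the
    power is smallest at the left end, the exponential at the right end.\<close>
  define q where "q = (1 / (2 * a)) ^ m / fact m * exp (- 1) * (norm (T (1 / a) v) / M)"
  have q0: "0 \<le> q" using a M_ge_1 by (simp add: q_def)
  have lower: "1 / (2 * a) * q\<^sup>2 \<le> (\<integral>t. (norm (orb m a v t))\<^sup>2 \<partial>lborel)"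
  proof -
    have "(\<integral>t. indicator {1 / (2 * a)..1 / a} t * q\<^sup>2 \<partial>lborel) \<le> (\<integral>t. (norm (orb m a v t))\<^sup>2 \<partial>lborel)"
    proof (rule integral_mono[OF _ V.int2])
      show "integrable lborel (\<lambda>t. indicator {1 / (2 * a)..1 / a} t * q\<^sup>2)"
        by (intro integrable_mult_left integrable_real_indicator) (auto simp: emeasure_lborel_Icc_eq)
      fix t
      show "indicator {1 / (2 * a)..1 / a} t * q\<^sup>2 \<le> (norm (orb m a v t))\<^sup>2"
      proof (cases "t \<in> {1 / (2 * a)..1 / a}")
        case True
        have t: "0 < t" using True a by (auto intro: less_le_trans[of _ "1 / (2 * a)"])
        have "norm (T (1 / a) v) = norm (T (1 / a - t) (T t v))"
          using T_plus[of "1 / a - t" t v] True t by simp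
        also have "\<dots> \<le> M * norm (T t v)" by (rule bound) (use True in auto)
        finally have n1: "norm (T (1 / a) v) / M \<le> norm (T t v)" using M_ge_1 by (simp add: divide_le_eq mult.commute)
        have n2: "(1 / (2 * a)) ^ m / fact m * exp (- 1) \<le> t ^ m / fact m * exp (- (a * t))"
          using True a t by (intro mult_mono divide_right_mono power_mono) (auto simp: field_simps)
        have "q \<le> t ^ m / fact m * exp (- (a * t)) * norm (T t v)"
          unfolding q_def by (rule mult_mono[OF n2 n1]) (use t a M_ge_1 in auto)
        hence "q \<le> norm (orb m a v t)" using t by (simp add: orb_def)
        thus ?thesis using True q0 by (simp add: power_mono)
      qed simp
    qed
    moreover have "(\<integral>t. indicator {1 / (2 * a)..1 / a} t * q\<^sup>2 \<partial>lborel) = 1 / (2 * a) * q\<^sup>2"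
      using a by (simp add: field_simps)
    ultimately show ?thesis by simp
  qed
  have "1 / (2 * a) * q\<^sup>2 \<le> K\<^sup>2 * ((M * norm x)\<^sup>2 * (1 / (2 * a)))"
    using order_trans[OF lower plancherel_orb[OF a K m v le]] mult_left_mono[OF upper, of "K\<^sup>2"] by simp
  hence "q\<^sup>2 \<le> (K * (M * norm x))\<^sup>2" using a by (simp add: power_mult_distrib field_simps)
  hence "q \<le> K * (M * norm x)" by (rule power2_le_imp_le) (use K M_ge_1 in auto)
  hence "M * fact m * exp 1 * (2 * a) ^ m * q \<le> M * fact m * exp 1 * (2 * a) ^ m * (K * (M * norm x))"
    using a M_ge_1 by (intro mult_left_mono) auto
  moreover have "M * fact m * exp 1 * (2 * a) ^ m * q = norm (T (1 / a) v)"
  proof -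
    have "(2 * a) ^ m * (1 / (2 * a)) ^ m = 1"
      using a unfolding power_mult_distrib[symmetric] by simp
    moreover have "exp (1::real) * exp (- 1) = 1" by (simp flip: exp_add)
    moreover have "M * fact m * exp 1 * (2 * a) ^ m * q =
        ((2 * a) ^ m * (1 / (2 * a)) ^ m) * (exp 1 * exp (- 1)) * (M / M) * (fact m / fact m) * norm (T (1 / a) v)"
      by (simp add: q_def)
    ultimately show ?thesis using M_ge_1 by simp
  qed
  ultimately show ?thesis by (simp add: power2_eq_square mult_ac)
qed

end


section \<open>Decay rates\<close>

context bounded_C0_semigroup
begin

text \<open>An approximation of the identity for large \<open>r\<close>, bounded by \<open>M\<close>
  for all \<open>r\<close>, that acts as a smooth cut-off to frequencies below
  \<open>r\<close>.\<close>

definition rr :: "real \<Rightarrow> 'a \<Rightarrow> 'a" where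
  "rr r x = r *\<^sub>R res (of_real r) x"

lemma norm_rr: "0 < r \<Longrightarrow> norm (rr r x) \<le> M * norm x"
  using norm_lp[of 1 "of_real r" x] by (simp add: rr_def powr_minus field_simps)

lemma norm_rr_funpow: "0 < r \<Longrightarrow> norm ((rr r ^^ k) x) \<le> M ^ k * norm x"
proof (induction k)
  case (Suc k)
  have "norm ((rr r ^^ Suc k) x) \<le> M * norm ((rr r ^^ k) x)"
    using norm_rr[OF Suc.prems] by simp
  also have "\<dots> \<le> M * (M ^ k * norm x)"
    using Suc M_ge_1 by (intro mult_left_mono) auto
  finally show ?case by simp
qed simp

lemma bounded_linear_rr: "0 < r \<Longrightarrow> bounded_linear (rr r)"
  unfolding rr_def by (rule bounded_linear_compose[OF bounded_linear_scaleR_right bounded_linear_lp]) auto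

lemma rr_scaleC: "0 < r \<Longrightarrow> rr r (c *\<^sub>C x) = c *\<^sub>C rr r x"
  by (simp add: rr_def lp_scaleC scaleR_scaleC scaleC_scaleC mult.commute)

lemma rr_lp: "0 < r \<Longrightarrow> 0 < g \<Longrightarrow> 0 < Re z \<Longrightarrow> rr r (lp g z x) = lp g z (rr r x)"
  by (rule lp_commute) (auto simp: bounded_linear_rr rr_scaleC, simp add: rr_def lp_T T_scaleR)

lemma rr_funpow_lp: "0 < r \<Longrightarrow> 0 < g \<Longrightarrow> 0 < Re z \<Longrightarrow> (rr r ^^ k) (lp g z x) = lp g z ((rr r ^^ k) x)"
  by (induction k) (auto simp: rr_lp)

lemma rr_funpow_diff_scaleC: "0 < r \<Longrightarrow> (rr r ^^ k) (c *\<^sub>C (x - y)) = c *\<^sub>C ((rr r ^^ k) x - (rr r ^^ k) y)"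
proof (induction k)
  case (Suc k)
  thus ?case
    using bounded_linear.linear[OF bounded_linear_rr[OF Suc.prems]] by (simp add: rr_scaleC linear_diff)
qed simp

lemma norm_shift_ge:
  assumes "1 \<le> r" "0 < a" "a \<le> 1 / 2"
  shows "r + \<bar>s\<bar> \<le> 4 * cmod (of_real r - Complex a s)"
proof -
  have "\<bar>r - a\<bar> \<le> cmod (of_real r - Complex a s)" "\<bar>s\<bar> \<le> cmod (of_real r - Complex a s)"
    using abs_Re_le_cmod[of "of_real r - Complex a s"] abs_Im_le_cmod[of "of_real r - Complex a s"] by auto
  thus ?thesis using assms by linarith
qed

text \<open>Telescoping: on the domain, one factor changes a vector by the resolvent at
  \<open>r\<close> applied to its image under the generator, which is of size \<open>1 / r\<close>.
  The constant depends on \<open>n\<close> but not on \<open>r\<close>.\<close>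

lemma res_minus_rr_funpow:
  "\<exists>e\<ge>0. \<forall>r y. 0 < r \<longrightarrow> norm (res 1 y - (rr r ^^ n) (res 1 y)) \<le> e / r * norm y"
proof (induction n)
  case (Suc n)
  then obtain e where e: "e \<ge> 0" "\<And>r y. 0 < r \<Longrightarrow> norm (res 1 y - (rr r ^^ n) (res 1 y)) \<le> e / r * norm y"
    by blast
  have "norm (res 1 y - (rr r ^^ Suc n) (res 1 y)) \<le> (M * (M + 1) + M * e) / r * norm y" if r: "0 < r" for r y
  proof -
    define g where "g = res 1 y"
    have g: "norm g \<le> M * norm y" using norm_lp[of 1 1 y] by (simp add: g_def)
    have "(g, g - y) \<in> generator T" using res_in_generator[of 1 y] by (simp add: g_def)
    from res_generator[OF this, of "of_real r"] r
    have "g = res (of_real r) (of_real r *\<^sub>C g - (g - y))" by simp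
    also have "\<dots> = rr r g - res (of_real r) (g - y)"
      using r by (simp add: rr_def lp_diff linear_scale[OF bounded_linear.linear[OF bounded_linear_lp]] scaleC_of_real)
    finally have "g - rr r g = - res (of_real r) (g - y)" by (simp add: algebra_simps)
    hence "norm (g - rr r g) = norm (res (of_real r) (g - y))" by simp
    also have "\<dots> \<le> M / r * norm (g - y)"
      using norm_lp[of 1 "of_real r" "g - y"] r by (simp add: powr_minus divide_inverse)
    also have "\<dots> \<le> M / r * ((M + 1) * norm y)"
      using norm_triangle_ineq4[of g y] g M_ge_1 r by (intro mult_left_mono) (auto simp: algebra_simps)
    finally have 1: "norm (g - rr r g) \<le> M / r * ((M + 1) * norm y)" .
    have "rr r g - (rr r ^^ Suc n) g = rr r (g - (rr r ^^ n) g)"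
      using bounded_linear.linear[OF bounded_linear_rr[OF r]] by (simp add: linear_diff)
    hence "norm (rr r g - (rr r ^^ Suc n) g) \<le> M * norm (g - (rr r ^^ n) g)"
      using norm_rr[OF r] by simp
    also have "\<dots> \<le> M * (e / r * norm y)"
      unfolding g_def using M_ge_1 by (intro mult_left_mono e(2)[OF r]) auto
    finally have 2: "norm (rr r g - (rr r ^^ Suc n) g) \<le> M * (e / r * norm y)" .
    from norm_diff_triangle_le[OF 1 2]
    have "norm (g - (rr r ^^ Suc n) g) \<le> M / r * ((M + 1) * norm y) + M * (e / r * norm y)" .
    also have "\<dots> = (M * (M + 1) + M * e) / r * norm y" using r by (simp add: field_simps)
    finally show ?thesis unfolding g_def .
  qed
  moreover have "0 \<le> M * (M + 1) + M * e" using M_ge_1 e(1) by simp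
  ultimately show ?case by blast
qed auto

section \<open>Decay from polynomial resolvent growth\<close>

context
  fixes K \<alpha> :: real
  assumes K: "0 \<le> K" and res: "\<And>a s x. 0 < a \<Longrightarrow> a \<le> 1 / 2 \<Longrightarrow>
      norm (res (Complex a s) x) \<le> K * (1 + \<bar>s\<bar>) powr \<alpha> * norm x"
    and \<alpha>: "0 < \<alpha>"
begin

text \<open>Each factor \<open>r R(r)\<close> gains a factor \<open>r / (r + |s|)\<close> at frequency \<open>s\<close>, so \<open>k \<ge> \<alpha>\<close> of them
  turn the growth \<open>|s| powr \<alpha>\<close> of the resolvent into \<open>min |s| r powr \<alpha>\<close>.\<close>

lemma res_rr_funpow_bound_aux:
  shows "\<exists>c\<ge>0. \<forall>r a s x. 1 \<le> r \<longrightarrow> 0 < a \<longrightarrow> a \<le> 1 / 2 \<longrightarrow>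
    norm (res (Complex a s) ((rr r ^^ k) x)) \<le> c * ((min 1 (r / (1 + \<bar>s\<bar>))) ^ k * (1 + \<bar>s\<bar>) powr \<alpha> + 1) * norm x"
proof (induction k)
  case 0
  have "norm (res (Complex a s) x) \<le> K * ((1 + \<bar>s\<bar>) powr \<alpha> + 1) * norm x" if "0 < a" "a \<le> 1 / 2" for a s x
  proof -
    have "K * (1 + \<bar>s\<bar>) powr \<alpha> * norm x \<le> K * ((1 + \<bar>s\<bar>) powr \<alpha> + 1) * norm x"
      using K by (intro mult_right_mono mult_left_mono) auto
    with res[OF that, of s x] show ?thesis by linarith
  qed
  thus ?case using K by (intro exI[of _ K]) auto
next
  case (Suc k)
  then obtain c where c: "c \<ge> 0" "\<And>r a s x. 1 \<le> r \<Longrightarrow> 0 < a \<Longrightarrow> a \<le> 1 / 2 \<Longrightarrow>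
    norm (res (Complex a s) ((rr r ^^ k) x)) \<le> c * ((min 1 (r / (1 + \<bar>s\<bar>))) ^ k * (1 + \<bar>s\<bar>) powr \<alpha> + 1) * norm x"
    by blast
  have "norm (res (Complex a s) ((rr r ^^ Suc k) x)) \<le>
     (4 * (c + M ^ Suc k)) * ((min 1 (r / (1 + \<bar>s\<bar>))) ^ Suc k * (1 + \<bar>s\<bar>) powr \<alpha> + 1) * norm x"
    if r: "1 \<le> r" and a: "0 < a" "a \<le> 1 / 2" for r a s x
  proof -
    define z where "z = Complex a s"
    define y where "y = (rr r ^^ k) x"
    define q where "q = min 1 (r / (1 + \<bar>s\<bar>))"
    define W where "W = (1 + \<bar>s\<bar>) powr \<alpha>"
    have r0: "0 < r" using r by simp
    have q: "0 \<le> q" "q \<le> 1" using r by (auto simp: q_def)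
    have W: "0 \<le> W" by (simp add: W_def)
    have d: "0 < cmod (of_real r - z)" "r / cmod (of_real r - z) \<le> 4 * q"
    proof -
      have ge: "r + \<bar>s\<bar> \<le> 4 * cmod (of_real r - z)" unfolding z_def by (rule norm_shift_ge[OF r a])
      show pos: "0 < cmod (of_real r - z)" using ge r by linarith
      have "r / cmod (of_real r - z) \<le> 4 * (r / (1 + \<bar>s\<bar>))"
      proof -
        have "r * (1 + \<bar>s\<bar>) \<le> r * (4 * cmod (of_real r - z))" using ge r by (intro mult_left_mono) linarith+
        thus ?thesis using pos by (simp add: field_simps)
      qed
      moreover have "r / cmod (of_real r - z) \<le> 4" using ge pos by (simp add: divide_le_eq)
      ultimately show "r / cmod (of_real r - z) \<le> 4 * q" by (simp add: q_def min_def)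
    qed
    \<comment> \<open>A product of two resolvents is traded for their difference divided by
      \<open>of_real r - z\<close>, which is the gain. The term at \<open>r\<close> is bounded in
      \<open>s\<close> and accounts for the summand 1 in the estimate.\<close>
    have "res z y - res (of_real r) y = (of_real r - z) *\<^sub>C res z (res (of_real r) y)"
      by (rule res_identity) (use a r0 in \<open>auto simp: z_def\<close>)
    moreover have "res z (rr r y) = r *\<^sub>R res z (res (of_real r) y)"
      using a by (simp add: rr_def z_def linear_scale[OF bounded_linear.linear[OF bounded_linear_lp]])
    ultimately have "norm (res z (rr r y)) = r / cmod (of_real r - z) * norm (res z y - res (of_real r) y)"
      using d r0 by (simp add: norm_scaleC)
    also have "\<dots> \<le> (4 * q) * norm (res z y - res (of_real r) y)"
      using d by (intro mult_right_mono) auto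
    also have "norm (res z y - res (of_real r) y) \<le> c * (q ^ k * W + 1) * norm x + M ^ Suc k * norm x"
    proof -
      have "norm (res z y) \<le> c * (q ^ k * W + 1) * norm x"
        unfolding z_def y_def q_def W_def by (rule c(2)[OF r a])
      moreover have "norm (res (of_real r) y) \<le> M * norm y"
      proof -
        have "norm (res (of_real r) y) \<le> M * (1 / r) * norm y"
          using norm_lp[of 1 "of_real r" y] r0 by (simp add: powr_minus divide_inverse)
        also have "\<dots> \<le> M * 1 * norm y"
          using r M_ge_1 by (intro mult_right_mono mult_left_mono) auto
        finally show ?thesis by simp
      qed
      moreover have "M * norm y \<le> M * (M ^ k * norm x)"
        unfolding y_def using M_ge_1 by (intro mult_left_mono norm_rr_funpow[OF r0]) auto
      ultimately show ?thesis using norm_triangle_ineq4[of "res z y" "res (of_real r) y"] by simp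
    qed
    also have "4 * q * (c * (q ^ k * W + 1) * norm x + M ^ Suc k * norm x) \<le>
        (4 * (c + M ^ Suc k)) * (q ^ Suc k * W + 1) * norm x"
    proof -
      have "q * (c * (q ^ k * W + 1) + M ^ Suc k) = c * (q ^ Suc k * W) + q * (c + M ^ Suc k)"
        by (simp add: algebra_simps)
      also have "\<dots> \<le> (c + M ^ Suc k) * (q ^ Suc k * W) + 1 * (c + M ^ Suc k)"
        using q c(1) M_ge_1 W by (intro add_mono mult_right_mono) auto
      also have "\<dots> = (c + M ^ Suc k) * (q ^ Suc k * W + 1)" by (simp add: algebra_simps)
      finally have "4 * norm x * (q * (c * (q ^ k * W + 1) + M ^ Suc k)) \<le> 4 * norm x * ((c + M ^ Suc k) * (q ^ Suc k * W + 1))"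
        by (intro mult_left_mono) auto
      thus ?thesis by (simp add: algebra_simps)
    qed
    finally have "norm (res z (rr r y)) \<le> (4 * (c + M ^ Suc k)) * (q ^ Suc k * W + 1) * norm x"
      using q by (simp add: mult_left_mono)
    thus ?thesis unfolding z_def y_def q_def W_def by simp
  qed
  thus ?case using c(1) M_ge_1 by (intro exI[of _ "4 * (c + M ^ Suc k)"]) auto
qed

text \<open>With \<open>q = min 1 (r / w)\<close> one has \<open>q ^ k \<le> q powr \<alpha>\<close>
  and \<open>q * w = min w r\<close>; the summand 1 is absorbed because this minimum is at least
  1.\<close>

lemma res_rr_funpow_bound:
  assumes k: "\<alpha> \<le> real k"
  obtains c where "c \<ge> 0" and "\<And>r a s x. 1 \<le> r \<Longrightarrow> 0 < a \<Longrightarrow> a \<le> 1 / 2 \<Longrightarrow>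
    norm (res (Complex a s) ((rr r ^^ k) x)) \<le> c * (min (1 + \<bar>s\<bar>) r) powr \<alpha> * norm x"
proof -
  obtain c where c: "c \<ge> 0" "\<And>r a s x. 1 \<le> r \<Longrightarrow> 0 < a \<Longrightarrow> a \<le> 1 / 2 \<Longrightarrow>
    norm (res (Complex a s) ((rr r ^^ k) x)) \<le> c * ((min 1 (r / (1 + \<bar>s\<bar>))) ^ k * (1 + \<bar>s\<bar>) powr \<alpha> + 1) * norm x"
    using res_rr_funpow_bound_aux[of k] by blast
  have "norm (res (Complex a s) ((rr r ^^ k) x)) \<le> (2 * c) * (min (1 + \<bar>s\<bar>) r) powr \<alpha> * norm x"
    if r: "1 \<le> r" and a: "0 < a" "a \<le> 1 / 2" for r a s x
  proof -
    define w where "w = 1 + \<bar>s\<bar>"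
    define q where "q = min 1 (r / w)"
    have w: "1 \<le> w" by (simp add: w_def)
    have q: "0 < q" "q \<le> 1" using r w by (auto simp: q_def)
    have "q ^ k = q powr real k" using q by (simp add: powr_realpow)
    also have "\<dots> \<le> q powr \<alpha>" using q k by (intro powr_mono') auto
    finally have "q ^ k * w powr \<alpha> \<le> q powr \<alpha> * w powr \<alpha>" by (rule mult_right_mono) simp
    also have "\<dots> = (q * w) powr \<alpha>" using q w by (simp add: powr_mult)
    also have "q * w = min w r" using w by (auto simp: q_def min_def field_simps)
    finally have "q ^ k * w powr \<alpha> + 1 \<le> 2 * min w r powr \<alpha>"
      using ge_one_powr_ge_zero[of "min w r" \<alpha>] w r \<alpha> by simp
    hence "c * (q ^ k * w powr \<alpha> + 1) * norm x \<le> c * (2 * min w r powr \<alpha>) * norm x"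
      using c(1) by (intro mult_right_mono mult_left_mono) auto
    with c(2)[OF r a, of s x] show ?thesis unfolding w_def q_def by simp
  qed
  with c(1) show thesis by (intro that[of "2 * c"]) auto
qed

text \<open>One resolvent stays on the right for the comparison with the orbit of \<open>y\<close>.
  Each of the other \<open>Suc m\<close> is paired with \<open>k\<close> factors \<open>rr r\<close>
  and costs \<open>min (1 + \<bar>s\<bar>) r powr \<alpha>\<close>; the divisor
  \<open>1 + \<bar>s\<bar>\<close> is due to \<open>res 1\<close>.\<close>

lemma lp_rr_res_bound:
  assumes k: "\<alpha> \<le> real k"
  shows "\<exists>c\<ge>0. \<forall>r a s y. 1 \<le> r \<longrightarrow> 0 < a \<longrightarrow> a \<le> 1 / 2 \<longrightarrow>
    norm (lp (real (Suc m) + 1) (Complex a s) ((rr r ^^ (Suc m * k)) (res 1 y))) \<le>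
      c * (min (1 + \<bar>s\<bar>) r powr (real (Suc m) * \<alpha>) / (1 + \<bar>s\<bar>)) * norm (res (Complex a s) y)"
proof -
  obtain c where c: "c \<ge> 0" "\<And>r a s x. 1 \<le> r \<Longrightarrow> 0 < a \<Longrightarrow> a \<le> 1 / 2 \<Longrightarrow>
    norm (res (Complex a s) ((rr r ^^ k) x)) \<le> c * (min (1 + \<bar>s\<bar>) r) powr \<alpha> * norm x"
    using res_rr_funpow_bound[OF k] by blast
  show ?thesis
  proof (induction m)
    case 0
    have "norm (lp 2 (Complex a s) ((rr r ^^ k) (res 1 y))) \<le>
      (4 * (c + M ^ Suc k)) * (min (1 + \<bar>s\<bar>) r powr \<alpha> / (1 + \<bar>s\<bar>)) * norm (res (Complex a s) y)"
      if r: "1 \<le> r" and a: "0 < a" "a \<le> 1 / 2" for r a s y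
    proof -
      define z where "z = Complex a s"
      define u where "u = min (1 + \<bar>s\<bar>) r powr \<alpha>"
      define x where "x = res z y"
      have z: "0 < Re z" using a by (simp add: z_def)
      have r0: "0 < r" using r by simp
      have u: "1 \<le> u" unfolding u_def using r \<alpha> by (intro ge_one_powr_ge_zero) auto
      have ge: "1 + \<bar>s\<bar> \<le> 4 * cmod (1 - z)"
        using norm_shift_ge[of 1 a s] a by (simp add: z_def)
      hence d: "0 < cmod (1 - z)" by linarith
      have "lp 2 z ((rr r ^^ k) (res 1 y)) = res z (res z ((rr r ^^ k) (res 1 y)))"
        using lp_res[of 1 z "(rr r ^^ k) (res 1 y)"] z by simp
      also have "\<dots> = (rr r ^^ k) (res z (res 1 x))"
        using r0 z by (simp add: rr_funpow_lp x_def lp_lp[of 1 1 1 z])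
      \<comment> \<open>The divisor arises here once; the induction step uses only the factors
        \<open>rr r\<close>.\<close>
      also have "res z (res 1 x) = (1 / (1 - z)) *\<^sub>C (res z x - res 1 x)"
        using res_identity[of z 1 x] z d by (simp add: scaleC_scaleC)
      also have "(rr r ^^ k) ((1 / (1 - z)) *\<^sub>C (res z x - res 1 x)) =
          (1 / (1 - z)) *\<^sub>C (res z ((rr r ^^ k) x) - (rr r ^^ k) (res 1 x))"
        using r0 z by (simp add: rr_funpow_diff_scaleC rr_funpow_lp)
      finally have "norm (lp 2 z ((rr r ^^ k) (res 1 y))) =
          norm (res z ((rr r ^^ k) x) - (rr r ^^ k) (res 1 x)) / cmod (1 - z)"
        by (simp add: norm_scaleC norm_divide)
      also have "\<dots> \<le> (c * u * norm x + M ^ Suc k * norm x) / cmod (1 - z)"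
      proof (rule divide_right_mono)
        have "norm (res z ((rr r ^^ k) x)) \<le> c * u * norm x"
          unfolding z_def u_def by (rule c(2)[OF r a])
        moreover have "norm ((rr r ^^ k) (res 1 x)) \<le> M ^ k * (M * norm x)"
          using norm_rr_funpow[OF r0, of k "res 1 x"] norm_lp[of 1 1 x] M_ge_1
          by (auto intro: order_trans mult_left_mono)
        ultimately show "norm (res z ((rr r ^^ k) x) - (rr r ^^ k) (res 1 x)) \<le> c * u * norm x + M ^ Suc k * norm x"
          using norm_triangle_ineq4[of "res z ((rr r ^^ k) x)" "(rr r ^^ k) (res 1 x)"] by (simp add: mult_ac)
      qed simp
      also have "\<dots> \<le> (c + M ^ Suc k) * u * norm x / cmod (1 - z)"
      proof (rule divide_right_mono)
        have "M ^ Suc k * 1 * norm x \<le> M ^ Suc k * u * norm x"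
          using u M_ge_1 by (intro mult_right_mono mult_left_mono) auto
        thus "c * u * norm x + M ^ Suc k * norm x \<le> (c + M ^ Suc k) * u * norm x" by (simp add: algebra_simps)
      qed simp
      also have "\<dots> \<le> (c + M ^ Suc k) * u * norm x * (4 / (1 + \<bar>s\<bar>))"
      proof -
        have "1 / cmod (1 - z) \<le> 4 / (1 + \<bar>s\<bar>)" using ge d by (simp add: field_simps)
        hence "(c + M ^ Suc k) * u * norm x * (1 / cmod (1 - z)) \<le> (c + M ^ Suc k) * u * norm x * (4 / (1 + \<bar>s\<bar>))"
          using c(1) u M_ge_1 by (intro mult_left_mono) auto
        thus ?thesis by simp
      qed
      also have "\<dots> = (4 * (c + M ^ Suc k)) * (u / (1 + \<bar>s\<bar>)) * norm x"
        by (simp only: times_divide_eq_right times_divide_eq_left mult_ac)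
      finally show ?thesis unfolding z_def u_def x_def .
    qed
    thus ?case using c(1) M_ge_1 by (intro exI[of _ "4 * (c + M ^ Suc k)"]) (auto simp: numeral_2_eq_2)
  next
    case (Suc m)
    then obtain b where b: "b \<ge> 0" "\<And>r a s y. 1 \<le> r \<Longrightarrow> 0 < a \<Longrightarrow> a \<le> 1 / 2 \<Longrightarrow>
      norm (lp (real (Suc m) + 1) (Complex a s) ((rr r ^^ (Suc m * k)) (res 1 y))) \<le>
      b * (min (1 + \<bar>s\<bar>) r powr (real (Suc m) * \<alpha>) / (1 + \<bar>s\<bar>)) * norm (res (Complex a s) y)"
      by blast
    have "norm (lp (real (Suc (Suc m)) + 1) (Complex a s) ((rr r ^^ (Suc (Suc m) * k)) (res 1 y))) \<le>
      (c * b) * (min (1 + \<bar>s\<bar>) r powr (real (Suc (Suc m)) * \<alpha>) / (1 + \<bar>s\<bar>)) * norm (res (Complex a s) y)"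
      if r: "1 \<le> r" and a: "0 < a" "a \<le> 1 / 2" for r a s y
    proof -
      define z where "z = Complex a s"
      define x where "x = (rr r ^^ (Suc m * k)) (res 1 y)"
      define u where "u = min (1 + \<bar>s\<bar>) r"
      have z: "0 < Re z" using a by (simp add: z_def)
      have r0: "0 < r" using r by simp
      have u: "1 \<le> u" using r by (simp add: u_def)
      have "(rr r ^^ (Suc (Suc m) * k)) (res 1 y) = (rr r ^^ k) x"
        by (simp add: x_def funpow_add flip: funpow_mult)
      hence "lp (real (Suc (Suc m)) + 1) z ((rr r ^^ (Suc (Suc m) * k)) (res 1 y)) = lp ((real (Suc m) + 1) + 1) z ((rr r ^^ k) x)"
        by (simp add: add_ac)
      also have "\<dots> = lp (real (Suc m) + 1) z (res z ((rr r ^^ k) x))"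
        by (rule lp_res) (use z in auto)
      also have "\<dots> = res z (lp (real (Suc m) + 1) z ((rr r ^^ k) x))"
        by (rule lp_lp) (use z in auto)
      also have "lp (real (Suc m) + 1) z ((rr r ^^ k) x) = (rr r ^^ k) (lp (real (Suc m) + 1) z x)"
        by (rule rr_funpow_lp[symmetric]) (use z r0 in auto)
      also have "norm (res z ((rr r ^^ k) (lp (real (Suc m) + 1) z x))) \<le> c * u powr \<alpha> * norm (lp (real (Suc m) + 1) z x)"
        unfolding z_def u_def by (rule c(2)[OF r a])
      also have "\<dots> \<le> c * u powr \<alpha> * (b * (u powr (real (Suc m) * \<alpha>) / (1 + \<bar>s\<bar>)) * norm (res z y))"
        unfolding z_def u_def x_def using c(1) by (intro mult_left_mono b(2)[OF r a]) auto
      also have "\<dots> = (c * b) * (u powr \<alpha> * u powr (real (Suc m) * \<alpha>) / (1 + \<bar>s\<bar>)) * norm (res z y)" by simp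
      also have "u powr \<alpha> * u powr (real (Suc m) * \<alpha>) = u powr (real (Suc (Suc m)) * \<alpha>)"
        by (simp add: algebra_simps flip: powr_add)
      finally show ?thesis by (simp add: z_def u_def)
    qed
    thus ?case using b(1) c(1) by (intro exI[of _ "c * b"]) auto
  qed
qed

text \<open>At time \<open>t\<close> the frequencies are split at \<open>r = t powr (1 / \<alpha>)\<close>: above \<open>r\<close> the factor \<open>R(1)\<close>
  alone gains \<open>1 / r\<close>, and below \<open>r\<close> the resolvent is at most of size \<open>r powr \<alpha> = t\<close>.\<close>

lemma norm_T_res_decay:
  obtains C where "C > 0" and "\<And>t x. 2 \<le> t \<Longrightarrow> norm (T t (res 1 x)) \<le> C * t powr (- 1 / \<alpha>) * norm x"
proof -
  obtain k :: nat where k: "\<alpha> \<le> real k" using real_arch_simple by blast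
  obtain m0 :: nat where m0: "1 / \<alpha> \<le> real m0" using real_arch_simple by blast
  define m where "m = Suc m0"
  \<comment> \<open>This makes the exponent \<open>real m * \<alpha> - 1\<close> nonnegative, so
    that the worst frequency is the splitting point \<open>r\<close>.\<close>
  have m\<alpha>: "1 \<le> real m * \<alpha>"
  proof -
    have "1 / \<alpha> * \<alpha> \<le> real m * \<alpha>" using m0 \<alpha> by (intro mult_right_mono) (auto simp: m_def)
    thus ?thesis using \<alpha> by simp
  qed
  define n where "n = m * k"
  obtain c where c: "c \<ge> 0" "\<And>r a s y. 1 \<le> r \<Longrightarrow> 0 < a \<Longrightarrow> a \<le> 1 / 2 \<Longrightarrow>
      norm (lp (real m + 1) (Complex a s) ((rr r ^^ n) (res 1 y))) \<le>
      c * (min (1 + \<bar>s\<bar>) r powr (real m * \<alpha>) / (1 + \<bar>s\<bar>)) * norm (res (Complex a s) y)"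
    using lp_rr_res_bound[OF k, of m0] unfolding m_def n_def by blast
  obtain e where e: "e \<ge> 0" "\<And>r y. 0 < r \<Longrightarrow> norm (res 1 y - (rr r ^^ n) (res 1 y)) \<le> e / r * norm y"
    using res_minus_rr_funpow[of n] by blast
  define C where "C = M * e + M\<^sup>2 * fact m * exp 1 * c * 2 ^ m"
  have C0: "C \<ge> 0" using e(1) c(1) M_ge_1 by (simp add: C_def)
  have le: "norm (T t (res 1 x)) \<le> C * t powr (- 1 / \<alpha>) * norm x" if t: "2 \<le> t" for t x
  proof -
    define r where "r = t powr (1 / \<alpha>)"
    have r: "1 \<le> r" unfolding r_def using t \<alpha> by (intro ge_one_powr_ge_zero) auto
    have rt: "1 / r = t powr (- 1 / \<alpha>)" by (simp add: r_def powr_minus_divide)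
    have rm: "r powr (real m * \<alpha>) = t ^ m" using t \<alpha> by (simp add: r_def powr_powr powr_realpow)
    define v where "v = (rr r ^^ n) (res 1 x)"
    have high: "norm (T t (res 1 x - v)) \<le> M * (e / r * norm x)"
    proof -
      have "norm (T t (res 1 x - v)) \<le> M * norm (res 1 x - v)" by (rule bound) (use t in simp)
      also have "\<dots> \<le> M * (e / r * norm x)"
        unfolding v_def using M_ge_1 r by (intro mult_left_mono e(2)) auto
      finally show ?thesis .
    qed
    have v: "v = res 1 ((rr r ^^ n) x)" unfolding v_def using r by (intro rr_funpow_lp) auto
    \<comment> \<open>Here \<open>a = 1 / t\<close>, which \<open>2 \<le> t\<close> keeps at most
      1/2; the double inverse matches the lemma being applied.\<close>
    have low: "norm (T (1 / (1 / t)) v) \<le> M\<^sup>2 * fact m * exp 1 * (c * (t ^ m / r)) * (2 * (1 / t)) ^ m * norm x"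
    proof (rule norm_T_le_of_resolvent_bound[OF _ _ m_def])
      show "(v, 1 *\<^sub>C v - (rr r ^^ n) x) \<in> generator T" unfolding v by (rule res_in_generator) simp
      fix s :: real
      define w where "w = 1 + \<bar>s\<bar>"
      have w: "1 \<le> w" by (simp add: w_def)
      \<comment> \<open>Shrinking the divisor to \<open>min w r\<close> treats low and high
        frequencies at once.\<close>
      have "min w r powr (real m * \<alpha>) / w \<le> t ^ m / r"
      proof -
        have "min w r powr (real m * \<alpha>) / w \<le> min w r powr (real m * \<alpha>) / min w r"
          using w r by (intro divide_left_mono) auto
        also have "\<dots> = min w r powr (real m * \<alpha> - 1)" using w r by (simp add: powr_diff)
        also have "\<dots> \<le> r powr (real m * \<alpha> - 1)" using w r m\<alpha> by (intro powr_mono2) auto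
        also have "\<dots> = t ^ m / r" using r by (simp add: powr_diff rm)
        finally show ?thesis .
      qed
      hence "c * (min w r powr (real m * \<alpha>) / w) * norm (res (Complex (1 / t) s) x) \<le> c * (t ^ m / r) * norm (res (Complex (1 / t) s) x)"
        using c(1) by (intro mult_right_mono mult_left_mono) auto
      moreover have "norm (lp (real m + 1) (Complex (1 / t) s) v) \<le> c * (min w r powr (real m * \<alpha>) / w) * norm (res (Complex (1 / t) s) x)"
        unfolding v_def w_def by (rule c(2)) (use r t in auto)
      ultimately show "norm (lp (real m + 1) (Complex (1 / t) s) v) \<le> c * (t ^ m / r) * norm (res (Complex (1 / t) s) x)"
        by linarith
    qed (use t c(1) r in auto)
    have "T t (res 1 x) = T t (res 1 x - v) + T (1 / (1 / t)) v" using t by (simp add: T_diff)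
    hence "norm (T t (res 1 x)) \<le> M * (e / r * norm x) + M\<^sup>2 * fact m * exp 1 * (c * (t ^ m / r)) * (2 * (1 / t)) ^ m * norm x"
      using norm_triangle_le[OF add_mono[OF high low]] by simp
    also have "M\<^sup>2 * fact m * exp 1 * (c * (t ^ m / r)) * (2 * (1 / t)) ^ m * norm x = M\<^sup>2 * fact m * exp 1 * c * 2 ^ m * (1 / r) * norm x"
      using t by (simp add: power_divide)
    also have "M * (e / r * norm x) + M\<^sup>2 * fact m * exp 1 * c * 2 ^ m * (1 / r) * norm x = C * (1 / r) * norm x"
      by (simp add: C_def algebra_simps add_divide_distrib)
    finally show ?thesis unfolding rt .
  qed
  have "norm (T t (res 1 x)) \<le> (C + 1) * t powr (- 1 / \<alpha>) * norm x" if "2 \<le> t" for t x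
  proof -
    have "C * t powr (- 1 / \<alpha>) * norm x \<le> (C + 1) * t powr (- 1 / \<alpha>) * norm x"
      by (intro mult_right_mono) auto
    with le[OF that, of x] show ?thesis by linarith
  qed
  with C0 show thesis by (intro that[of "C + 1"]) auto
qed

end

text \<open>Subtracting from \<open>res 1 h\<close> its difference quotient gives an element of the
  range of \<open>res 1\<close>, by commutation with \<open>T t\<close>; as \<open>t\<close> tends
  to 0 it converges to \<open>res 1 h - (res 1 h - h) = h\<close>.\<close>

lemma res_range_dense:
  assumes "0 < e"
  obtains k where "norm (h - res 1 k) < e"
proof -
  have "(res 1 h, res 1 h - h) \<in> generator T" using res_in_generator[of 1 h] by simp
  hence "((\<lambda>t. res 1 h - (1 / t) *\<^sub>R (T t (res 1 h) - res 1 h)) \<longlongrightarrow> res 1 h - (res 1 h - h)) (at_right 0)"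
    unfolding generator_def by (intro tendsto_intros) auto
  hence "((\<lambda>t. res 1 h - (1 / t) *\<^sub>R (T t (res 1 h) - res 1 h)) \<longlongrightarrow> h) (at_right 0)" by simp
  from tendstoD[OF this assms]
  have "\<forall>\<^sub>F t in at_right 0. dist (res 1 h - (1 / t) *\<^sub>R (T t (res 1 h) - res 1 h)) h < e" .
  moreover have "\<forall>\<^sub>F t::real in at_right 0. 0 < t" by (simp add: eventually_at_right_less)
  ultimately have "\<exists>t>0. dist (res 1 h - (1 / t) *\<^sub>R (T t (res 1 h) - res 1 h)) h < e"
    using eventually_happens'[of "at_right (0::real)"] eventually_conj by (metis (no_types, lifting) trivial_limit_at_right_real)
  then obtain t where t: "0 < t" "dist (res 1 h - (1 / t) *\<^sub>R (T t (res 1 h) - res 1 h)) h < e" by blast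
  have "res 1 h - (1 / t) *\<^sub>R (T t (res 1 h) - res 1 h) = res 1 (h - (1 / t) *\<^sub>R (T t h - h))"
    using t(1) by (simp add: lp_diff lp_T linear_scale[OF bounded_linear.linear[OF bounded_linear_lp]])
  with t(2) that show thesis by (metis dist_norm norm_minus_commute)
qed

end


section \<open>The imaginary axis and the two decay rates\<close>

theorem theorem2p3:
  fixes T :: "real \<Rightarrow> 'a::complex_hilbert_space \<Rightarrow> 'a" and A :: "'a operator" and p \<beta> :: real
  assumes "C0_semigroup T" and "bounded_semigroup T" and "A = generator T"
    and "1 \<le> p" and "0 < \<beta>"
    and "\<And>x y. x \<in> Domain (neg_generator_power T \<beta>) \<Longrightarrow>
           (\<integral>\<^sup>+t\<in>{0..}. ennreal (cmod (cinner (T t x) y) powr p) \<partial>lborel) < \<infinity>"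
  shows "(\<forall>s::real. \<i> * complex_of_real s \<in> resolvent_set A)
    \<and> (\<lambda>t. onorm (\<lambda>x. T t (op_inverse A x))) \<in> O[at_top](\<lambda>t. t powr (- 1 / (p * \<beta>)))
    \<and> (\<forall>x\<in>Domain A. (\<lambda>t. norm (T t x)) \<in> o[at_top](\<lambda>t. t powr (- 1 / (p * \<beta>))))"
proof -
  obtain M0 where M0: "\<And>t. 0 \<le> t \<Longrightarrow> onorm (T t) \<le> M0"
    using assms(2) by (auto simp: bounded_semigroup_def bdd_above_def)
  have "norm (T t x) \<le> max 1 M0 * norm x" if t: "0 \<le> t" for t x
  proof -
    have "bounded_linear (T t)" using assms(1) t by (auto simp: C0_semigroup_def bounded_clinear_def)
    hence "norm (T t x) \<le> onorm (T t) * norm x" by (rule onorm)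
    also have "\<dots> \<le> max 1 M0 * norm x" using M0[OF t] by (intro mult_right_mono) auto
    finally show ?thesis .
  qed
  then interpret bounded_C0_semigroup T "max 1 M0"
    using assms(1) by unfold_locales auto
  define \<alpha> where "\<alpha> = p * \<beta>"
  have \<alpha>: "0 < \<alpha>" using assms(4,5) by (simp add: \<alpha>_def)
  obtain K where K: "K > 0" "\<And>a s x. 0 < a \<Longrightarrow> a \<le> 1 / 2 \<Longrightarrow>
      norm (res (Complex a s) x) \<le> K * (1 + \<bar>s\<bar>) powr \<alpha> * norm x"
    using res_polynomial_bound[OF assms(4-6)] unfolding \<alpha>_def by blast
  obtain C where C: "C > 0" "\<And>t x. 2 \<le> t \<Longrightarrow> norm (T t (res 1 x)) \<le> C * t powr (- 1 / \<alpha>) * norm x"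
    using norm_T_res_decay[OF less_imp_le[OF K(1)] K(2) \<alpha>] by blast
  have imag: "\<i> * complex_of_real s \<in> resolvent_set A" for s
  proof -
    obtain R where R: "bounded_clinear R" "\<And>w. (R w, (\<i> * of_real s) *\<^sub>C R w - w) \<in> A"
        "\<And>x y. (x, y) \<in> A \<Longrightarrow> R ((\<i> * of_real s) *\<^sub>C x - y) = x"
      using imaginary_in_resolvent_set[of s "K * (1 + \<bar>s\<bar>) powr \<alpha>"] K(2) unfolding assms(3) by blast
    have "{((\<i> * of_real s) *\<^sub>C x - y, x) |x y. (x, y) \<in> A} = {(w, R w) |w. True}"
    proof (intro set_eqI iffI)
      fix q assume "q \<in> {((\<i> * of_real s) *\<^sub>C x - y, x) |x y. (x, y) \<in> A}"
      thus "q \<in> {(w, R w) |w. True}" using R(3) by force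
    next
      fix q assume "q \<in> {(w, R w) |w. True}"
      then obtain w where "q = (w, R w)" by blast
      thus "q \<in> {((\<i> * of_real s) *\<^sub>C x - y, x) |x y. (x, y) \<in> A}"
        using R(2)[of w] by (auto intro!: exI[of _ "R w"] exI[of _ "(\<i> * of_real s) *\<^sub>C R w - w"])
    qed
    thus ?thesis using R(1) unfolding resolvent_set_def by blast
  qed
  have inverse: "(\<lambda>t. onorm (\<lambda>x. T t (op_inverse A x))) \<in> O[at_top](\<lambda>t. t powr (- 1 / \<alpha>))"
  proof -
    obtain R where R: "bounded_clinear R" "\<And>w. (R w, (\<i> * of_real 0) *\<^sub>C R w - w) \<in> A"
        "\<And>x y. (x, y) \<in> A \<Longrightarrow> R ((\<i> * of_real 0) *\<^sub>C x - y) = x"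
      using imaginary_in_resolvent_set[of 0 "K * (1 + \<bar>0\<bar>) powr \<alpha>"] K(2) unfolding assms(3) by blast
    have R_lin: "bounded_linear R" using R(1) by (simp add: bounded_clinear_def)
    obtain L where L: "L > 0" "\<And>w. norm (R w) \<le> norm w * L"
      using bounded_linear.pos_bounded[OF R_lin] by blast
    \<comment> \<open>\<open>R\<close> inverts \<open>0 - A\<close>, hence the sign. The left
      inverse property gives the uniqueness behind \<open>THE\<close>.\<close>
    have inv: "op_inverse A w = R (- w)" and inv_mem: "(R (- w), w) \<in> A" for w
    proof -
      show "(R (- w), w) \<in> A" using R(2)[of "- w"] by simp
      thus "op_inverse A w = R (- w)"
        unfolding op_inverse_def
      proof (rule the_equality)
        fix x assume "(x, w) \<in> A"
        from R(3)[OF this] show "x = R (- w)" by simp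
      qed
    qed
    have "norm (onorm (\<lambda>x. T t (op_inverse A x))) \<le> C * (L + 1) * norm (t powr (- 1 / \<alpha>))" if t: "2 \<le> t" for t
    proof -
      have le: "norm (T t (op_inverse A x)) \<le> C * (L + 1) * t powr (- 1 / \<alpha>) * norm x" for x
      proof -
        define g where "g = R (- x)"
        have "(g, x) \<in> generator T" using inv_mem[of x] by (simp add: g_def assms(3))
        \<comment> \<open>The decay estimate concerns \<open>res 1\<close>, so the preimage
          \<open>g\<close> of \<open>x\<close> is written as \<open>res 1\<close> of a vector of
          norm at most \<open>(L + 1) * norm x\<close>.\<close>
        from res_generator[OF this, of 1] have "g = res 1 (g - x)" by simp
        hence "norm (T t g) \<le> C * t powr (- 1 / \<alpha>) * norm (g - x)" using C(2)[OF t, of "g - x"] by simp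
        also have "\<dots> \<le> C * t powr (- 1 / \<alpha>) * ((L + 1) * norm x)"
          using C(1) L(2)[of "- x"] norm_triangle_ineq4[of g x]
          by (intro mult_left_mono) (auto simp: g_def algebra_simps)
        finally show ?thesis by (simp add: inv g_def mult_ac)
      qed
      have "onorm (\<lambda>x. T t (op_inverse A x)) \<le> C * (L + 1) * t powr (- 1 / \<alpha>)"
        by (rule onorm_bound) (use le C(1) L(1) in auto)
      moreover have "0 \<le> onorm (\<lambda>x. T t (op_inverse A x))"
        unfolding inv using t
        by (intro onorm_pos_le bounded_linear_compose[OF T_bounded_linear]
            bounded_linear_compose[OF R_lin] bounded_linear_minus bounded_linear_ident) auto
      ultimately show ?thesis by simp
    qed
    thus ?thesis
      by (intro bigoI[where c = "C * (L + 1)"] eventually_mono[OF eventually_ge_at_top[of 2]])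
  qed
  \<comment> \<open>Writing \<open>x = res 1 h\<close>, the vector \<open>h\<close> is approximated
    by some \<open>res 1 k\<close>. The error costs half of \<open>e\<close> times the rate, and on
    \<open>res 1 (res 1 k)\<close> each half of the time contributes the rate once.\<close>
  have small: "(\<lambda>t. norm (T t x)) \<in> o[at_top](\<lambda>t. t powr (- 1 / \<alpha>))" if x: "x \<in> Domain A" for x
  proof (rule landau_o.smallI)
    fix e :: real assume e: "e > 0"
    obtain y where "(x, y) \<in> generator T" using x assms(3) by blast
    from res_generator[OF this, of 1] have h: "x = res 1 (x - y)" by simp
    define h where "h = x - y"
    note h = h[folded h_def]
    obtain k where k: "norm (h - res 1 k) < e / (2 * C)"
      using res_range_dense[of "e / (2 * C)" h] e C(1) by auto
    define D where "D = C * (C * norm k)"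
    have "((\<lambda>t. D * (t / 2) powr (- 1 / \<alpha>) * 2 powr (1 / \<alpha>)) \<longlongrightarrow> D * 0 * 2 powr (1 / \<alpha>)) at_top"
    proof (intro tendsto_intros)
      show "((\<lambda>t::real. (t / 2) powr (- 1 / \<alpha>)) \<longlongrightarrow> 0) at_top" using \<alpha> by real_asymp
    qed
    hence "\<forall>\<^sub>F t in at_top. D * (t / 2) powr (- 1 / \<alpha>) * 2 powr (1 / \<alpha>) < e / 2"
      using e by (intro order_tendstoD(2)[of _ "D * 0 * 2 powr (1 / \<alpha>)"]) auto
    thus "\<forall>\<^sub>F t in at_top. norm (norm (T t x)) \<le> e * norm (t powr (- 1 / \<alpha>))"
      \<comment> \<open>From 4 on, the half time \<open>t / 2\<close> is admissible in
        \<open>C(2)\<close>.\<close>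
      using eventually_ge_at_top[of 4]
    proof eventually_elim
      case (elim t)
      have t: "0 < t" "2 \<le> t" "2 \<le> t / 2" using elim by auto
      define r where "r = t powr (- 1 / \<alpha>)"
      define r2 where "r2 = (t / 2) powr (- 1 / \<alpha>)"
      have r: "r2 = r * 2 powr (1 / \<alpha>)"
        using t by (simp add: r_def r2_def powr_divide powr_minus_divide)
      have "norm (T t (res 1 (h - res 1 k))) \<le> C * r * norm (h - res 1 k)"
        unfolding r_def by (rule C(2)[OF t(2)])
      also have "\<dots> \<le> C * r * (e / (2 * C))"
        using C(1) k by (intro mult_left_mono) (auto simp: r_def)
      also have "\<dots> = e / 2 * r" using C(1) by simp
      finally have 1: "norm (T t (res 1 (h - res 1 k))) \<le> e / 2 * r" .
      have "T t (res 1 (res 1 k)) = T (t / 2) (res 1 (T (t / 2) (res 1 k)))"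
        using T_plus[of "t / 2" "t / 2" "res 1 (res 1 k)"] t by (simp add: lp_T)
      hence "norm (T t (res 1 (res 1 k))) \<le> C * r2 * norm (T (t / 2) (res 1 k))"
        using C(2)[OF t(3)] by (simp add: r2_def)
      also have "\<dots> \<le> C * r2 * (C * r2 * norm k)"
        using C(1) C(2)[OF t(3), of k] by (intro mult_left_mono) (auto simp: r2_def)
      also have "\<dots> = (D * r2 * 2 powr (1 / \<alpha>)) * r" by (simp add: D_def r)
      also have "\<dots> \<le> e / 2 * r"
        using elim(1) by (intro mult_right_mono) (auto simp: r_def r2_def)
      finally have 2: "norm (T t (res 1 (res 1 k))) \<le> e / 2 * r" .
      have "T t x = T t (res 1 (h - res 1 k)) + T t (res 1 (res 1 k))"
        using t by (simp add: h lp_diff T_diff)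
      hence "norm (T t x) \<le> e / 2 * r + e / 2 * r" using norm_triangle_le[OF add_mono[OF 1 2]] by simp
      thus ?case by (simp add: r_def)
    qed
  qed
  show ?thesis using imag inverse small unfolding \<alpha>_def by blast
qed

end
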